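(* Let $\Omega\subset\mathbb{R}^n$ be an open and bounded domain which admits a perimeter bound for its inner parallel bodies. Let $d(x)=\operatorname{dist}(x,\partial\Omega)$ and $r=\max_{x\in\Omega}d(x)$. Then there is $t_*>0$ such that the initial value problem $$g'(t)=\frac{g(t)^2}{I_2(g(t))},\quad t>0,\qquad g(0)=0,$$ has a solution $g$ for $t\in[0,t_*]$. Furthermore, the function $$u(t,x)=\begin{cases}\min\left(\dfrac{1}{g(t)}d(x),\,r\right), & 0\le t<t_*,\\[2mm] \dfrac{1}{\|d\|_2^2}\left(\|d\|_2^2+t_*-t\right)_+ d(x), & t\ge t_*,\end{cases}$$ solves the gradient flow $u'(t)+\partial\mathcal{J}(u(t))\ni 0$, $u(0)=f$, with datum $f\equiv r$.
   Context: Inner parallel bodies: $\Omega_\tau=\{x\in\Omega: d(x)\ge\tau\}$; $P(\cdot)$ denotes the perimeter. $\Omega$ admits a perimeter bound for its inner parallel bodies if there are $\tilde r>0$ and $0<\tilde\tau\le\tilde r$ with $P(\Omega_\tau)\ge P(\Omega)\left(1-\frac{\tau}{\tilde r}\right)^{n-1}$ for all $0\le\tau\le\tilde\tau$. $I_2(g)=\int_{\Omega\setminus\Omega_{rg}}d(x)^2\,\mathrm{d}x$ for $0\le g\le 1$. $(a)_+=\max(a,0)$. At $t=0$ (where $g(0)=0$) the formula is understood as $u(0,x)=r$ for $x\in\Omega$. $W^{1,\infty}_0(\Omega)=\{u\in W^{1,\infty}(\Omega): u=0\text{ on }\partial\Omega\}$; $\mathcal{J}:L^2(\Omega)\to[0,\infty]$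 is $\mathcal{J}(u)=\|\nabla u\|_\infty$ if $u\in W^{1,\infty}_0(\Omega)$ and $+\infty$ otherwise; $\partial\mathcal{J}$ is its convex subdifferential in $L^2(\Omega)$, and the gradient flow is understood in $L^2(\Omega)$. *)

theory Defs
  imports "HOL-Analysis.Analysis" "HOL-Probability.Essential_Supremum"
begin

primrec Ck :: "nat \<Rightarrow> ('a::euclidean_space \<Rightarrow> 'b::real_normed_vector) \<Rightarrow> bool" where
  "Ck 0 = (\<lambda>f. continuous_on UNIV f)"
| "Ck (Suc k) = (\<lambda>f. (\<forall>x. f differentiable (at x)) \<and>
                    (\<forall>i\<in>Basis. Ck k (\<lambda>x. frechet_derivative f (at x) i)))"

definition supp :: "('a::euclidean_space \<Rightarrow> 'b::real_normed_vector) \<Rightarrow> 'a set" where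
  "supp f = closure {x. f x \<noteq> 0}"

definition test_functions :: "'a::euclidean_space set \<Rightarrow> ('a \<Rightarrow> real) set" where
  "test_functions \<Omega> = {\<phi>. (\<forall>k. Ck k \<phi>) \<and> compact (supp \<phi>) \<and> supp \<phi> \<subseteq> \<Omega>}"

definition locally_integrable ::
    "'a::euclidean_space set \<Rightarrow> ('a \<Rightarrow> 'b::euclidean_space) \<Rightarrow> bool" where
  "locally_integrable \<Omega> f \<longleftrightarrow> (\<forall>K. compact K \<and> K \<subseteq> \<Omega> \<longrightarrow> f absolutely_integrable_on K)"

definition has_weak_gradient ::
    "'a::euclidean_space set \<Rightarrow> ('a \<Rightarrow> real) \<Rightarrow> ('a \<Rightarrow> 'a) \<Rightarrow> bool" where
  "has_weak_gradient \<Omega> u G \<longleftrightarrow>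
     locally_integrable \<Omega> u \<and> locally_integrable \<Omega> G \<and>
     (\<forall>\<phi>\<in>test_functions \<Omega>. \<forall>i\<in>Basis.
        (\<integral>x. u x * frechet_derivative \<phi> (at x) i \<partial>(lebesgue_on \<Omega>)) =
        - (\<integral>x. (G x \<bullet> i) * \<phi> x \<partial>(lebesgue_on \<Omega>)))"

text \<open>Weak gradients are unique almost everywhere, so the choice below only selects a
  representative.\<close>

definition weak_gradient ::
    "'a::euclidean_space set \<Rightarrow> ('a \<Rightarrow> real) \<Rightarrow> 'a \<Rightarrow> 'a" where
  "weak_gradient \<Omega> u = (SOME G. has_weak_gradient \<Omega> u G)"


text \<open>Elements of Lebesgue spaces are represented by functions on the whole space; only their
  values almost everywhere in \<open>\<Omega>\<close> matter.\<close>

definition Linf_norm :: "'a::euclidean_space set \<Rightarrow> ('a \<Rightarrow> 'b::euclidean_space) \<Rightarrow> ennreal" where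
  "Linf_norm \<Omega> f = esssup (lebesgue_on \<Omega>) (\<lambda>x. ennreal (norm (f x)))"

definition Linf :: "'a::euclidean_space set \<Rightarrow> ('a \<Rightarrow> 'b::euclidean_space) set" where
  "Linf \<Omega> = {f \<in> borel_measurable (lebesgue_on \<Omega>). Linf_norm \<Omega> f < \<infinity>}"

definition L2 :: "'a::euclidean_space set \<Rightarrow> ('a \<Rightarrow> real) set" where
  "L2 \<Omega> = {f \<in> borel_measurable (lebesgue_on \<Omega>). integrable (lebesgue_on \<Omega>) (\<lambda>x. (f x)\<^sup>2)}"

definition L2_inner :: "'a::euclidean_space set \<Rightarrow> ('a \<Rightarrow> real) \<Rightarrow> ('a \<Rightarrow> real) \<Rightarrow> real" where
  "L2_inner \<Omega> f g = (\<integral>x. f x * g x \<partial>(lebesgue_on \<Omega>))"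

definition L2_norm :: "'a::euclidean_space set \<Rightarrow> ('a \<Rightarrow> real) \<Rightarrow> real" where
  "L2_norm \<Omega> f = sqrt (L2_inner \<Omega> f f)"

definition W1inf :: "'a::euclidean_space set \<Rightarrow> ('a \<Rightarrow> real) set" where
  "W1inf \<Omega> = {u \<in> Linf \<Omega>. \<exists>G\<in>Linf \<Omega>. has_weak_gradient \<Omega> u G}"

text \<open>The boundary condition is imposed pointwise on a representative that is continuous up to the
  boundary. No regularity of \<open>\<Omega>\<close> is assumed, so a trace operator is not available.\<close>

definition W1inf_0 :: "'a::euclidean_space set \<Rightarrow> ('a \<Rightarrow> real) set" where
  "W1inf_0 \<Omega> = {u \<in> W1inf \<Omega>.
     \<exists>v. (AE x in lebesgue_on \<Omega>. v x = u x) \<and>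
         continuous_on (closure \<Omega>) v \<and> (\<forall>x\<in>frontier \<Omega>. v x = 0)}"


definition J_fun :: "'a::euclidean_space set \<Rightarrow> ('a \<Rightarrow> real) \<Rightarrow> ennreal" where
  "J_fun \<Omega> u = (if u \<in> W1inf_0 \<Omega> then Linf_norm \<Omega> (weak_gradient \<Omega> u) else \<infinity>)"

definition subdifferential ::
    "'a::euclidean_space set \<Rightarrow> (('a \<Rightarrow> real) \<Rightarrow> ennreal) \<Rightarrow> ('a \<Rightarrow> real) \<Rightarrow> ('a \<Rightarrow> real) set" where
  "subdifferential \<Omega> J u = {p \<in> L2 \<Omega>. u \<in> L2 \<Omega> \<and> J u < \<infinity> \<and>
     (\<forall>v\<in>L2 \<Omega>. enn2ereal (J u) + ereal (L2_inner \<Omega> p (\<lambda>x. v x - u x)) \<le> enn2ereal (J v))}"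

definition has_L2_derivative ::
    "'a::euclidean_space set \<Rightarrow> (real \<Rightarrow> 'a \<Rightarrow> real) \<Rightarrow> ('a \<Rightarrow> real) \<Rightarrow> real \<Rightarrow> bool" where
  "has_L2_derivative \<Omega> u w t \<longleftrightarrow> w \<in> L2 \<Omega> \<and>
     ((\<lambda>s. L2_norm \<Omega> (\<lambda>x. (u s x - u t x) / (s - t) - w x)) \<longlongrightarrow> 0) (at t)"

definition L2_continuous_on ::
    "'a::euclidean_space set \<Rightarrow> real set \<Rightarrow> (real \<Rightarrow> 'a \<Rightarrow> real) \<Rightarrow> bool" where
  "L2_continuous_on \<Omega> T u \<longleftrightarrow>
     (\<forall>t\<in>T. ((\<lambda>s. L2_norm \<Omega> (\<lambda>x. u s x - u t x)) \<longlongrightarrow> 0) (at t within T))"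

definition L2_abs_continuous_on ::
    "'a::euclidean_space set \<Rightarrow> real set \<Rightarrow> (real \<Rightarrow> 'a \<Rightarrow> real) \<Rightarrow> bool" where
  "L2_abs_continuous_on \<Omega> T u \<longleftrightarrow>
     (\<forall>\<epsilon>>0. \<exists>\<delta>>0. \<forall>(n::nat) a b.
        (\<forall>k<n. a k \<in> T \<and> b k \<in> T \<and> a k \<le> b k) \<and>
        disjoint_family_on (\<lambda>k. {a k<..<b k}) {..<n} \<and>
        (\<Sum>k<n. b k - a k) < \<delta> \<longrightarrow>
        (\<Sum>k<n. L2_norm \<Omega> (\<lambda>x. u (b k) x - u (a k) x)) < \<epsilon>)"

text \<open>Strong solutions in the sense of Brezis of \<open>u'(t) + \<partial>J(u(t)) \<ni> 0\<close>, \<open>u(0) = f\<close> in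
  \<open>L\<^sup>2(\<Omega>)\<close>.\<close>

definition solves_gradient_flow ::
    "'a::euclidean_space set \<Rightarrow> (('a \<Rightarrow> real) \<Rightarrow> ennreal) \<Rightarrow> ('a \<Rightarrow> real) \<Rightarrow> (real \<Rightarrow> 'a \<Rightarrow> real) \<Rightarrow> bool"
  where
  "solves_gradient_flow \<Omega> J f u \<longleftrightarrow>
     (\<forall>t\<ge>0. u t \<in> L2 \<Omega>) \<and>
     L2_continuous_on \<Omega> {0..} u \<and>
     (\<forall>a b. 0 < a \<and> a < b \<longrightarrow> L2_abs_continuous_on \<Omega> {a..b} u) \<and>
     (AE x in lebesgue_on \<Omega>. u 0 x = f x) \<and>
     (AE t in lebesgue. 0 < t \<longrightarrow>
        (\<exists>w. has_L2_derivative \<Omega> u w t \<and> (\<lambda>x. - w x) \<in> subdifferential \<Omega> J (u t)))"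


definition bdist :: "'a::euclidean_space set \<Rightarrow> 'a \<Rightarrow> real" where
  "bdist \<Omega> x = infdist x (frontier \<Omega>)"

text \<open>For nonempty, bounded and open \<open>\<Omega>\<close> the supremum is attained.\<close>

definition inradius :: "'a::euclidean_space set \<Rightarrow> real" where
  "inradius \<Omega> = (SUP x\<in>\<Omega>. bdist \<Omega> x)"

definition inner_parallel :: "'a::euclidean_space set \<Rightarrow> real \<Rightarrow> 'a set" where
  "inner_parallel \<Omega> \<tau> = {x \<in> \<Omega>. bdist \<Omega> x \<ge> \<tau>}"

definition divergence :: "('a::euclidean_space \<Rightarrow> 'a) \<Rightarrow> 'a \<Rightarrow> real" where
  "divergence \<phi> x = (\<Sum>i\<in>Basis. frechet_derivative \<phi> (at x) i \<bullet> i)"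

text \<open>De Giorgi perimeter in the whole space. Truncating negative integrals to 0 is harmless,
  since the zero field is admissible.\<close>

definition perimeter :: "'a::euclidean_space set \<Rightarrow> ennreal" where
  "perimeter E = (SUP \<phi>\<in>{\<phi> :: 'a \<Rightarrow> 'a. Ck 1 \<phi> \<and> compact (supp \<phi>) \<and> (\<forall>x. norm (\<phi> x) \<le> 1)}.
     ennreal (\<integral>x. divergence \<phi> x \<partial>(lebesgue_on E)))"

definition admits_perimeter_bound :: "'a::euclidean_space set \<Rightarrow> bool" where
  "admits_perimeter_bound \<Omega> \<longleftrightarrow>
     (\<exists>r' \<tau>'. 0 < r' \<and> 0 < \<tau>' \<and> \<tau>' \<le> r' \<and>
        (\<forall>\<tau>. 0 \<le> \<tau> \<and> \<tau> \<le> \<tau>' \<longrightarrow>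
           perimeter (inner_parallel \<Omega> \<tau>) \<ge>
             perimeter \<Omega> * ennreal ((1 - \<tau> / r') ^ (DIM('a) - 1))))"

definition I2 :: "'a::euclidean_space set \<Rightarrow> real \<Rightarrow> real" where
  "I2 \<Omega> s = (\<integral>x. (bdist \<Omega> x)\<^sup>2 \<partial>(lebesgue_on (\<Omega> - inner_parallel \<Omega> (inradius \<Omega> * s))))"


text \<open>The right-hand side is meaningful only for \<open>0 < g(t) \<le> 1\<close>, as \<open>I2 \<Omega> 0 = 0\<close>. Positivity also
  excludes \<open>g = 0\<close>, which would solve the equation because of \<open>0 / 0 = 0\<close>. The derivative at
  \<open>T\<close> is one-sided.\<close>

definition solves_ivp :: "'a::euclidean_space set \<Rightarrow> real \<Rightarrow> (real \<Rightarrow> real) \<Rightarrow> bool" where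
  "solves_ivp \<Omega> T g \<longleftrightarrow>
     continuous_on {0..T} g \<and> g 0 = 0 \<and>
     (\<forall>t\<in>{0<..T}. 0 < g t \<and> g t \<le> 1 \<and>
        (g has_real_derivative (g t)\<^sup>2 / I2 \<Omega> (g t)) (at t within {0..T}))"

definition flow_solution ::
    "'a::euclidean_space set \<Rightarrow> real \<Rightarrow> (real \<Rightarrow> real) \<Rightarrow> real \<Rightarrow> 'a \<Rightarrow> real" where
  "flow_solution \<Omega> T g t x =
     (if t = 0 then inradius \<Omega>
      else if t < T then min (1 / g t * bdist \<Omega> x) (inradius \<Omega>)
      else 1 / (L2_norm \<Omega> (bdist \<Omega>))\<^sup>2 * max ((L2_norm \<Omega> (bdist \<Omega>))\<^sup>2 + T - t) 0 * bdist \<Omega> x)"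

end

theory Submission
  imports Defs
begin

text \<open>Write \<open>d\<close> for the distance to the boundary, \<open>r\<close> for its maximum over \<open>\<Omega>\<close> and look for a
  solution of the form \<open>u(t) = min (c(t) d) r\<close>. Then \<open>- u'(t) = k d 1{c d < r}\<close> with
  \<open>k = - c'(t)\<close>. Every \<open>v\<close> in \<open>W1inf_0\<close> satisfies \<open>\<bar>v\<bar> \<le> J(v) d\<close> almost everywhere, and
  \<open>J(u(t)) \<le> c(t)\<close>, so \<open>- u'(t)\<close> is a subgradient of the one-homogeneous functional \<open>J\<close> at \<open>u(t)\<close> as
  soon as \<open>k\<close> times the integral of \<open>d\<^sup>2\<close> over \<open>{c d < r}\<close> equals 1. For \<open>c = 1 / g\<close> this is the
  differential equation for \<open>g\<close>. It separates: the time needed to reach height \<open>s\<close> is the integral of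
  \<open>I2 \<sigma> / \<sigma>\<^sup>2\<close> over \<open>{0..s}\<close>, whose integrand is bounded by \<open>r\<^sup>2 \<bar>\<Omega>\<bar>\<close>, and it is continuous because
  the level sets of \<open>d\<close> are null sets. Once \<open>c = 1\<close> the truncation is void and \<open>c\<close> decreases linearly.\<close>

section \<open>Smooth bump functions on boxes\<close>

text \<open>For J(u(t)) <= c(t) a truncated multiple of d needs a weak gradient bounded by its
  Lipschitz constant without a dimensional factor. Its directional derivatives exist one-sidedly
  because d^2 is semiconcave; integration by parts shows that they are linear in the direction
  almost everywhere, and all directions together give the norm. An upper bound for J(u(t)) is
  enough, since it stands on the smaller side of the subgradient inequality and the pairing with
  u(t) equals c(t). For \<bar>v\<bar> <= J(v) d the obstacle is that \<Omega> need not be convex, so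
  a bound on the weak gradient makes v Lipschitz only along segments inside \<Omega>. The segment
  from x to a nearest boundary point is one of these up to its endpoint. J is evaluated at an
  unspecified representative of the weak gradient. Hence the need for uniqueness, and for bump
  functions to prove it; the same bumps serve as averaging kernels on the segments. That level sets
  of d are null is used three times: for the weak gradient of the truncation, for the time
  derivative and for continuity in the differential equation.\<close>

lemma Ck_continuous: "Ck k f \<Longrightarrow> continuous_on UNIV f"
  by (cases k)
     (auto simp: continuous_on_eq_continuous_at intro: differentiable_imp_continuous_within)

text \<open>The product rule keeps one factor undifferentiated, so the induction for products needs
  that factor at the lower order as well.\<close>

lemma Ck_antimono: "Ck (Suc k) f \<Longrightarrow> Ck k f"
proof (induction k arbitrary: f)
  case 0
  then show ?case using Ck_continuous[of "Suc 0" f] by simp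
next
  case (Suc k)
  from Suc.prems have "\<forall>x. f differentiable at x"
    and "\<forall>i\<in>Basis. Ck (Suc k) (\<lambda>x. frechet_derivative f (at x) i)" by simp_all
  with Suc.IH show ?case by simp
qed

lemma Ck_add:
  fixes f g :: "'a::euclidean_space \<Rightarrow> real"
  shows "Ck k f \<Longrightarrow> Ck k g \<Longrightarrow> Ck k (\<lambda>x. f x + g x)"
proof (induction k arbitrary: f g)
  case 0
  then show ?case by (simp add: continuous_on_add)
next
  case (Suc k)
  have "frechet_derivative (\<lambda>x. f x + g x) (at x) =
      (\<lambda>i. frechet_derivative f (at x) i + frechet_derivative g (at x) i)" for x
    using Suc.prems
    by (intro frechet_derivative_at[symmetric] has_derivative_add)
       (auto simp: frechet_derivative_works)
  with Suc show ?case by auto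
qed

lemma Ck_mult:
  fixes f g :: "'a::euclidean_space \<Rightarrow> real"
  shows "Ck k f \<Longrightarrow> Ck k g \<Longrightarrow> Ck k (\<lambda>x. f x * g x)"
proof (induction k arbitrary: f g)
  case 0
  then show ?case by (simp add: continuous_on_mult)
next
  case (Suc k)
  have d: "frechet_derivative (\<lambda>x. f x * g x) (at x) =
      (\<lambda>i. f x * frechet_derivative g (at x) i + frechet_derivative f (at x) i * g x)" for x
    using Suc.prems
    by (intro frechet_derivative_at[symmetric] has_derivative_mult)
       (auto simp: frechet_derivative_works)
  have "Ck k f" "Ck k g" using Suc.prems by (auto simp del: Ck.simps intro: Ck_antimono)
  with Suc d show ?case by (auto intro!: Ck_add)
qed

lemma Ck_const: "Ck k (\<lambda>x::'a::euclidean_space. c::real)"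
  by (induction k arbitrary: c) auto

lemma Ck_prod:
  fixes f :: "'b \<Rightarrow> 'a::euclidean_space \<Rightarrow> real"
  assumes "\<And>i. i \<in> A \<Longrightarrow> Ck k (f i)"
  shows "Ck k (\<lambda>x. \<Prod>i\<in>A. f i x)"
  using assms
proof (induction A rule: infinite_finite_induct)
  case (insert i A)
  then show ?case by (auto intro!: Ck_mult)
qed (auto intro: Ck_const)

text \<open>\<open>D\<close> supplies the whole sequence of derivatives at once, so that the
  induction can pass from \<open>D m\<close> to \<open>D (Suc m)\<close>. The inner derivative of an
  affine map is constant and contributes only a factor.\<close>

lemma Ck_compose_affine:
  fixes D :: "nat \<Rightarrow> real \<Rightarrow> real" and v :: "'a::euclidean_space"
  assumes D: "\<And>m t. (D m has_real_derivative D (Suc m) t) (at t)"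
  shows "Ck k (\<lambda>x. D m (x \<bullet> v + c))"
proof (induction k arbitrary: m)
  case 0
  have "continuous_on UNIV (D m)"
    using D DERIV_isCont continuous_at_imp_continuous_on by blast
  then have "continuous_on UNIV (\<lambda>x. D m (x \<bullet> v + c))"
    by (rule continuous_on_compose2) (auto intro!: continuous_intros)
  then show ?case by simp
next
  case (Suc k)
  have d: "((\<lambda>x. D m (x \<bullet> v + c)) has_derivative (\<lambda>h. D (Suc m) (x \<bullet> v + c) * (h \<bullet> v))) (at x)" for x
  proof -
    have "((\<lambda>x. x \<bullet> v + c) has_derivative (\<lambda>h. h \<bullet> v)) (at x)"
      by (auto intro!: derivative_eq_intros)
    from has_derivative_compose[OF this D[of m "x \<bullet> v + c", unfolded has_field_derivative_def]]
    show ?thesis by simp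
  qed
  have "frechet_derivative (\<lambda>x. D m (x \<bullet> v + c)) (at x) = (\<lambda>h. D (Suc m) (x \<bullet> v + c) * (h \<bullet> v))" for x
    using frechet_derivative_at[OF d] by simp
  moreover have "(\<lambda>x. D m (x \<bullet> v + c)) differentiable at x" for x
    using d differentiable_def by blast
  ultimately show ?case using Suc by (auto intro!: Ck_mult Ck_const)
qed

text \<open>The derivatives of \<open>exp (- 1 / t)\<close> are \<open>p (1 / t) * exp (- 1 / t)\<close> for these polynomials
  \<open>p\<close>.\<close>

primrec bump_poly :: "nat \<Rightarrow> real poly" where
  "bump_poly 0 = 1"
| "bump_poly (Suc m) = [:0, 0, 1:] * (bump_poly m - pderiv (bump_poly m))"

definition bump :: "nat \<Rightarrow> real \<Rightarrow> real" where
  "bump m t = (if t > 0 then poly (bump_poly m) (1 / t) * exp (- (1 / t)) else 0)"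

lemma poly_exp_tendsto_0:
  fixes p :: "real poly"
  shows "((\<lambda>s. poly p s * exp (- s)) \<longlongrightarrow> 0) at_top"
proof -
  have "((\<lambda>s. coeff p i * (s ^ i / exp s)) \<longlongrightarrow> coeff p i * 0) at_top" for i
    by (intro tendsto_mult tendsto_const tendsto_power_div_exp_0)
  then have "((\<lambda>s. \<Sum>i\<le>degree p. coeff p i * (s ^ i / exp s)) \<longlongrightarrow> (\<Sum>i\<le>degree p. coeff p i * 0)) at_top"
    by (intro tendsto_sum)
  then show ?thesis 
    by (simp add: poly_altdef exp_minus sum_distrib_right divide_inverse mult.assoc)
qed

text \<open>With s = 1 / t the derivative of p(s) exp(-s) in t is s^2 (p(s) - p'(s)) exp(-s), which
  explains the recursion of \<open>bump_poly\<close>. Only t = 0 needs a limit: the difference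
  quotient is 0 from the left, and from the right it is s p(s) exp(-s) with s tending to
  infinity.\<close>

lemma bump_deriv: "(bump m has_real_derivative bump (Suc m) t) (at t)"
proof -
  consider "t > 0" | "t < 0" | "t = 0" by linarith
  then show ?thesis
  proof cases
    case 1
    have "((\<lambda>t. poly (bump_poly m) (1 / t) * exp (- (1 / t))) has_real_derivative bump (Suc m) t) (at t)"
      using 1 by (auto intro!: derivative_eq_intros simp: bump_def field_simps power2_eq_square)
    then show ?thesis
      by (rule has_field_derivative_transform_within_open[where S = "{0<..}"])
         (use 1 in \<open>auto simp: bump_def\<close>)
  next
    case 2
    have "((\<lambda>t. 0) has_real_derivative bump (Suc m) t) (at t)"
      using 2 by (simp add: bump_def)
    then show ?thesis
      by (rule has_field_derivative_transform_within_open[where S = "{..<0}"])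
         (use 2 in \<open>auto simp: bump_def\<close>)
  next
    case 3
    have "((\<lambda>h. poly ([:0, 1:] * bump_poly m) (1 / h) * exp (- (1 / h))) \<longlongrightarrow> 0) (at_right 0)"
      using filterlim_compose[OF poly_exp_tendsto_0[of "[:0, 1:] * bump_poly m"]
          filterlim_inverse_at_top_right]
      by (simp only: inverse_eq_divide)
    moreover have "\<forall>\<^sub>F h in at_right 0. poly ([:0, 1:] * bump_poly m) (1 / h) * exp (- (1 / h)) = bump m h / h"
      by (auto simp: eventually_at_filter bump_def)
    ultimately have r: "((\<lambda>h. bump m h / h) \<longlongrightarrow> 0) (at_right 0)"
      by (rule Lim_transform_eventually)
    have l: "((\<lambda>h. bump m h / h) \<longlongrightarrow> 0) (at_left 0)"
      by (rule Lim_transform_eventually[OF tendsto_const])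
         (auto simp: eventually_at_filter bump_def)
    from l r have "((\<lambda>h. bump m h / h) \<longlongrightarrow> 0) (at 0)"
      by (simp add: filterlim_split_at)
    then show ?thesis using 3 by (simp add: DERIV_def bump_def)
  qed
qed

text \<open>For positive \<open>c\<close> the bump is positive exactly on the open box, whatever
  \<open>c\<close> is; a larger \<open>c\<close> only steepens the flanks. The factors exp(-1 / (c
  t)) tend to 1 inside the box, so the indicator of the box is a bounded pointwise limit of such
  bumps.\<close>

definition box_bump :: "'a::euclidean_space \<Rightarrow> 'a \<Rightarrow> real \<Rightarrow> 'a \<Rightarrow> real" where
  "box_bump a b c x = (\<Prod>i\<in>Basis. bump 0 (c * (x \<bullet> i - a \<bullet> i)) * bump 0 (c * (b \<bullet> i - x \<bullet> i)))"

lemma Ck_box_bump: "Ck k (box_bump a b c)"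
proof -
  have "Ck k (\<lambda>x. bump 0 (x \<bullet> (c *\<^sub>R i) + - (c * (a \<bullet> i))))"
       "Ck k (\<lambda>x. bump 0 (x \<bullet> (- c *\<^sub>R i) + (c * (b \<bullet> i))))" for i :: 'a
    by (rule Ck_compose_affine, rule bump_deriv)+
  then have "Ck k (\<lambda>x. \<Prod>i\<in>Basis. bump 0 (c * (x \<bullet> i - a \<bullet> i)) * bump 0 (c * (b \<bullet> i - x \<bullet> i)))"
    by (intro Ck_prod Ck_mult) (simp_all add: algebra_simps)
  moreover have "box_bump a b c = (\<lambda>x. \<Prod>i\<in>Basis. bump 0 (c * (x \<bullet> i - a \<bullet> i)) * bump 0 (c * (b \<bullet> i - x \<bullet> i)))"
    by (simp add: fun_eq_iff box_bump_def)
  ultimately show ?thesis by simp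
qed

lemma bump_0_bounds: "0 \<le> bump 0 t" "bump 0 t \<le> 1" "0 < bump 0 t \<longleftrightarrow> 0 < t"
  by (auto simp: bump_def)

lemma box_bump_nonneg: "0 \<le> box_bump a b c x"
  by (auto simp: box_bump_def bump_0_bounds intro!: prod_nonneg)

lemma box_bump_le_1: "box_bump a b c x \<le> 1"
  unfolding box_bump_def by (intro prod_le_1) (auto simp: bump_0_bounds intro!: mult_le_one)

lemma box_bump_pos_iff:
  assumes "c > 0"
  shows "0 < box_bump a b c x \<longleftrightarrow> x \<in> box a b"
proof
  assume "x \<in> box a b"
  with assms show "0 < box_bump a b c x"
    by (auto simp: box_bump_def mem_box bump_0_bounds intro!: prod_pos mult_pos_pos)
next
  assume p: "0 < box_bump a b c x"
  have "a \<bullet> i < x \<bullet> i \<and> x \<bullet> i < b \<bullet> i" if "i \<in> Basis" for i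
  proof (rule ccontr)
    assume "\<not> ?thesis"
    with assms have "bump 0 (c * (x \<bullet> i - a \<bullet> i)) * bump 0 (c * (b \<bullet> i - x \<bullet> i)) = 0"
      by (auto simp: bump_def zero_less_mult_iff)
    with that have "box_bump a b c x = 0"
      unfolding box_bump_def by (subst prod_zero_iff) auto
    with p show False by simp
  qed
  then show "x \<in> box a b" by (auto simp: mem_box)
qed

lemma supp_box_bump: "c > 0 \<Longrightarrow> supp (box_bump a b c) \<subseteq> cbox a b"
  unfolding supp_def
  using box_bump_pos_iff[of c a b] box_bump_nonneg[of a b c] box_subset_cbox[of a b]
  by (intro closure_minimal) (auto simp: order_less_le subset_iff)

lemma box_bump_test_function:
  assumes "c > 0" "cbox a b \<subseteq> \<Omega>"
  shows "box_bump a b c \<in> test_functions \<Omega>"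
proof -
  have "compact (supp (box_bump a b c))"
    using supp_box_bump[OF assms(1), of a b] compact_cbox closed_closure
    by (metis compact_Int_closed inf.absorb_iff2 supp_def)
  then show ?thesis
    using supp_box_bump[OF assms(1), of a b] assms(2) Ck_box_bump[of _ a b c]
    by (auto simp: test_functions_def)
qed

lemma box_bump_tendsto:
  "(\<lambda>n. box_bump a b (real (Suc n)) x) \<longlonglongrightarrow> indicator (box a b) x"
proof (cases "x \<in> box a b")
  case True
  have *: "(\<lambda>n. bump 0 (real (Suc n) * t)) \<longlonglongrightarrow> 1" if "t > 0" for t
  proof -
    have "(\<lambda>n. exp (- ((1 / t) * inverse (real (Suc n))))) \<longlonglongrightarrow> exp (- ((1 / t) * 0))"
      by (intro tendsto_intros LIMSEQ_inverse_real_of_nat)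
    moreover have "bump 0 (real (Suc n) * t) = exp (- ((1 / t) * inverse (real (Suc n))))" for n
      using that by (simp add: bump_def field_simps del: of_nat_Suc)
    ultimately show ?thesis by simp
  qed
  have "(\<lambda>n. box_bump a b (real (Suc n)) x) \<longlonglongrightarrow> (\<Prod>i\<in>(Basis::'a set). 1 * 1)"
    unfolding box_bump_def using True
    by (intro tendsto_prod tendsto_mult *) (auto simp: mem_box)
  then show ?thesis using True by simp
next
  case False
  then have "box_bump a b (real (Suc n)) x = 0" for n
    using box_bump_pos_iff[of "real (Suc n)" a b x] box_bump_nonneg[of a b "real (Suc n)" x]
    by (simp add: order_less_le)
  with False show ?thesis by simp
qed

section \<open>The fundamental lemma of the calculus of variations\<close>

lemma AE_lebesgue_on_iff_negligible:
  assumes "S \<in> sets lebesgue"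
  shows "(AE x in lebesgue_on S. P x) \<longleftrightarrow> negligible {x\<in>S. \<not> P x}"
proof
  assume "AE x in lebesgue_on S. P x"
  then have "AE x in lebesgue. x \<in> S \<longrightarrow> P x"
    using assms by (subst (asm) AE_restrict_space_iff) auto
  then have "{x. \<not> (x \<in> S \<longrightarrow> P x)} \<in> null_sets lebesgue"
    by (simp add: completion.AE_iff_null_sets)
  then show "negligible {x\<in>S. \<not> P x}"
    by (simp add: negligible_iff_null_sets)
next
  assume "negligible {x\<in>S. \<not> P x}"
  then have "{x\<in>S. \<not> P x} \<in> null_sets lebesgue"
    by (simp only: negligible_iff_null_sets)
  then have "AE x in lebesgue. x \<in> S \<longrightarrow> P x"
    by (rule AE_I') auto
  then show "AE x in lebesgue_on S. P x"
    using assms by (subst AE_restrict_space_iff) auto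
qed

lemma integral_lebesgue_on_subset:
  fixes f :: "'a::euclidean_space \<Rightarrow> real"
  assumes "S \<subseteq> T" "S \<in> sets lebesgue" "T \<in> sets lebesgue" "\<And>x. x \<in> T - S \<Longrightarrow> f x = 0"
  shows "(\<integral>x. f x \<partial>lebesgue_on T) = (\<integral>x. f x \<partial>lebesgue_on S)"
  using assms by (subst (1 2) integral_restrict_space)
    (auto simp: indicator_def intro!: Bochner_Integration.integral_cong)

lemma integrable_lebesgue_on_subset_iff:
  fixes f :: "'a::euclidean_space \<Rightarrow> real"
  assumes "S \<subseteq> T" "S \<in> sets lebesgue" "T \<in> sets lebesgue" "\<And>x. x \<in> T - S \<Longrightarrow> f x = 0"
  shows "integrable (lebesgue_on T) f \<longleftrightarrow> integrable (lebesgue_on S) f"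
proof -
  have "(\<lambda>x. indicat_real T x *\<^sub>R f x) = (\<lambda>x. indicat_real S x *\<^sub>R f x)"
  proof
    fix x show "indicat_real T x *\<^sub>R f x = indicat_real S x *\<^sub>R f x"
      using assms(1) assms(4)[of x] by (cases "x \<in> S"; cases "x \<in> T") auto
  qed
  with assms(2,3) show ?thesis by (subst (1 2) integrable_restrict_space) auto
qed

lemma test_function_eq_0: "x \<notin> supp \<phi> \<Longrightarrow> \<phi> x = 0"
  unfolding supp_def using closure_subset[of "{x. \<phi> x \<noteq> 0}"] by auto

text \<open>Bumps make the integral of \<open>h\<close> over every box vanish, by dominated
  convergence. Boxes are stable under intersection and generate the Borel sets, so it vanishes over
  every Borel set and, up to negligible sets, over every Lebesgue set. The closed box lies in
  \<Omega> because local integrability controls \<open>h\<close> only on compact sets.\<close>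

lemma AE_0_on_box:
  fixes h :: "'a::euclidean_space \<Rightarrow> real"
  assumes \<Omega>: "open \<Omega>" "cbox a b \<subseteq> \<Omega>" and h: "locally_integrable \<Omega> h"
    and 0: "\<And>\<phi>. \<phi> \<in> test_functions \<Omega> \<Longrightarrow> (\<integral>x. h x * \<phi> x \<partial>lebesgue_on \<Omega>) = 0"
  shows "AE x in lebesgue_on (box a b). h x = 0"
proof -
  define M where "M = lebesgue_on (box a b)"
  have hM: "integrable M h"
  proof -
    have "h absolutely_integrable_on cbox a b"
      using h \<Omega>(2) unfolding locally_integrable_def by auto
    then have "h absolutely_integrable_on box a b"
      by (rule set_integrable_subset) (auto simp: box_subset_cbox)
    then show ?thesis unfolding M_def set_integrable_def by (subst integrable_restrict_space) auto
  qed
  have [measurable]: "h \<in> borel_measurable M" using hM by auto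
  have bM: "A \<inter> space M \<in> sets M" if "A \<in> sets borel" for A
    using that by (simp add: M_def sets_restrict_space_iff)
  have ind: "(\<lambda>x. indicator A x :: real) \<in> borel_measurable M" if "A \<in> sets borel" for A :: "'a set"
    unfolding M_def using that by (intro measurable_restrict_space1 measurable_completion) simp
  have box0: "(\<integral>x. indicator (box c d) x * h x \<partial>M) = 0" for c d
  proof -
    obtain a' b' where ab: "box c d \<inter> box a b = box a' b'" by (rule that, rule box_Int_box)
    show ?thesis
    proof (cases "box a' b' = {}")
      case True
      then have "(\<integral>x. indicator (box c d) x * h x \<partial>M) = (\<integral>x. 0 \<partial>M)"
        using ab by (intro Bochner_Integration.integral_cong) (auto simp: M_def indicator_def)
      then show ?thesis by simp
    next
      case False
      \<comment> \<open>The bump has to be supported in \<Omega>, hence the passage from the open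
        boxes to their closures.\<close>
      have sub: "cbox a' b' \<subseteq> cbox a b"
      proof -
        have "box a b \<noteq> {}" "box a' b' \<subseteq> box a b" using False ab by auto
        then show ?thesis
          using False closure_mono[of "box a' b'" "box a b"] by (simp add: closure_box)
      qed
      have sub': "box a' b' \<subseteq> box a b" using ab by auto
      let ?\<phi> = "\<lambda>n. box_bump a' b' (real (Suc n))"
      have z: "(\<integral>x. ?\<phi> n x * h x \<partial>M) = 0" for n
      proof -
        have "x \<notin> box a b \<Longrightarrow> ?\<phi> n x = 0" for x
          using sub' box_bump_pos_iff[of "real (Suc n)" a' b' x] box_bump_nonneg[of a' b' "real (Suc n)" x]
          by (force simp: order_less_le)
        then have "(\<integral>x. h x * ?\<phi> n x \<partial>lebesgue_on \<Omega>) = (\<integral>x. h x * ?\<phi> n x \<partial>M)"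
          unfolding M_def using \<Omega> box_subset_cbox[of a b] by (intro integral_lebesgue_on_subset) auto
        moreover have "?\<phi> n \<in> test_functions \<Omega>"
          using sub \<Omega> by (intro box_bump_test_function) auto
        ultimately show ?thesis using 0[of "?\<phi> n"] by (simp add: mult.commute)
      qed
      have "(\<lambda>n. \<integral>x. ?\<phi> n x * h x \<partial>M) \<longlonglongrightarrow> (\<integral>x. indicator (box c d) x * h x \<partial>M)"
      proof (rule integral_dominated_convergence[where w = "\<lambda>x. norm (h x)"])
        show "(\<lambda>x. indicator (box c d) x * h x) \<in> borel_measurable M"
          by (intro borel_measurable_times ind) auto
        show "(\<lambda>x. ?\<phi> n x * h x) \<in> borel_measurable M" for n
        proof -
          have "continuous_on UNIV (?\<phi> n)" using Ck_continuous[OF Ck_box_bump] .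
          then have "?\<phi> n \<in> borel_measurable borel" by (rule borel_measurable_continuous_onI)
          then have "?\<phi> n \<in> borel_measurable M" unfolding M_def
            by (intro measurable_restrict_space1 measurable_completion) simp
          then show ?thesis by (intro borel_measurable_times) auto
        qed
        show "integrable M (\<lambda>x. norm (h x))" using hM by auto
        show "AE x in M. norm (?\<phi> n x * h x) \<le> norm (h x)" for n
          by (intro AE_I2) (auto simp: abs_mult abs_of_nonneg[OF box_bump_nonneg] box_bump_le_1
              box_bump_nonneg intro!: mult_left_le_one_le)
        have "(\<lambda>n. ?\<phi> n x * h x) \<longlonglongrightarrow> indicator (box c d) x * h x" if "x \<in> box a b" for x
        proof -
          have "indicator (box c d) x = (indicator (box a' b') x :: real)"
            using that by (auto simp: indicator_def simp flip: ab)
          then show ?thesis using box_bump_tendsto[of a' b' x] by (auto intro!: tendsto_mult)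
        qed
        then show "AE x in M. (\<lambda>n. ?\<phi> n x * h x) \<longlonglongrightarrow> indicator (box c d) x * h x"
          by (intro AE_I2) (auto simp: M_def)
      qed
      then show ?thesis unfolding z by (simp add: LIMSEQ_const_iff)
    qed
  qed
  have borel0: "(\<integral>x. indicator A x * h x \<partial>M) = 0" if A: "A \<in> sets borel" for A
  proof -
    have "Int_stable (range (\<lambda>(a, b). box a b :: 'a set))"
      by (auto simp: Int_stable_def box_Int_box)
    moreover have "range (\<lambda>(a, b). box a b) \<subseteq> Pow (UNIV :: 'a set)"
      by auto
    moreover have "A \<in> sigma_sets UNIV (range (\<lambda>(a, b). box a b))"
      using A unfolding borel_eq_box by simp
    ultimately show ?thesis
    proof (induction rule: sigma_sets_induct_disjoint)
      case (basic A)
      then show ?case using box0 by auto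
    next
      case empty
      then show ?case by simp
    next
      case (compl A)
      then have [measurable]: "A \<in> sets borel" by (simp add: borel_eq_box)
      have i: "integrable M (\<lambda>x. indicator A x * h x)"
      proof (rule Bochner_Integration.integrable_bound[OF hM])
        show "(\<lambda>x. indicator A x * h x) \<in> borel_measurable M"
          by (intro borel_measurable_times ind) auto
      qed (auto simp: indicator_def)
      have "(\<integral>x. indicator (UNIV - A) x * h x \<partial>M) = (\<integral>x. h x - indicator A x * h x \<partial>M)"
        by (intro Bochner_Integration.integral_cong) (auto simp: indicator_def)
      also have "\<dots> = (\<integral>x. h x \<partial>M)" using hM i compl by simp
      \<comment> \<open>\<open>M\<close> lives on a box, so its total integral is an instance of the
        base case.\<close>
      also have "\<dots> = (\<integral>x. indicator (box a b) x * h x \<partial>M)"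
        by (intro Bochner_Integration.integral_cong) (auto simp: indicator_def M_def)
      finally show ?case using box0 by simp
    next
      case (union F)
      then have F: "\<And>i. F i \<in> sets borel" by (auto simp: borel_eq_box subset_eq)
      let ?F = "\<lambda>i. F i \<inter> space M"
      have eq: "(\<integral>x. indicator A x * h x \<partial>M) = (LINT x:(A \<inter> space M)|M. h x)" for A
        unfolding set_lebesgue_integral_def
        by (intro Bochner_Integration.integral_cong) (auto simp: indicator_def)
      have "(LINT x:(\<Union>i. ?F i)|M. h x) = (\<Sum>i. LINT x:?F i|M. h x)"
      proof (rule lebesgue_integral_countable_add)
        show "set_integrable M (\<Union>i. ?F i) h"
          unfolding set_integrable_def using hM bM F by (intro integrable_mult_indicator) auto
        have "F i \<inter> F j = {}" if "i \<noteq> j" for i j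
          using union(1) that by (simp add: disjoint_family_on_def)
        then show "?F i \<inter> ?F j = {}" if "i \<noteq> j" for i j
          using that by blast
      qed (use bM F in auto)
      also have "\<dots> = (\<Sum>i. 0)" using union by (simp flip: eq)
      finally show ?case unfolding eq by simp
    qed
  qed
  have "AE x in M. h x = 0"
  proof (rule density_unique_real[OF hM])
    show "integrable M (\<lambda>x. 0)" by simp
    fix A assume "A \<in> sets M"
    then obtain S where "S \<in> sets lebesgue" "A = S \<inter> box a b"
      by (auto simp: M_def sets_restrict_space)
    \<comment> \<open>Only Borel sets have been treated; a Lebesgue set is a Borel set together with
      a negligible one, which does not change the integral.\<close>
    then obtain B N where B: "B \<in> sets borel" "negligible N" "B \<union> N = S"
      by (metis sets_lebesgue_almost_borel)
    have "AE x in M. x \<notin> N"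
      unfolding M_def using B(2) by (subst AE_lebesgue_on_iff_negligible) (auto intro: negligible_subset)
    then have "AE x in M. indicator A x * h x = indicator B x * h x"
      by (rule AE_mp) (use B \<open>A = S \<inter> box a b\<close> in \<open>auto intro!: AE_I2 simp: M_def indicator_def\<close>)
    then have "(\<integral>x. indicator A x * h x \<partial>M) = (\<integral>x. indicator B x * h x \<partial>M)"
      by (rule integral_cong_AE[rotated 2])
         (use B \<open>A \<in> sets M\<close> in \<open>auto intro!: borel_measurable_times ind\<close>)
    then show "(LINT x:A|M. h x) = (LINT x:A|M. 0)"
      using borel0[OF B(1)] by (simp add: set_lebesgue_integral_def)
  qed
  then show ?thesis unfolding M_def .
qed

text \<open>Countably many closed boxes inside \<Omega> cover it. Each is settled on its interior,
  and its boundary is negligible.\<close>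

lemma AE_0_on_open:
  fixes h :: "'a::euclidean_space \<Rightarrow> real"
  assumes \<Omega>: "open \<Omega>" and h: "locally_integrable \<Omega> h"
    and 0: "\<And>\<phi>. \<phi> \<in> test_functions \<Omega> \<Longrightarrow> (\<integral>x. h x * \<phi> x \<partial>lebesgue_on \<Omega>) = 0"
  shows "AE x in lebesgue_on \<Omega>. h x = 0"
proof -
  obtain D where D: "countable D" "D \<subseteq> Pow \<Omega>" "\<And>X. X \<in> D \<Longrightarrow> \<exists>a b. X = cbox a b" "\<Union>D = \<Omega>"
    using open_countable_Union_open_cbox[OF \<Omega>] by metis
  have "negligible {x\<in>X. h x \<noteq> 0}" if X: "X \<in> D" for X
  proof -
    obtain a b where ab: "X = cbox a b" using D X by blast
    have "negligible {x\<in>box a b. \<not> h x = 0}"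
      using AE_0_on_box[OF \<Omega> _ h 0, of a b] D(2) X ab
      by (subst AE_lebesgue_on_iff_negligible[symmetric]) auto
    moreover have "negligible (cbox a b - box a b)" by (rule negligible_frontier_interval)
    ultimately have "negligible ({x\<in>box a b. \<not> h x = 0} \<union> (cbox a b - box a b))"
      by (rule negligible_Un)
    then show ?thesis by (rule negligible_subset) (auto simp: ab)
  qed
  then have "negligible (\<Union>X\<in>D. {x\<in>X. h x \<noteq> 0})"
    using D(1) by (intro negligible_countable_Union) auto
  moreover have "{x\<in>\<Omega>. \<not> h x = 0} = (\<Union>X\<in>D. {x\<in>X. h x \<noteq> 0})"
    unfolding D(4)[symmetric] by auto
  ultimately show ?thesis
    using \<Omega> by (subst AE_lebesgue_on_iff_negligible) auto
qed

section \<open>Weak gradients and test functions\<close>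

lemma absolutely_integrable_on_iff_lebesgue_on:
  fixes f :: "'a::euclidean_space \<Rightarrow> 'b::euclidean_space"
  assumes "S \<in> sets lebesgue"
  shows "f absolutely_integrable_on S \<longleftrightarrow> integrable (lebesgue_on S) f"
  unfolding set_integrable_def using assms by (subst integrable_restrict_space) simp_all

lemma locally_integrable_iff:
  "locally_integrable \<Omega> f \<longleftrightarrow> (\<forall>K. compact K \<and> K \<subseteq> \<Omega> \<longrightarrow> integrable (lebesgue_on K) f)"
  unfolding locally_integrable_def
  by (metis absolutely_integrable_on_iff_lebesgue_on compact_imp_closed lborelD borel_closed
      sets_completionI_sets)

lemma compact_sets_lebesgue: "compact K \<Longrightarrow> K \<in> sets lebesgue"
  using lmeasurable_compact by blast

lemma integrable_lebesgue_on_compact: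
  fixes f :: "'a::euclidean_space \<Rightarrow> real"
  assumes "compact K" "continuous_on K f"
  shows "integrable (lebesgue_on K) f"
proof -
  have i: "integrable lborel (\<lambda>x. indicator K x *\<^sub>R f x)"
    using assms by (rule borel_integrable_compact)
  then have "integrable lebesgue (\<lambda>x. indicator K x *\<^sub>R f x)"
    by (subst integrable_completion) auto
  then show ?thesis
    using compact_sets_lebesgue[OF assms(1)] by (subst integrable_restrict_space) simp_all
qed

lemma locally_integrable_inner:
  "locally_integrable \<Omega> G \<Longrightarrow> locally_integrable \<Omega> (\<lambda>x. G x \<bullet> i)"
  unfolding locally_integrable_iff by auto

lemma locally_integrable_diff:
  "locally_integrable \<Omega> f \<Longrightarrow> locally_integrable \<Omega> g \<Longrightarrow> locally_integrable \<Omega> (\<lambda>x. f x - g x)"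
  unfolding locally_integrable_iff by auto

section \<open>Derivatives, bounds and Lipschitz constants of test functions\<close>

lemma test_function_has_derivative:
  assumes "\<phi> \<in> test_functions \<Omega>"
  shows "(\<phi> has_derivative frechet_derivative \<phi> (at x)) (at x)"
proof -
  have "Ck (Suc 0) \<phi>" using assms unfolding test_functions_def by blast
  then show ?thesis by (simp add: frechet_derivative_works)
qed

text \<open>\<open>has_weak_gradient\<close> tests only coordinate directions; this formula carries
  integration by parts over to an arbitrary direction \<open>w\<close>.\<close>

lemma frechet_derivative_test_function:
  assumes "\<phi> \<in> test_functions \<Omega>"
  shows "frechet_derivative \<phi> (at x) w = (\<Sum>i\<in>Basis. (w \<bullet> i) * frechet_derivative \<phi> (at x) i)"
proof -
  interpret linear "frechet_derivative \<phi> (at x)"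
    using test_function_has_derivative[OF assms] by (rule has_derivative_linear)
  have "frechet_derivative \<phi> (at x) w = frechet_derivative \<phi> (at x) (\<Sum>i\<in>Basis. (w \<bullet> i) *\<^sub>R i)"
    by (simp only: euclidean_representation)
  also have "\<dots> = (\<Sum>i\<in>Basis. (w \<bullet> i) * frechet_derivative \<phi> (at x) i)"
    by (simp add: sum scale)
  finally show ?thesis .
qed

lemma continuous_on_frechet_derivative_test_function:
  assumes "\<phi> \<in> test_functions \<Omega>"
  shows "continuous_on UNIV (\<lambda>x. frechet_derivative \<phi> (at x) w)"
proof -
  have "Ck (Suc 0) \<phi>" using assms unfolding test_functions_def by blast
  then show ?thesis
    by (subst frechet_derivative_test_function[OF assms]) (auto intro!: continuous_intros)
qed

lemma continuous_on_test_function: "\<phi> \<in> test_functions \<Omega> \<Longrightarrow> continuous_on UNIV \<phi>"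
  by (auto simp: test_functions_def intro: Ck_continuous)

lemma frechet_derivative_eq_0_outside_supp:
  assumes "x \<notin> supp \<phi>"
  shows "frechet_derivative \<phi> (at x) w = 0"
proof -
  have "(\<phi> has_derivative (\<lambda>h. 0)) (at x)"
  proof (rule has_derivative_transform_within_open)
    show "((\<lambda>x. 0) has_derivative (\<lambda>h. 0)) (at x)" by simp
    show "open (- supp \<phi>)" by (simp add: supp_def open_Compl)
  qed (use assms test_function_eq_0 in auto)
  then have "frechet_derivative \<phi> (at x) = (\<lambda>h. 0)" by (rule frechet_derivative_at[symmetric])
  then show ?thesis by simp
qed

lemma test_function_supp:
  "\<phi> \<in> test_functions \<Omega> \<Longrightarrow> compact (supp \<phi>)" "\<phi> \<in> test_functions \<Omega> \<Longrightarrow> supp \<phi> \<subseteq> \<Omega>"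
  by (auto simp: test_functions_def)

lemma bounded_if_compact_supp:
  fixes f :: "'a::euclidean_space \<Rightarrow> real"
  assumes "continuous_on UNIV f" "compact K" "\<And>x. x \<notin> K \<Longrightarrow> f x = 0"
  obtains B where "B \<ge> 0" "\<And>x. \<bar>f x\<bar> \<le> B"
proof -
  have "compact (f ` K)"
    using assms by (intro compact_continuous_image) (auto intro: continuous_on_subset)
  then obtain B where "\<forall>y\<in>f ` K. norm y \<le> B" by (meson compact_imp_bounded bounded_iff)
  then have "\<bar>f x\<bar> \<le> max B 0" for x
    using assms(3)[of x] by (cases "x \<in> K") auto
  then show ?thesis using that[of "max B 0"] by auto
qed

text \<open>The constant dominates the difference quotients of \<phi> when their limit is taken
  under the integral.\<close>

lemma test_function_Lipschitz:
  assumes "\<phi> \<in> test_functions \<Omega>"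
  obtains C where "C \<ge> 0" "\<And>x y. \<bar>\<phi> x - \<phi> y\<bar> \<le> C * norm (x - y)"
proof -
  have "\<exists>B. \<forall>x. \<bar>frechet_derivative \<phi> (at x) i\<bar> \<le> B" for i
    using bounded_if_compact_supp[OF continuous_on_frechet_derivative_test_function[OF assms]
        test_function_supp(1)[OF assms] frechet_derivative_eq_0_outside_supp]
    by metis
  then obtain B where B: "\<And>i x. \<bar>frechet_derivative \<phi> (at x) i\<bar> \<le> B i" by metis
  have B0: "B i \<ge> 0" for i using B[of 0 i] by linarith
  define C where "C = (\<Sum>i\<in>Basis. B i)"
  have "norm (\<phi> x - \<phi> y) \<le> C * norm (x - y)" for x y
  proof (rule differentiable_bound[OF convex_UNIV])
    show "(\<phi> has_derivative frechet_derivative \<phi> (at x)) (at x within UNIV)" for x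
      using test_function_has_derivative[OF assms] by simp
    show "onorm (frechet_derivative \<phi> (at x)) \<le> C" for x
    proof (rule onorm_le)
      fix w
      have "norm (frechet_derivative \<phi> (at x) w) \<le> (\<Sum>i\<in>Basis. \<bar>(w \<bullet> i) * frechet_derivative \<phi> (at x) i\<bar>)"
        by (subst frechet_derivative_test_function[OF assms]) (simp add: sum_abs)
      also have "\<dots> \<le> (\<Sum>i\<in>Basis. norm w * B i)"
        unfolding abs_mult by (intro sum_mono mult_mono B Basis_le_norm) auto
      also have "\<dots> = C * norm w" by (simp add: C_def sum_distrib_left mult.commute)
      finally show "norm (frechet_derivative \<phi> (at x) w) \<le> C * norm w" .
    qed
  qed auto
  moreover have "C \<ge> 0" using B0 by (simp add: C_def sum_nonneg)
  ultimately show ?thesis using that by simp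
qed

lemma borel_measurable_lebesgue_on_continuous:
  fixes f :: "'a::euclidean_space \<Rightarrow> 'b::euclidean_space"
  assumes "continuous_on UNIV f"
  shows "f \<in> borel_measurable (lebesgue_on S)"
  using borel_measurable_continuous_onI[OF assms]
  by (intro measurable_restrict_space1 measurable_completion) simp

lemma integrable_mult_test_function:
  assumes \<Omega>: "open \<Omega>" and f: "locally_integrable \<Omega> f" and \<phi>: "\<phi> \<in> test_functions \<Omega>"
  shows "integrable (lebesgue_on \<Omega>) (\<lambda>x. f x * \<phi> x)"
proof -
  let ?K = "supp \<phi>"
  obtain B where B: "\<And>x. \<bar>\<phi> x\<bar> \<le> B"
    using bounded_if_compact_supp[OF continuous_on_test_function[OF \<phi>] test_function_supp(1)[OF \<phi>]
        test_function_eq_0[of _ \<phi>]] by metis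
  have fK: "integrable (lebesgue_on ?K) f"
    using f test_function_supp[OF \<phi>] by (auto simp: locally_integrable_iff)
  have "integrable (lebesgue_on ?K) (\<lambda>x. f x * \<phi> x)"
  proof (rule Bochner_Integration.integrable_bound)
    show "integrable (lebesgue_on ?K) (\<lambda>x. f x * B)" using fK by simp
    show "(\<lambda>x. f x * \<phi> x) \<in> borel_measurable (lebesgue_on ?K)"
      using fK borel_measurable_lebesgue_on_continuous[OF continuous_on_test_function[OF \<phi>]]
      by (intro borel_measurable_times) auto
    have "\<bar>\<phi> x\<bar> \<le> \<bar>B\<bar>" for x using B[of x] by linarith
    then show "AE x in lebesgue_on ?K. norm (f x * \<phi> x) \<le> norm (f x * B)"
      by (intro AE_I2) (auto simp: abs_mult intro!: mult_left_mono)
  qed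
  then show ?thesis
    using test_function_supp[OF \<phi>] \<Omega> compact_sets_lebesgue test_function_eq_0
    by (subst integrable_lebesgue_on_subset_iff[of ?K]) auto
qed

text \<open>\<open>weak_gradient\<close> is an unspecified choice, so a bound proved for one weak
  gradient reaches it only through uniqueness. The components of the difference integrate to 0
  against all test functions.\<close>

lemma has_weak_gradient_unique:
  assumes \<Omega>: "open \<Omega>" and G: "has_weak_gradient \<Omega> u G" and H: "has_weak_gradient \<Omega> u H"
  shows "AE x in lebesgue_on \<Omega>. G x = H x"
proof -
  have "AE x in lebesgue_on \<Omega>. G x \<bullet> i - H x \<bullet> i = 0" if i: "i \<in> Basis" for i
  proof (rule AE_0_on_open[OF \<Omega>])
    have li: "locally_integrable \<Omega> (\<lambda>x. G x \<bullet> i)" "locally_integrable \<Omega> (\<lambda>x. H x \<bullet> i)"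
      using G H by (auto simp: has_weak_gradient_def intro: locally_integrable_inner)
    then show "locally_integrable \<Omega> (\<lambda>x. G x \<bullet> i - H x \<bullet> i)" by (rule locally_integrable_diff)
    fix \<phi> assume \<phi>: "\<phi> \<in> test_functions \<Omega>"
    have "(\<integral>x. (G x \<bullet> i - H x \<bullet> i) * \<phi> x \<partial>lebesgue_on \<Omega>) =
        (\<integral>x. (G x \<bullet> i) * \<phi> x \<partial>lebesgue_on \<Omega>) - (\<integral>x. (H x \<bullet> i) * \<phi> x \<partial>lebesgue_on \<Omega>)"
      using integrable_mult_test_function[OF \<Omega> _ \<phi>] li
      by (simp add: left_diff_distrib)
    also have "\<dots> = 0"
    proof -
      have "(\<integral>x. u x * frechet_derivative \<phi> (at x) i \<partial>lebesgue_on \<Omega>) = - (\<integral>x. (G x \<bullet> i) * \<phi> x \<partial>lebesgue_on \<Omega>)"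
        using G i \<phi> unfolding has_weak_gradient_def by blast
      moreover have "(\<integral>x. u x * frechet_derivative \<phi> (at x) i \<partial>lebesgue_on \<Omega>) = - (\<integral>x. (H x \<bullet> i) * \<phi> x \<partial>lebesgue_on \<Omega>)"
        using H i \<phi> unfolding has_weak_gradient_def by blast
      ultimately show ?thesis by simp
    qed
    finally show "(\<integral>x. (G x \<bullet> i - H x \<bullet> i) * \<phi> x \<partial>lebesgue_on \<Omega>) = 0" .
  qed
  then have "AE x in lebesgue_on \<Omega>. \<forall>i\<in>Basis. G x \<bullet> i - H x \<bullet> i = 0"
    by (intro AE_finite_allI) auto
  then show ?thesis
  proof eventually_elim
    case (elim x)
    then show ?case using euclidean_eqI[of "G x" "H x"] by (metis eq_iff_diff_eq_0)
  qed
qed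

section \<open>Translation invariance, and passage between integrals over \<Omega> and over the
  whole space\<close>

lemma lborel_integral_translate:
  fixes f :: "'a::euclidean_space \<Rightarrow> real"
  assumes "f \<in> borel_measurable borel"
  shows "(\<integral>x. f (x + c) \<partial>lborel) = (\<integral>x. f x \<partial>lborel)"
proof -
  have "(\<integral>x. f x \<partial>distr lborel borel ((+) c)) = (\<integral>x. f (c + x) \<partial>lborel)"
    using assms by (intro integral_distr) auto
  then show ?thesis by (simp add: lborel_distr_plus add.commute)
qed

lemma integrable_compact_supp:
  fixes f :: "'a::euclidean_space \<Rightarrow> real"
  assumes "continuous_on UNIV f" "compact K" "\<And>x. x \<notin> K \<Longrightarrow> f x = 0"
  shows "integrable lborel f"
proof -
  have "integrable lborel (\<lambda>x. indicator K x *\<^sub>R f x)"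
    using assms by (intro borel_integrable_compact) (auto intro: continuous_on_subset)
  moreover have "(\<lambda>x. indicator K x *\<^sub>R f x) = f"
  proof
    fix x show "indicator K x *\<^sub>R f x = f x" using assms(3)[of x] by (cases "x \<in> K") auto
  qed
  ultimately show ?thesis by simp
qed

lemma integral_lebesgue_on_eq_lborel:
  fixes f :: "'a::euclidean_space \<Rightarrow> real"
  assumes "S \<in> sets lebesgue" "f \<in> borel_measurable borel" "\<And>x. x \<notin> S \<Longrightarrow> f x = 0"
  shows "(\<integral>x. f x \<partial>lebesgue_on S) = (\<integral>x. f x \<partial>lborel)"
proof -
  have "(\<integral>x. f x \<partial>lebesgue_on UNIV) = (\<integral>x. f x \<partial>lebesgue_on S)"
    using assms by (intro integral_lebesgue_on_subset) auto
  moreover have "(\<integral>x. f x \<partial>lebesgue_on UNIV) = (\<integral>x. f x \<partial>lborel)"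
    using assms by (simp only: lebesgue_on_UNIV_eq) (intro integral_completion, simp)
  ultimately show ?thesis by simp
qed

section \<open>Weak gradients of Lipschitz functions\<close>

text \<open>A one-sided quotient along the steps 1 / (n + 1): a semiconcave function has such limits
  at every point, even where it is not differentiable, and the limit of a sequence of measurable
  functions is measurable.\<close>

definition diff_quotient :: "('a::euclidean_space \<Rightarrow> real) \<Rightarrow> 'a \<Rightarrow> 'a \<Rightarrow> nat \<Rightarrow> real" where
  "diff_quotient U x w n = (U (x + w /\<^sub>R real (Suc n)) - U x) * real (Suc n)"

text \<open>\<open>lim\<close> is an unspecified value at points of divergence, which form a null
  set wherever this is applied.\<close>

definition one_sided_deriv :: "('a::euclidean_space \<Rightarrow> real) \<Rightarrow> 'a \<Rightarrow> 'a \<Rightarrow> real" where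
  "one_sided_deriv U w x = lim (diff_quotient U x w)"

definition one_sided_grad :: "('a::euclidean_space \<Rightarrow> real) \<Rightarrow> 'a \<Rightarrow> 'a" where
  "one_sided_grad U x = (\<Sum>i\<in>Basis. one_sided_deriv U i x *\<^sub>R i)"

text \<open>Convergence is assumed for each direction separately, with an exceptional set that may
  depend on \<open>w\<close>. Linearity in the direction is derived from this and not
  assumed.\<close>

context
  fixes U :: "'a::euclidean_space \<Rightarrow> real" and L :: real and \<Omega> :: "'a set"
  assumes L: "\<And>x y. \<bar>U x - U y\<bar> \<le> L * norm (x - y)"
    and \<Omega>: "open \<Omega>"
    and conv: "\<And>w. AE x in lebesgue_on \<Omega>. convergent (diff_quotient U x w)"
begin

lemma Lipschitz_constant_nonneg: "0 \<le> L"
proof -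
  obtain b :: 'a where "b \<in> Basis" using nonempty_Basis by blast
  then show ?thesis using L[of b 0] by simp
qed

lemma Lipschitz_continuous: "continuous_on UNIV U"
  unfolding continuous_on_iff
proof (intro ballI allI impI)
  fix x :: 'a and e :: real assume "e > 0"
  have "dist (U y) (U x) < e" if "dist y x < e / (L + 1)" for y
  proof -
    have "dist (U y) (U x) \<le> L * dist y x" using L[of y x] by (simp add: dist_norm)
    also have "\<dots> \<le> (L + 1) * dist y x" by (simp add: mult_right_mono)
    also have "\<dots> < e" using that Lipschitz_constant_nonneg by (simp add: field_simps)
    finally show ?thesis .
  qed
  then show "\<exists>d>0. \<forall>y\<in>UNIV. dist y x < d \<longrightarrow> dist (U y) (U x) < e"
    using \<open>e > 0\<close> Lipschitz_constant_nonneg by (intro exI[of _ "e / (L + 1)"]) auto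
qed

lemma diff_quotient_bound: "\<bar>diff_quotient U x w n\<bar> \<le> L * norm w"
proof -
  have "\<bar>diff_quotient U x w n\<bar> = \<bar>U (x + w /\<^sub>R real (Suc n)) - U x\<bar> * real (Suc n)"
    by (simp add: diff_quotient_def abs_mult)
  also have "\<dots> \<le> L * norm (w /\<^sub>R real (Suc n)) * real (Suc n)"
    using L[of "x + w /\<^sub>R real (Suc n)" x] by (intro mult_right_mono) simp_all
  finally show ?thesis by (simp add: field_simps del: of_nat_Suc)
qed

lemma diff_quotient_measurable: "(\<lambda>x. diff_quotient U x w n) \<in> borel_measurable borel"
  unfolding diff_quotient_def
  by (intro borel_measurable_continuous_onI continuous_intros
      continuous_on_compose2[OF Lipschitz_continuous]) auto

lemma one_sided_deriv_measurable: "one_sided_deriv U w \<in> borel_measurable borel"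
proof -
  have "(\<lambda>x. lim (\<lambda>n. diff_quotient U x w n)) \<in> borel_measurable borel"
    by (rule borel_measurable_lim_metric) (rule diff_quotient_measurable)
  then show ?thesis by (simp add: one_sided_deriv_def[abs_def])
qed

lemma one_sided_deriv_bound: "AE x in lebesgue_on \<Omega>. \<bar>one_sided_deriv U w x\<bar> \<le> L * norm w"
  using conv[of w]
proof eventually_elim
  case (elim x)
  then have "(\<lambda>n. \<bar>diff_quotient U x w n\<bar>) \<longlonglongrightarrow> \<bar>one_sided_deriv U w x\<bar>"
    unfolding one_sided_deriv_def by (intro tendsto_rabs) (simp add: convergent_LIMSEQ_iff)
  then show ?case by (rule LIMSEQ_le_const2) (use diff_quotient_bound in auto)
qed

lemma one_sided_deriv_locally_integrable: "locally_integrable \<Omega> (one_sided_deriv U w)"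
  unfolding locally_integrable_iff
proof (intro allI impI)
  fix K assume K: "compact K \<and> K \<subseteq> \<Omega>"
  interpret finite_measure "lebesgue_on K"
    using K by (intro finite_measure_lebesgue_on lmeasurable_compact) auto
  show "integrable (lebesgue_on K) (one_sided_deriv U w)"
  proof (rule integrable_const_bound)
    have "negligible {x \<in> \<Omega>. \<not> norm (one_sided_deriv U w x) \<le> L * norm w}"
      using one_sided_deriv_bound[of w] \<Omega> by (subst AE_lebesgue_on_iff_negligible[symmetric]) auto
    then have "negligible {x \<in> K. \<not> norm (one_sided_deriv U w x) \<le> L * norm w}"
      using K by (auto elim: negligible_subset)
    then show "AE x in lebesgue_on K. norm (one_sided_deriv U w x) \<le> L * norm w"
      using K compact_sets_lebesgue by (subst AE_lebesgue_on_iff_negligible) auto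
    show "one_sided_deriv U w \<in> borel_measurable (lebesgue_on K)"
      using one_sided_deriv_measurable by (intro measurable_restrict_space1 measurable_completion) simp
  qed
qed

text \<open>Discrete integration by parts: translation invariance moves the shift from
  \<open>U\<close> to \<phi> and reverses its sign. The right side is taken over the whole space
  because the shifted \<phi> may leave \<Omega>.\<close>

lemma integral_diff_quotient:
  assumes \<phi>: "\<phi> \<in> test_functions \<Omega>"
  shows "(\<integral>x. diff_quotient U x w n * \<phi> x \<partial>lebesgue_on \<Omega>) =
    (\<integral>x. U x * ((\<phi> (x - w /\<^sub>R real (Suc n)) - \<phi> x) * real (Suc n)) \<partial>lborel)"
proof -
  define h where "h = w /\<^sub>R real (Suc n)"
  define K where "K = supp \<phi>"
  note \<phi>c = continuous_on_test_function[OF \<phi>]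
  have K: "compact K" "K \<subseteq> \<Omega>" "\<And>x. x \<notin> K \<Longrightarrow> \<phi> x = 0"
    using test_function_supp[OF \<phi>] test_function_eq_0 by (auto simp: K_def)
  have K': "compact ((\<lambda>x. x + h) ` K)"
    using K(1) by (intro compact_continuous_image continuous_intros)
  have c1: "continuous_on UNIV (\<lambda>x. U (x + h) * \<phi> x)"
    by (intro continuous_intros continuous_on_compose2[OF Lipschitz_continuous] \<phi>c) auto
  have c2: "continuous_on UNIV (\<lambda>x. U x * \<phi> x)"
    by (intro continuous_intros Lipschitz_continuous \<phi>c)
  have c3: "continuous_on UNIV (\<lambda>x. U x * \<phi> (x - h))"
    by (intro continuous_intros Lipschitz_continuous continuous_on_compose2[OF \<phi>c]) auto
  have i1: "integrable lborel (\<lambda>x. U (x + h) * \<phi> x)"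
    by (rule integrable_compact_supp[OF c1 K(1)]) (simp add: K)
  have i2: "integrable lborel (\<lambda>x. U x * \<phi> x)"
    by (rule integrable_compact_supp[OF c2 K(1)]) (simp add: K)
  have i3: "integrable lborel (\<lambda>x. U x * \<phi> (x - h))"
  proof (rule integrable_compact_supp[OF c3 K'])
    fix x assume "x \<notin> (\<lambda>x. x + h) ` K"
    then have "x - h \<notin> K" by (auto simp: image_iff)
    then show "U x * \<phi> (x - h) = 0" by (simp add: K)
  qed
  have tr: "(\<integral>x. U (x + h) * \<phi> x \<partial>lborel) = (\<integral>x. U x * \<phi> (x - h) \<partial>lborel)"
    using lborel_integral_translate[of "\<lambda>x. U x * \<phi> (x - h)" h] c3
    by (simp add: borel_measurable_continuous_onI)
  have "(\<integral>x. diff_quotient U x w n * \<phi> x \<partial>lebesgue_on \<Omega>) =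
      (\<integral>x. diff_quotient U x w n * \<phi> x \<partial>lborel)"
    using K(2,3) \<Omega> diff_quotient_measurable[of w n] borel_measurable_continuous_onI[OF \<phi>c]
    by (intro integral_lebesgue_on_eq_lborel borel_measurable_times) auto
  also have "\<dots> = (\<integral>x. (U (x + h) * \<phi> x - U x * \<phi> x) * real (Suc n) \<partial>lborel)"
    by (simp add: diff_quotient_def h_def algebra_simps)
  also have "\<dots> = ((\<integral>x. U x * \<phi> (x - h) \<partial>lborel) - (\<integral>x. U x * \<phi> x \<partial>lborel)) * real (Suc n)"
    using i1 i2 tr by (simp del: of_nat_Suc)
  also have "\<dots> = (\<integral>x. (U x * \<phi> (x - h) - U x * \<phi> x) * real (Suc n) \<partial>lborel)"
    using i2 i3 by (simp del: of_nat_Suc)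
  also have "\<dots> = (\<integral>x. U x * ((\<phi> (x - h) - \<phi> x) * real (Suc n)) \<partial>lborel)"
    by (simp add: algebra_simps)
  finally show ?thesis by (simp add: h_def)
qed

text \<open>Both sides of the discrete identity pass to the limit by dominated convergence: on the
  left the quotients of \<open>U\<close> are at most \<open>L * norm w\<close>, on the right \<phi>
  is Lipschitz.\<close>

lemma one_sided_deriv_by_parts:
  assumes \<phi>: "\<phi> \<in> test_functions \<Omega>"
  shows "(\<integral>x. one_sided_deriv U w x * \<phi> x \<partial>lebesgue_on \<Omega>) =
    - (\<integral>x. U x * frechet_derivative \<phi> (at x) w \<partial>lebesgue_on \<Omega>)"
proof -
  define K where "K = supp \<phi>"
  note \<phi>c = continuous_on_test_function[OF \<phi>]
  have K: "compact K" "K \<subseteq> \<Omega>" "\<And>x. x \<notin> K \<Longrightarrow> \<phi> x = 0"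
    using test_function_supp[OF \<phi>] test_function_eq_0 by (auto simp: K_def)
  have i\<phi>: "integrable (lebesgue_on \<Omega>) \<phi>"
    using integrable_mult_test_function[OF \<Omega> _ \<phi>, of "\<lambda>_. 1"]
    by (simp add: locally_integrable_iff finite_measure.integrable_const finite_measure_lebesgue_on
        lmeasurable_compact)
  have l: "(\<lambda>n. \<integral>x. diff_quotient U x w n * \<phi> x \<partial>lebesgue_on \<Omega>) \<longlonglongrightarrow>
      (\<integral>x. one_sided_deriv U w x * \<phi> x \<partial>lebesgue_on \<Omega>)"
  proof (rule integral_dominated_convergence[where w = "\<lambda>x. L * norm w * \<bar>\<phi> x\<bar>"])
    show "integrable (lebesgue_on \<Omega>) (\<lambda>x. L * norm w * \<bar>\<phi> x\<bar>)"
      using i\<phi> by simp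
    have \<phi>m: "\<phi> \<in> borel_measurable (lebesgue_on \<Omega>)" using i\<phi> by simp
    show "(\<lambda>x. one_sided_deriv U w x * \<phi> x) \<in> borel_measurable (lebesgue_on \<Omega>)"
      using one_sided_deriv_measurable
      by (intro borel_measurable_times \<phi>m measurable_restrict_space1 measurable_completion) simp
    show "(\<lambda>x. diff_quotient U x w n * \<phi> x) \<in> borel_measurable (lebesgue_on \<Omega>)" for n
      using diff_quotient_measurable
      by (intro borel_measurable_times \<phi>m measurable_restrict_space1 measurable_completion) simp
    show "AE x in lebesgue_on \<Omega>. norm (diff_quotient U x w n * \<phi> x) \<le> L * norm w * \<bar>\<phi> x\<bar>" for n
      using diff_quotient_bound by (intro AE_I2) (auto simp: abs_mult intro!: mult_right_mono)
    show "AE x in lebesgue_on \<Omega>. (\<lambda>n. diff_quotient U x w n * \<phi> x) \<longlonglongrightarrow> one_sided_deriv U w x * \<phi> x"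
      using conv[of w]
    proof eventually_elim
      case (elim x)
      then show ?case
        unfolding one_sided_deriv_def by (intro tendsto_mult tendsto_const) (simp add: convergent_LIMSEQ_iff)
    qed
  qed
  \<comment> \<open>All translates of the support that occur for steps in [0, 1] lie in this one
    compact set, which makes the dominating function integrable.\<close>
  define K' where "K' = (\<lambda>(x, s). x + s *\<^sub>R w) ` (K \<times> {0..1::real})"
  have K': "compact K'" unfolding K'_def
    by (intro compact_continuous_image compact_Times K) (auto intro!: continuous_intros simp: split_beta)
  have shift: "\<phi> (x - s *\<^sub>R w) = 0" if "x \<notin> K'" "s \<in> {0..1}" for x s
  proof (rule K(3), rule notI)
    assume "x - s *\<^sub>R w \<in> K"
    then have "x \<in> K'" unfolding K'_def using that by (intro image_eqI[of _ _ "(x - s *\<^sub>R w, s)"]) auto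
    with that show False by simp
  qed
  obtain C where C: "C \<ge> 0" "\<And>x y. \<bar>\<phi> x - \<phi> y\<bar> \<le> C * norm (x - y)"
    using test_function_Lipschitz[OF \<phi>] by blast
  have iw: "integrable lborel (\<lambda>x. indicator K' x *\<^sub>R (\<bar>U x\<bar> * (C * norm w)))"
    using K' by (intro borel_integrable_compact) (auto intro!: continuous_intros continuous_on_subset[OF Lipschitz_continuous])
  have r: "(\<lambda>n. \<integral>x. U x * ((\<phi> (x - w /\<^sub>R real (Suc n)) - \<phi> x) * real (Suc n)) \<partial>lborel) \<longlonglongrightarrow>
      (\<integral>x. U x * - frechet_derivative \<phi> (at x) w \<partial>lborel)"
  proof (rule integral_dominated_convergence[OF _ _ iw])
    show "(\<lambda>x. U x * - frechet_derivative \<phi> (at x) w) \<in> borel_measurable lborel"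
      using continuous_on_frechet_derivative_test_function[OF \<phi>]
      by (simp, intro borel_measurable_continuous_onI continuous_intros Lipschitz_continuous)
    show "(\<lambda>x. U x * ((\<phi> (x - w /\<^sub>R real (Suc n)) - \<phi> x) * real (Suc n))) \<in> borel_measurable lborel" for n
      by (simp del: of_nat_Suc, intro borel_measurable_continuous_onI continuous_intros Lipschitz_continuous
          continuous_on_compose2[OF \<phi>c] \<phi>c) auto
    show "AE x in lborel. norm (U x * ((\<phi> (x - w /\<^sub>R real (Suc n)) - \<phi> x) * real (Suc n)))
        \<le> indicator K' x *\<^sub>R (\<bar>U x\<bar> * (C * norm w))" for n
    proof (rule AE_I2)
      fix x
      show "norm (U x * ((\<phi> (x - w /\<^sub>R real (Suc n)) - \<phi> x) * real (Suc n)))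
        \<le> indicator K' x *\<^sub>R (\<bar>U x\<bar> * (C * norm w))"
      proof (cases "x \<in> K'")
        case True
        have "\<bar>\<phi> (x - w /\<^sub>R real (Suc n)) - \<phi> x\<bar> * real (Suc n) \<le> C * norm (w /\<^sub>R real (Suc n)) * real (Suc n)"
          using C(2)[of "x - w /\<^sub>R real (Suc n)" x] by (intro mult_right_mono) simp_all
        then have "\<bar>\<phi> (x - w /\<^sub>R real (Suc n)) - \<phi> x\<bar> * real (Suc n) \<le> C * norm w"
          by (simp add: field_simps del: of_nat_Suc)
        then show ?thesis using True by (simp add: abs_mult mult_left_mono del: of_nat_Suc)
      next
        case False
        have "\<phi> (x - w /\<^sub>R real (Suc n)) = 0"
          using shift[OF False, of "inverse (real (Suc n))"] by (simp add: field_simps del: of_nat_Suc)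
        moreover have "\<phi> x = 0" using shift[OF False, of 0] by simp
        ultimately show ?thesis using False by simp
      qed
    qed
    show "AE x in lborel. (\<lambda>n. U x * ((\<phi> (x - w /\<^sub>R real (Suc n)) - \<phi> x) * real (Suc n)))
        \<longlonglongrightarrow> U x * - frechet_derivative \<phi> (at x) w"
    proof (intro AE_I2 tendsto_mult tendsto_const)
      fix x
      interpret linear "frechet_derivative \<phi> (at x)"
        using test_function_has_derivative[OF \<phi>] by (rule has_derivative_linear)
      have "((\<lambda>s. \<phi> (x + s *\<^sub>R w)) has_derivative (\<lambda>s. frechet_derivative \<phi> (at x) (s *\<^sub>R w))) (at 0)"
        by (rule has_derivative_compose[of "\<lambda>s. x + s *\<^sub>R w" "\<lambda>s. s *\<^sub>R w"])
           (auto intro!: derivative_eq_intros test_function_has_derivative[OF \<phi>])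
      moreover have "(\<lambda>s. frechet_derivative \<phi> (at x) (s *\<^sub>R w)) = (*) (frechet_derivative \<phi> (at x) w)"
        by (simp add: fun_eq_iff scale)
      ultimately have "((\<lambda>s. \<phi> (x + s *\<^sub>R w)) has_real_derivative frechet_derivative \<phi> (at x) w) (at 0)"
        by (simp add: has_field_derivative_def)
      then have d: "((\<lambda>s. (\<phi> (x + s *\<^sub>R w) - \<phi> x) / s) \<longlongrightarrow> frechet_derivative \<phi> (at x) w) (at 0)"
        by (simp add: DERIV_def)
      \<comment> \<open>The shifts x - w / (n + 1) approach x with the negative parameter -1 / (n +
        1), whence the minus signs below.\<close>
      have "filterlim (\<lambda>n. - inverse (real (Suc n))) (at 0) sequentially"
        unfolding filterlim_at using tendsto_minus[OF LIMSEQ_inverse_real_of_nat] by auto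
      note lim = tendsto_minus[OF filterlim_compose[OF d this]]
      have "- ((\<phi> (x + (- inverse (real (Suc n))) *\<^sub>R w) - \<phi> x) / (- inverse (real (Suc n)))) =
          (\<phi> (x - w /\<^sub>R real (Suc n)) - \<phi> x) * real (Suc n)" for n
        by (simp add: divide_inverse del: of_nat_Suc)
      then show "(\<lambda>n. (\<phi> (x - w /\<^sub>R real (Suc n)) - \<phi> x) * real (Suc n)) \<longlonglongrightarrow> - frechet_derivative \<phi> (at x) w"
        using lim by (simp only:)
    qed
  qed
  have "(\<integral>x. one_sided_deriv U w x * \<phi> x \<partial>lebesgue_on \<Omega>) = (\<integral>x. U x * - frechet_derivative \<phi> (at x) w \<partial>lborel)"
    using l r unfolding integral_diff_quotient[OF \<phi>] by (rule LIMSEQ_unique)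
  also have "\<dots> = (\<integral>x. U x * - frechet_derivative \<phi> (at x) w \<partial>lebesgue_on \<Omega>)"
  proof (rule integral_lebesgue_on_eq_lborel[symmetric])
    show "(\<lambda>x. U x * - frechet_derivative \<phi> (at x) w) \<in> borel_measurable borel"
      using continuous_on_frechet_derivative_test_function[OF \<phi>]
      by (intro borel_measurable_continuous_onI continuous_intros Lipschitz_continuous)
    show "U x * - frechet_derivative \<phi> (at x) w = 0" if "x \<notin> \<Omega>" for x
    proof -
      have "x \<notin> supp \<phi>" using that K(2) by (auto simp: K_def)
      then show ?thesis by (simp add: frechet_derivative_eq_0_outside_supp)
    qed
  qed (use \<Omega> in auto)
  finally show ?thesis by simp
qed

lemma one_sided_grad_inner: "one_sided_grad U x \<bullet> w = (\<Sum>i\<in>Basis. (w \<bullet> i) * one_sided_deriv U i x)"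
  by (simp add: one_sided_grad_def inner_sum_left inner_commute[of w] mult.commute)

lemma has_weak_gradient_one_sided_grad: "has_weak_gradient \<Omega> U (one_sided_grad U)"
  unfolding has_weak_gradient_def
proof (intro conjI ballI)
  show "locally_integrable \<Omega> U"
    unfolding locally_integrable_iff
    by (auto intro!: integrable_lebesgue_on_compact continuous_on_subset[OF Lipschitz_continuous])
  show "locally_integrable \<Omega> (one_sided_grad U)"
    using one_sided_deriv_locally_integrable
    unfolding locally_integrable_iff one_sided_grad_def by auto
  fix \<phi> :: "'a \<Rightarrow> real" and i :: 'a assume \<phi>: "\<phi> \<in> test_functions \<Omega>" and i: "i \<in> Basis"
  have "one_sided_grad U x \<bullet> i = one_sided_deriv U i x" for x
    using i by (simp add: one_sided_grad_def inner_sum_left inner_Basis if_distrib[of "\<lambda>a. _ * a"] sum.delta cong: if_cong)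
  then show "(\<integral>x. U x * frechet_derivative \<phi> (at x) i \<partial>lebesgue_on \<Omega>) =
      - (\<integral>x. (one_sided_grad U x \<bullet> i) * \<phi> x \<partial>lebesgue_on \<Omega>)"
    using one_sided_deriv_by_parts[OF \<phi>, of i] by simp
qed

text \<open>The directional derivatives depend linearly on the direction almost everywhere, because
  integration by parts turns them into derivatives of the test function.\<close>

lemma one_sided_deriv_eq_grad_inner:
  "AE x in lebesgue_on \<Omega>. one_sided_deriv U w x - one_sided_grad U x \<bullet> w = 0"
proof (rule AE_0_on_open[OF \<Omega>])
  have lg: "locally_integrable \<Omega> (\<lambda>x. one_sided_grad U x \<bullet> w)"
    using has_weak_gradient_one_sided_grad by (auto simp: has_weak_gradient_def intro: locally_integrable_inner)
  then show "locally_integrable \<Omega> (\<lambda>x. one_sided_deriv U w x - one_sided_grad U x \<bullet> w)"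
    by (intro locally_integrable_diff one_sided_deriv_locally_integrable)
  fix \<phi> assume \<phi>: "\<phi> \<in> test_functions \<Omega>"
  note int = integrable_mult_test_function[OF \<Omega> _ \<phi>]
  have intU: "integrable (lebesgue_on \<Omega>) (\<lambda>x. U x * frechet_derivative \<phi> (at x) i)" for i
  proof -
    have "continuous_on UNIV (\<lambda>x. U x * frechet_derivative \<phi> (at x) i)"
      using continuous_on_frechet_derivative_test_function[OF \<phi>] by (intro continuous_intros Lipschitz_continuous)
    then have "integrable (lebesgue_on (supp \<phi>)) (\<lambda>x. U x * frechet_derivative \<phi> (at x) i)"
      by (intro integrable_lebesgue_on_compact test_function_supp(1)[OF \<phi>])
         (auto intro: continuous_on_subset)
    then show ?thesis
      using test_function_supp[OF \<phi>] \<Omega> compact_sets_lebesgue frechet_derivative_eq_0_outside_supp[of _ \<phi> i]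
      by (subst integrable_lebesgue_on_subset_iff[of "supp \<phi>"]) auto
  qed
  have "(\<integral>x. one_sided_grad U x \<bullet> w * \<phi> x \<partial>lebesgue_on \<Omega>) =
      (\<integral>x. (\<Sum>i\<in>Basis. (w \<bullet> i) * (one_sided_deriv U i x * \<phi> x)) \<partial>lebesgue_on \<Omega>)"
    by (simp add: one_sided_grad_inner sum_distrib_right mult.assoc)
  also have "\<dots> = (\<Sum>i\<in>Basis. (w \<bullet> i) * (\<integral>x. one_sided_deriv U i x * \<phi> x \<partial>lebesgue_on \<Omega>))"
    using int[OF one_sided_deriv_locally_integrable] by (subst Bochner_Integration.integral_sum) auto
  also have "\<dots> = - (\<Sum>i\<in>Basis. (w \<bullet> i) * (\<integral>x. U x * frechet_derivative \<phi> (at x) i \<partial>lebesgue_on \<Omega>))"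
    by (simp add: one_sided_deriv_by_parts[OF \<phi>] sum_negf)
  also have "\<dots> = - (\<integral>x. (\<Sum>i\<in>Basis. (w \<bullet> i) * (U x * frechet_derivative \<phi> (at x) i)) \<partial>lebesgue_on \<Omega>)"
    using intU by (subst Bochner_Integration.integral_sum) auto
  also have "\<dots> = - (\<integral>x. U x * frechet_derivative \<phi> (at x) w \<partial>lebesgue_on \<Omega>)"
    by (subst frechet_derivative_test_function[OF \<phi>, of _ w]) (simp add: sum_distrib_left ac_simps)
  also have "\<dots> = (\<integral>x. one_sided_deriv U w x * \<phi> x \<partial>lebesgue_on \<Omega>)"
    by (simp add: one_sided_deriv_by_parts[OF \<phi>])
  finally show "(\<integral>x. (one_sided_deriv U w x - one_sided_grad U x \<bullet> w) * \<phi> x \<partial>lebesgue_on \<Omega>) = 0"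
    using int[OF lg] int[OF one_sided_deriv_locally_integrable] by (simp add: left_diff_distrib)
qed

text \<open>For each \<open>w\<close> the inner product of the gradient with \<open>w\<close> is at
  most \<open>L * norm w\<close> off a null set depending on \<open>w\<close>. A countable dense set
  of directions leaves a single null set, continuity extends the bound to all directions, and the
  gradient itself is then inserted as the direction. Estimating the components one by one would lose
  a factor that depends on the dimension.\<close>

lemma norm_one_sided_grad_le: "AE x in lebesgue_on \<Omega>. norm (one_sided_grad U x) \<le> L"
proof -
  obtain W :: "'a set" where W: "countable W" "\<And>X. open X \<Longrightarrow> X \<noteq> {} \<Longrightarrow> \<exists>d\<in>W. d \<in> X"
    using countable_dense_setE by blast
  have "AE x in lebesgue_on \<Omega>. \<bar>one_sided_grad U x \<bullet> w\<bar> \<le> L * norm w" for w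
    using one_sided_deriv_eq_grad_inner[of w] one_sided_deriv_bound[of w] by eventually_elim simp
  then have "AE x in lebesgue_on \<Omega>. \<forall>w\<in>W. \<bar>one_sided_grad U x \<bullet> w\<bar> \<le> L * norm w"
    using W(1) by (intro AE_ball_countable') auto
  then show ?thesis
  proof eventually_elim
    case (elim x)
    let ?g = "one_sided_grad U x"
    have "closed {w. \<bar>?g \<bullet> w\<bar> \<le> L * norm w}"
      by (intro closed_Collect_le continuous_intros)
    then have "open (- {w. \<bar>?g \<bullet> w\<bar> \<le> L * norm w})" by (rule open_Compl)
    then have "- {w. \<bar>?g \<bullet> w\<bar> \<le> L * norm w} = {}"
      using W(2) elim by blast
    then have "\<bar>?g \<bullet> ?g\<bar> \<le> L * norm ?g" by blast
    then have "norm ?g * norm ?g \<le> L * norm ?g"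
      by (simp add: dot_square_norm power2_eq_square)
    then show ?case using Lipschitz_constant_nonneg by (cases "?g = 0") auto
  qed
qed

lemma one_sided_grad_measurable: "one_sided_grad U \<in> borel_measurable (lebesgue_on S)"
proof -
  have "one_sided_grad U \<in> borel_measurable borel"
    unfolding one_sided_grad_def[abs_def]
    by (intro borel_measurable_sum borel_measurable_scaleR one_sided_deriv_measurable) auto
  then show ?thesis by (intro measurable_restrict_space1 measurable_completion) simp
qed

end

lemma Lipschitz_weak_gradient:
  fixes U :: "'a::euclidean_space \<Rightarrow> real"
  assumes "\<And>x y. \<bar>U x - U y\<bar> \<le> L * norm (x - y)" and "open \<Omega>"
    and "\<And>w. AE x in lebesgue_on \<Omega>. convergent (diff_quotient U x w)"
  obtains G where "has_weak_gradient \<Omega> U G" "G \<in> borel_measurable (lebesgue_on \<Omega>)"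
    "AE x in lebesgue_on \<Omega>. norm (G x) \<le> L"
  using has_weak_gradient_one_sided_grad[OF assms] one_sided_grad_measurable[OF assms]
    norm_one_sided_grad_le[OF assms] that by blast

section \<open>Level sets and directional derivatives of the distance function\<close>

text \<open>On the segment from \<open>z\<close> to a nearest point \<open>y\<close> of
  \<open>F\<close> the point \<open>y\<close> stays nearest, since a closer one would be closer to
  \<open>z\<close> too.\<close>

lemma infdist_scaled_segment:
  fixes x y z :: "'a::euclidean_space"
  assumes "x - y = t *\<^sub>R (z - y)" "y \<in> F" "infdist z F = dist z y" "0 \<le> t" "t \<le> 1"
  shows "infdist x F = t * infdist z F"
proof (rule antisym)
  have xy: "dist x y = t * dist z y" using assms by (simp add: dist_norm)
  show "infdist x F \<le> t * infdist z F"
    using infdist_le[OF assms(2), of x] assms xy by simp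
  have "z - x = (1 - t) *\<^sub>R (z - y)" using assms(1) by (simp add: algebra_simps)
  then have "dist z x = (1 - t) * dist z y" using assms by (simp add: dist_norm)
  moreover have "infdist z F \<le> infdist x F + dist z x" by (rule infdist_triangle)
  ultimately show "t * infdist z F \<le> infdist x F" using assms by (simp add: algebra_simps)
qed

text \<open>Uncountably many level sets of finite total measure cannot all have positive measure.
  Moving towards the nearest point does not shrink distances by more than the factor \<open>s / \<tau>\<close>, so
  a level set is a Lipschitz image of part of a negligible level set closer to \<open>F\<close>.\<close>

lemma negligible_infdist_level:
  fixes F :: "'a::euclidean_space set"
  assumes F: "compact F" "F \<noteq> {}" and \<tau>: "\<tau> > 0"
  shows "negligible {x. infdist x F = \<tau>}"
proof -
  define A where "A s = {x. infdist x F = s}" for s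
  define B where "B = {x. infdist x F \<le> \<tau>}"
  have clF: "closed F" using F by (simp add: compact_imp_closed)
  have cont: "continuous_on UNIV (\<lambda>x. infdist x F)" by (intro continuous_intros)
  have "B = (\<lambda>(x, y). x + y) ` (F \<times> cball 0 \<tau>)"
  proof (intro equalityI subsetI)
    fix x assume "x \<in> B"
    moreover obtain y where "y \<in> F" "infdist x F = dist x y" using infdist_attains_inf[OF clF F(2)] by blast
    ultimately show "x \<in> (\<lambda>(x, y). x + y) ` (F \<times> cball 0 \<tau>)"
      by (intro image_eqI[of _ _ "(y, x - y)"]) (auto simp: B_def dist_norm norm_minus_commute)
  next
    fix x assume "x \<in> (\<lambda>(x, y). x + y) ` (F \<times> cball 0 \<tau>)"
    then obtain y z where "x = y + z" "y \<in> F" "norm z \<le> \<tau>" by auto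
    then show "x \<in> B" using infdist_le[of y F x] by (simp add: B_def dist_norm)
  qed
  moreover have "compact ((\<lambda>(x, y). x + y) ` (F \<times> cball (0::'a) \<tau>))"
    using F by (intro compact_continuous_image compact_Times) (auto intro!: continuous_intros simp: split_beta)
  ultimately have B: "compact B" by simp
  have B': "B \<in> lmeasurable" "B \<in> sets lebesgue"
    using B by (auto simp: compact_imp_closed lmeasurable_compact compact_sets_lebesgue)
  define M where "M = distr (lebesgue_on B) borel (\<lambda>x. infdist x F)"
  have dm: "(\<lambda>x. infdist x F) \<in> borel_measurable (lebesgue_on B)"
    using cont by (rule borel_measurable_lebesgue_on_continuous)
  interpret finite_measure "lebesgue_on B" using B'(1) by (rule finite_measure_lebesgue_on)
  interpret M: finite_measure M unfolding M_def by (rule finite_measure_distr[OF dm])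
  have "countable {s. measure M {s} \<noteq> 0}" by (rule M.countable_support)
  then have "\<not> {0<..<\<tau>} \<subseteq> {s. measure M {s} \<noteq> 0}"
    using \<tau> uncountable_open_interval[of 0 \<tau>] by (auto dest: countable_subset)
  then obtain s where s: "0 < s" "s < \<tau>" "measure M {s} = 0" by auto
  have "A s \<subseteq> B" using s by (auto simp: A_def B_def)
  have clA: "closed (A s)" unfolding A_def by (intro closed_Collect_eq continuous_intros)
  have nA: "negligible (A s)"
  proof -
    have "measure M {s} = measure (lebesgue_on B) ((\<lambda>x. infdist x F) -` {s} \<inter> space (lebesgue_on B))"
      unfolding M_def by (rule measure_distr[OF dm]) simp
    also have "(\<lambda>x. infdist x F) -` {s} \<inter> space (lebesgue_on B) = A s"
      using \<open>A s \<subseteq> B\<close> by (auto simp: A_def)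
    also have "measure (lebesgue_on B) (A s) = measure lebesgue (A s)"
      using B'(2) \<open>A s \<subseteq> B\<close> by (intro measure_restrict_space) auto
    finally have "measure lebesgue (A s) = 0" using s by simp
    moreover have "A s \<in> lmeasurable"
      using clA \<open>A s \<subseteq> B\<close> B by (intro lmeasurable_compact) (metis compact_Int_closed inf.absorb_iff2)
    ultimately show ?thesis by (simp add: negligible_iff_measure)
  qed
  define c where "c = s / \<tau>"
  have c: "0 < c" "c < 1" using s \<tau> by (auto simp: c_def)
  have "\<exists>y. y \<in> F \<and> infdist x F = dist x y" for x
    using infdist_attains_inf[OF clF F(2)] by blast
  then obtain y where y: "\<And>x. y x \<in> F" "\<And>x. infdist x F = dist x (y x)" by metis
  define f where "f x = y x + c *\<^sub>R (x - y x)" for x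
  \<comment> \<open>\<open>y x\<close> is nearest to \<open>x\<close> and \<open>y x'\<close> to
    \<open>x'\<close>; comparing each with the other's choice shows that x - x' and y x - y x' form
    no obtuse angle. The mixed term in the square is therefore nonnegative.\<close>
  have expand: "c * norm (x - x') \<le> norm (f x - f x')" for x x'
  proof -
    let ?a = "x - x'" and ?b = "y x - y x'"
    have "(dist x (y x))\<^sup>2 \<le> (dist x (y x'))\<^sup>2"
      using infdist_le[OF y(1)[of x'], of x] y(2)[of x] by (intro power_mono) auto
    moreover have "(dist x' (y x'))\<^sup>2 \<le> (dist x' (y x))\<^sup>2"
      using infdist_le[OF y(1)[of x], of x'] y(2)[of x'] by (intro power_mono) auto
    ultimately have ab: "?a \<bullet> ?b \<ge> 0"
      by (simp add: dist_norm power2_norm_eq_inner inner_diff_left inner_diff_right inner_commute)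
    have "f x - f x' = (1 - c) *\<^sub>R ?b + c *\<^sub>R ?a" by (simp add: f_def algebra_simps)
    then have "(norm (f x - f x'))\<^sup>2 = (1 - c)\<^sup>2 * (?b \<bullet> ?b) + 2 * (1 - c) * c * (?a \<bullet> ?b) + c\<^sup>2 * (?a \<bullet> ?a)"
      by (simp only: power2_norm_eq_inner inner_add_left inner_add_right inner_scaleR_left inner_scaleR_right
          inner_commute[of ?b ?a]) (simp add: power2_eq_square algebra_simps)
    also have "\<dots> \<ge> c\<^sup>2 * (?a \<bullet> ?a)" using ab c by simp
    finally have "(c * norm ?a)\<^sup>2 \<le> (norm (f x - f x'))\<^sup>2"
      by (simp add: power_mult_distrib power2_norm_eq_inner)
    then show ?thesis by (rule power2_le_imp_le) simp
  qed
  have fA: "f ` A \<tau> \<subseteq> A s"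
  proof
    fix z assume "z \<in> f ` A \<tau>"
    then obtain x where x: "z = f x" "infdist x F = \<tau>" by (auto simp: A_def)
    have "infdist z F = c * infdist x F"
      using c y by (intro infdist_scaled_segment[of _ "y x"]) (auto simp: x(1) f_def)
    then show "z \<in> A s" using x \<tau> by (simp add: A_def c_def)
  qed
  have inj: "inj_on f (A \<tau>)"
  proof (rule inj_onI)
    fix x x' assume "f x = f x'"
    then have "c * norm (x - x') \<le> 0" using expand[of x x'] by simp
    then show "x = x'" using c by (simp add: mult_le_0_iff)
  qed
  \<comment> \<open>Nearest points are chosen arbitrarily, so \<open>f\<close> need not be
    continuous. Only its inverse has to be Lipschitz, with constant 1 / c, which is what
    \<open>expand\<close> provides.\<close>
  have "negligible (the_inv_into (A \<tau>) f ` (f ` A \<tau>))"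
  proof (rule negligible_locally_Lipschitz_image)
    show "negligible (f ` A \<tau>)" using fA nA by (rule negligible_subset[rotated])
    fix z assume "z \<in> f ` A \<tau>"
    then have "norm (the_inv_into (A \<tau>) f z' - the_inv_into (A \<tau>) f z) \<le> 1 / c * norm (z' - z)"
      if "z' \<in> f ` A \<tau>" for z'
      using that expand c inj by (auto simp: the_inv_into_f_f field_simps)
    then show "\<exists>T B. open T \<and> z \<in> T \<and> (\<forall>z'\<in>f ` A \<tau> \<inter> T.
        norm (the_inv_into (A \<tau>) f z' - the_inv_into (A \<tau>) f z) \<le> B * norm (z' - z))"
      by (intro exI[of _ UNIV] exI[of _ "1 / c"]) auto
  qed simp
  moreover have "the_inv_into (A \<tau>) f ` (f ` A \<tau>) = A \<tau>"
    using inj by (force simp: the_inv_into_f_f)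
  ultimately show ?thesis by (simp add: A_def)
qed

text \<open>The squared distance minus \<open>h\<^sup>2 |w|\<^sup>2\<close> is an infimum of functions affine in \<open>h\<close>.\<close>

lemma infdist_semiconcave:
  fixes F :: "'a::euclidean_space set"
  assumes F: "closed F" "F \<noteq> {}" and hk: "0 \<le> h" "h \<le> k" "0 < k"
  shows "(1 - h / k) * (infdist x F)\<^sup>2 + (h / k) * ((infdist (x + k *\<^sub>R w) F)\<^sup>2 - k\<^sup>2 * (w \<bullet> w))
    \<le> (infdist (x + h *\<^sub>R w) F)\<^sup>2 - h\<^sup>2 * (w \<bullet> w)"
proof -
  \<comment> \<open>\<open>y\<close> is nearest to the intermediate point, so its affine function
    equals the infimum there and lies above it at both ends.\<close>
  obtain y where y: "y \<in> F" "infdist (x + h *\<^sub>R w) F = dist (x + h *\<^sub>R w) y"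
    using infdist_attains_inf[OF F] by blast
  have sq: "(dist (x + s *\<^sub>R w) y)\<^sup>2 - s\<^sup>2 * (w \<bullet> w) = (x - y) \<bullet> (x - y) + 2 * s * (w \<bullet> (x - y))" for s
    by (simp only: dist_norm power2_norm_eq_inner)
       (simp add: inner_add_left inner_add_right inner_diff_left inner_diff_right inner_commute
        power2_eq_square algebra_simps)
  have le: "(infdist z F)\<^sup>2 \<le> (dist z y)\<^sup>2" for z
    using infdist_le[OF y(1), of z] infdist_nonneg[of z F] by (intro power_mono) auto
  have "(1 - h / k) * (infdist x F)\<^sup>2 + (h / k) * ((infdist (x + k *\<^sub>R w) F)\<^sup>2 - k\<^sup>2 * (w \<bullet> w))
      \<le> (1 - h / k) * (dist (x + 0 *\<^sub>R w) y)\<^sup>2 + (h / k) * ((dist (x + k *\<^sub>R w) y)\<^sup>2 - k\<^sup>2 * (w \<bullet> w))"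
    using hk le[of x] le[of "x + k *\<^sub>R w"] by (intro add_mono mult_left_mono) auto
  also have "\<dots> = (dist (x + h *\<^sub>R w) y)\<^sup>2 - h\<^sup>2 * (w \<bullet> w)"
    using sq[of 0] sq[of k] sq[of h] hk(3) by (simp add: field_simps)
  finally show ?thesis using y by simp
qed

lemma infdist_tendsto_shift:
  fixes x w :: "'a::euclidean_space"
  shows "(\<lambda>n. infdist (x + w /\<^sub>R real (Suc n)) F) \<longlonglongrightarrow> infdist x F"
proof -
  have "(\<lambda>n. infdist (x + w /\<^sub>R real (Suc n)) F) \<longlonglongrightarrow> infdist (x + 0 *\<^sub>R w) F"
    by (intro tendsto_infdist tendsto_add tendsto_scaleR tendsto_const LIMSEQ_inverse_real_of_nat)
  then show ?thesis by simp
qed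

text \<open>By concavity the quotients of d^2, corrected by the last term of \<open>q\<close>,
  increase as the step shrinks, and the Lipschitz bound keeps them bounded. Dividing by
  \<open>D n + d\<close>, which tends to 2 d > 0 off \<open>F\<close>, turns the limit for d^2 into
  one for d.\<close>

lemma convergent_diff_quotient_infdist:
  fixes F :: "'a::euclidean_space set"
  assumes F: "closed F" "F \<noteq> {}" and x: "x \<notin> F"
  shows "convergent (diff_quotient (\<lambda>x. infdist x F) x w)"
proof -
  define d where "d = infdist x F"
  define D where "D n = infdist (x + w /\<^sub>R real (Suc n)) F" for n
  define q where "q n = (D n ^ 2 - d ^ 2) * real (Suc n) - (w \<bullet> w) * inverse (real (Suc n))" for n
  have d: "d > 0" unfolding d_def using infdist_pos_not_in_closed[OF F x] .
  have D0: "D n \<ge> 0" for n by (simp add: D_def infdist_nonneg)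
  have "incseq q"
  proof (rule incseq_SucI)
    fix n
    define h k where "h = inverse (real (Suc (Suc n)))" and "k = inverse (real (Suc n))"
    have hk: "0 < h" "h \<le> k" "0 < k" by (auto simp: h_def k_def)
    have qh: "q (Suc n) = (D (Suc n) ^ 2 - h\<^sup>2 * (w \<bullet> w) - d ^ 2) / h"
      using hk by (simp add: q_def h_def power2_eq_square field_simps del: of_nat_Suc)
    have qk: "q n = (D n ^ 2 - k\<^sup>2 * (w \<bullet> w) - d ^ 2) / k"
      using hk by (simp add: q_def k_def power2_eq_square field_simps del: of_nat_Suc)
    have "(1 - h / k) * d\<^sup>2 + (h / k) * ((D n)\<^sup>2 - k\<^sup>2 * (w \<bullet> w)) \<le> (D (Suc n))\<^sup>2 - h\<^sup>2 * (w \<bullet> w)"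
      using infdist_semiconcave[OF F, of h k x w] hk by (simp add: d_def D_def h_def k_def del: of_nat_Suc)
    then have "(h / k) * ((D n)\<^sup>2 - k\<^sup>2 * (w \<bullet> w) - d\<^sup>2) \<le> (D (Suc n))\<^sup>2 - h\<^sup>2 * (w \<bullet> w) - d\<^sup>2"
      by (simp add: algebra_simps)
    then show "q n \<le> q (Suc n)"
      unfolding qh qk using hk(1) by (simp add: pos_le_divide_eq mult.commute)
  qed
  moreover have "q n \<le> norm w * (2 * d + norm w)" for n
  proof -
    define h where "h = inverse (real (Suc n))"
    have h: "0 < h" "h \<le> 1" "real (Suc n) = 1 / h" by (auto simp: h_def inverse_eq_divide)
    have "\<bar>D n - d\<bar> \<le> h * norm w"
      using infdist_triangle_abs[of "x + w /\<^sub>R real (Suc n)" F x]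
      by (simp add: D_def d_def dist_norm h_def del: of_nat_Suc)
    then have 1: "D n - d \<le> h * norm w" "D n + d \<le> 2 * d + norm w"
      using h mult_right_mono[of h 1 "norm w"] by auto
    have "D n ^ 2 - d ^ 2 = (D n - d) * (D n + d)" by (simp add: power2_eq_square algebra_simps)
    also have "\<dots> \<le> (h * norm w) * (2 * d + norm w)"
      using 1 D0[of n] d h by (intro mult_mono) auto
    finally have "(D n ^ 2 - d ^ 2) / h \<le> norm w * (2 * d + norm w)"
      using h by (simp add: pos_divide_le_eq mult_ac)
    moreover have "q n \<le> (D n ^ 2 - d ^ 2) / h"
      unfolding q_def h(3) using h by simp
    ultimately show ?thesis by linarith
  qed
  ultimately have "convergent q"
    by (metis incseq_convergent convergent_def)
  then obtain l where "q \<longlonglongrightarrow> l" by (auto simp: convergent_def)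
  then have "(\<lambda>n. q n + (w \<bullet> w) * inverse (real (Suc n))) \<longlonglongrightarrow> l + (w \<bullet> w) * 0"
    by (intro tendsto_add tendsto_mult tendsto_const LIMSEQ_inverse_real_of_nat)
  moreover have "(\<lambda>n. D n + d) \<longlonglongrightarrow> d + d"
    using infdist_tendsto_shift[of x w F] by (intro tendsto_intros) (simp add: D_def d_def)
  ultimately have "(\<lambda>n. (q n + (w \<bullet> w) * inverse (real (Suc n))) / (D n + d)) \<longlonglongrightarrow> (l + (w \<bullet> w) * 0) / (d + d)"
    using d by (intro tendsto_divide) auto
  moreover have "(q n + (w \<bullet> w) * inverse (real (Suc n))) / (D n + d) = diff_quotient (\<lambda>x. infdist x F) x w n" for n
  proof -
    have "D n + d \<noteq> 0" using D0[of n] d by linarith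
    moreover have "D n ^ 2 - d ^ 2 = (D n - d) * (D n + d)" by (simp add: power2_eq_square algebra_simps)
    ultimately show ?thesis by (simp add: q_def diff_quotient_def D_def d_def del: of_nat_Suc)
  qed
  ultimately show ?thesis by (simp add: convergent_def) blast
qed

text \<open>Off the null set c d = r the truncation is locally void or locally constant.\<close>

lemma AE_convergent_diff_quotient_min:
  fixes F :: "'a::euclidean_space set"
  assumes F: "compact F" "F \<noteq> {}" and \<Omega>: "open \<Omega>" "\<Omega> \<inter> F = {}" and c: "c \<ge> 0" "r > 0"
  shows "AE x in lebesgue_on \<Omega>. convergent (diff_quotient (\<lambda>x. min (c * infdist x F) r) x w)"
proof -
  let ?U = "\<lambda>x. min (c * infdist x F) r"
  have clF: "closed F" using F by (simp add: compact_imp_closed)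
  have "negligible {x. c * infdist x F = r}"
  proof (cases "c = 0")
    case False
    then have "{x. c * infdist x F = r} = {x. infdist x F = r / c}" by (auto simp: field_simps)
    then show ?thesis using negligible_infdist_level[OF F, of "r / c"] c False by simp
  qed (use c in simp)
  then have "AE x in lebesgue_on \<Omega>. c * infdist x F \<noteq> r"
    using \<Omega> by (subst AE_lebesgue_on_iff_negligible) (auto elim: negligible_subset)
  then show ?thesis
  proof (rule AE_mp, intro AE_I2 impI)
    fix x assume "x \<in> space (lebesgue_on \<Omega>)" and ne: "c * infdist x F \<noteq> r"
    then have x: "x \<in> \<Omega>" "x \<notin> F" using \<Omega> by auto
    let ?D = "\<lambda>n. c * infdist (x + w /\<^sub>R real (Suc n)) F"
    have lim: "?D \<longlonglongrightarrow> c * infdist x F"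
      by (intro tendsto_intros infdist_tendsto_shift)
    obtain l where l: "diff_quotient (\<lambda>x. infdist x F) x w \<longlonglongrightarrow> l"
      using convergent_diff_quotient_infdist[OF clF F(2) x(2), of w] by (auto simp: convergent_def)
    show "convergent (diff_quotient ?U x w)"
    proof (cases "c * infdist x F < r")
      case True
      have "\<forall>\<^sub>F n in sequentially. ?D n < r" by (rule order_tendstoD(2)[OF lim True])
      then have "\<forall>\<^sub>F n in sequentially. c * diff_quotient (\<lambda>x. infdist x F) x w n = diff_quotient ?U x w n"
        by eventually_elim (use True in \<open>simp add: diff_quotient_def algebra_simps\<close>)
      from Lim_transform_eventually[OF tendsto_mult[OF tendsto_const l] this]
      show ?thesis by (auto simp: convergent_def)
    next
      case False
      then have "r < c * infdist x F" using ne by simp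
      from order_tendstoD(1)[OF lim this]
      have "\<forall>\<^sub>F n in sequentially. 0 = diff_quotient ?U x w n"
        by eventually_elim (use False in \<open>simp add: diff_quotient_def\<close>)
      from Lim_transform_eventually[OF tendsto_const this]
      show ?thesis by (auto simp: convergent_def)
    qed
  qed
qed

section \<open>The distance to the boundary\<close>

text \<open>Local integrability gives measurability on each compact box, and countably many of them
  cover \<Omega>. \<open>esssup_I\<close> asks for it when applied to the chosen
  \<open>weak_gradient\<close>.\<close>

lemma locally_integrable_imp_measurable:
  fixes G :: "'a::euclidean_space \<Rightarrow> 'b::euclidean_space"
  assumes \<Omega>: "open \<Omega>" and G: "locally_integrable \<Omega> G"
  shows "G \<in> borel_measurable (lebesgue_on \<Omega>)"
proof -
  obtain D where D: "countable D" "D \<subseteq> Pow \<Omega>" "\<And>X. X \<in> D \<Longrightarrow> \<exists>a b. X = cbox a b" "\<Union>D = \<Omega>"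
    using open_countable_Union_open_cbox[OF \<Omega>] by metis
  have \<Omega>s: "\<Omega> \<in> sets lebesgue" using \<Omega> by simp
  have X: "compact X" "X \<subseteq> \<Omega>" "X \<in> sets lebesgue" if X: "X \<in> D" for X
  proof -
    obtain a b where "X = cbox a b" using D(3)[OF X] by blast
    then show "compact X" "X \<in> sets lebesgue" by auto
    show "X \<subseteq> \<Omega>" using D(2) X by auto
  qed
  show ?thesis
  proof (rule measurable_piecewise_restrict[OF D(1)])
    show "X \<inter> space (lebesgue_on \<Omega>) \<in> sets (lebesgue_on \<Omega>)" if "X \<in> D" for X
      using X[OF that] \<Omega>s by (subst sets_restrict_space_iff) (auto simp: Int_absorb2)
    show "space (lebesgue_on \<Omega>) \<subseteq> \<Union>D" using D by simp
    fix A assume A: "A \<in> D"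
    have "restrict_space (lebesgue_on \<Omega>) A = lebesgue_on (\<Omega> \<inter> A)"
      using X[OF A] \<Omega>s by (intro restrict_restrict_space) auto
    also have "\<Omega> \<inter> A = A" using X[OF A] by auto
    finally show "G \<in> borel_measurable (restrict_space (lebesgue_on \<Omega>) A)"
      using G X[OF A] unfolding locally_integrable_iff by auto
  qed
qed

lemma has_weak_gradient_weak_gradient:
  "has_weak_gradient \<Omega> u G \<Longrightarrow> has_weak_gradient \<Omega> u (weak_gradient \<Omega> u)"
  unfolding weak_gradient_def by (rule someI[of "has_weak_gradient \<Omega> u"])

lemma has_weak_gradient_cong_AE:
  assumes \<Omega>: "open \<Omega>" and u: "has_weak_gradient \<Omega> u G"
    and v: "locally_integrable \<Omega> v" and eq: "AE x in lebesgue_on \<Omega>. v x = u x"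
  shows "has_weak_gradient \<Omega> v G"
proof -
  have m: "u \<in> borel_measurable (lebesgue_on \<Omega>)" "v \<in> borel_measurable (lebesgue_on \<Omega>)"
    using u v \<Omega> by (auto simp: has_weak_gradient_def intro: locally_integrable_imp_measurable)
  have "(\<integral>x. v x * frechet_derivative \<phi> (at x) i \<partial>lebesgue_on \<Omega>) =
      (\<integral>x. u x * frechet_derivative \<phi> (at x) i \<partial>lebesgue_on \<Omega>)" if "\<phi> \<in> test_functions \<Omega>" for \<phi> i
    using eq m borel_measurable_lebesgue_on_continuous[OF continuous_on_frechet_derivative_test_function[OF that]]
    by (intro integral_cong_AE borel_measurable_times) auto
  with u v show ?thesis unfolding has_weak_gradient_def by simp
qed

section \<open>Lipschitz continuity of the distance, its positivity inside, and inscribed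
  balls\<close>

lemma bdist_nonneg: "0 \<le> bdist \<Omega> x"
  by (simp add: bdist_def infdist_nonneg)

lemma bdist_Lipschitz: "\<bar>bdist \<Omega> x - bdist \<Omega> y\<bar> \<le> norm (x - y)"
  unfolding bdist_def using infdist_triangle_abs[of x "frontier \<Omega>" y] by (simp add: dist_norm)

lemma bdist_continuous: "continuous_on S (bdist \<Omega>)"
  unfolding bdist_def[abs_def] by (intro continuous_intros)

lemma bdist_measurable: "bdist \<Omega> \<in> borel_measurable (lebesgue_on S)"
  by (rule borel_measurable_lebesgue_on_continuous[OF bdist_continuous])

context
  fixes \<Omega> :: "'a::euclidean_space set"
  assumes \<Omega>: "open \<Omega>" "bounded \<Omega>" "\<Omega> \<noteq> {}"
begin

lemma domain_sets: "\<Omega> \<in> sets lebesgue" "\<Omega> \<in> lmeasurable"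
  using \<Omega> by (auto intro: lmeasurable_open)

lemma domain_finite_measure: "finite_measure (lebesgue_on \<Omega>)"
  using domain_sets(2) by (rule finite_measure_lebesgue_on)

lemma frontier_domain: "compact (frontier \<Omega>)" "closed (frontier \<Omega>)" "frontier \<Omega> \<noteq> {}" "\<Omega> \<inter> frontier \<Omega> = {}"
proof -
  have "\<Omega> \<noteq> UNIV" using \<Omega> not_bounded_UNIV by auto
  then show "frontier \<Omega> \<noteq> {}" using \<Omega> by (simp add: frontier_eq_empty)
  show "compact (frontier \<Omega>)" using \<Omega> by (simp add: compact_frontier_bounded)
  show "\<Omega> \<inter> frontier \<Omega> = {}" using \<Omega> by (auto simp: frontier_def interior_open)
qed simp

lemma bdist_pos: "x \<in> \<Omega> \<Longrightarrow> 0 < bdist \<Omega> x"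
  unfolding bdist_def using frontier_domain by (intro infdist_pos_not_in_closed) auto

lemma bdist_nearest: obtains y where "y \<in> frontier \<Omega>" "bdist \<Omega> x = dist x y"
  unfolding bdist_def using infdist_attains_inf frontier_domain by metis

lemma bdd_above_bdist: "bdd_above (bdist \<Omega> ` \<Omega>)"
proof -
  have "compact (bdist \<Omega> ` closure \<Omega>)"
    using \<Omega> by (intro compact_continuous_image bdist_continuous) (simp add: compact_closure)
  then have "bounded (bdist \<Omega> ` \<Omega>)"
    by (meson bounded_subset closure_subset compact_imp_bounded image_mono)
  then show ?thesis by (rule bounded_imp_bdd_above)
qed

lemma bdist_le_inradius: "x \<in> \<Omega> \<Longrightarrow> bdist \<Omega> x \<le> inradius \<Omega>"
  unfolding inradius_def using bdd_above_bdist by (rule cSUP_upper[rotated])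

lemma inradius_pos: "0 < inradius \<Omega>"
proof -
  obtain x where "x \<in> \<Omega>" using \<Omega> by blast
  then show ?thesis using bdist_pos bdist_le_inradius by (meson order_less_le_trans)
qed

text \<open>A ball that also met the complement of \<Omega> would, being connected, meet the
  frontier at a distance below d(x).\<close>

lemma ball_bdist_subset: "x \<in> \<Omega> \<Longrightarrow> ball x (bdist \<Omega> x) \<subseteq> \<Omega>"
proof (rule ccontr)
  assume x: "x \<in> \<Omega>" and "\<not> ball x (bdist \<Omega> x) \<subseteq> \<Omega>"
  then have 1: "ball x (bdist \<Omega> x) - \<Omega> \<noteq> {}" by blast
  have "x \<in> ball x (bdist \<Omega> x)" using bdist_pos[OF x] by simp
  then have 2: "ball x (bdist \<Omega> x) \<inter> \<Omega> \<noteq> {}" using x by blast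
  have "ball x (bdist \<Omega> x) \<inter> frontier \<Omega> \<noteq> {}"
    by (rule connected_Int_frontier[OF connected_ball 2 1])
  then obtain y where "y \<in> frontier \<Omega>" "dist x y < bdist \<Omega> x" by auto
  then show False using infdist_le[of y "frontier \<Omega>" x] by (simp add: bdist_def)
qed

text \<open>Values of \<open>u\<close> outside \<Omega> are arbitrary, so the globally Lipschitz
  representative \<open>U\<close> carries the argument: it has a weak gradient bounded by its
  Lipschitz constant \<open>c\<close>, and it is the continuous function vanishing on the frontier
  that \<open>W1inf_0\<close> asks for.\<close>

lemma J_fun_min_bdist_le:
  assumes c: "c \<ge> 0" "r > 0" and u: "\<And>x. x \<in> \<Omega> \<Longrightarrow> u x = min (c * bdist \<Omega> x) r"
  shows "J_fun \<Omega> u \<le> ennreal c"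
proof -
  define U where "U x = min (c * bdist \<Omega> x) r" for x
  have U_Lip: "\<bar>U x - U y\<bar> \<le> c * norm (x - y)" for x y
  proof -
    have "\<bar>U x - U y\<bar> \<le> \<bar>c * bdist \<Omega> x - c * bdist \<Omega> y\<bar>" by (auto simp: U_def min_def)
    also have "\<dots> = c * \<bar>bdist \<Omega> x - bdist \<Omega> y\<bar>" using c by (simp add: abs_mult flip: right_diff_distrib)
    also have "\<dots> \<le> c * norm (x - y)" using c bdist_Lipschitz by (intro mult_left_mono) auto
    finally show ?thesis .
  qed
  have U_cont: "continuous_on S U" for S
    unfolding U_def[abs_def] by (intro continuous_intros bdist_continuous)
  have conv: "AE x in lebesgue_on \<Omega>. convergent (diff_quotient U x w)" for w
    using AE_convergent_diff_quotient_min[OF frontier_domain(1,3) \<Omega>(1) frontier_domain(4) c]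
    by (simp add: U_def[abs_def] bdist_def)
  obtain G where G: "has_weak_gradient \<Omega> U G" "G \<in> borel_measurable (lebesgue_on \<Omega>)"
    "AE x in lebesgue_on \<Omega>. norm (G x) \<le> c"
    using Lipschitz_weak_gradient[OF U_Lip \<Omega>(1) conv] by blast
  have eq: "AE x in lebesgue_on \<Omega>. u x = U x"
    using u by (intro AE_I2) (simp add: U_def)
  have uU: "u x = U x" if "x \<in> \<Omega>" for x using u that by (simp add: U_def)
  have um: "u \<in> borel_measurable (lebesgue_on \<Omega>)"
    using borel_measurable_lebesgue_on_continuous[OF U_cont]
    by (rule measurable_cong[THEN iffD1, rotated]) (simp add: uU)
  have lu: "locally_integrable \<Omega> u"
    unfolding locally_integrable_iff
  proof (intro allI impI)
    fix K assume K: "compact K \<and> K \<subseteq> \<Omega>"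
    have "integrable (lebesgue_on K) U" using K U_cont by (intro integrable_lebesgue_on_compact) auto
    then show "integrable (lebesgue_on K) u"
      by (rule Bochner_Integration.integrable_cong[THEN iffD1, rotated -1]) (use K uU in auto)
  qed
  have uG: "has_weak_gradient \<Omega> u G"
    by (rule has_weak_gradient_cong_AE[OF \<Omega>(1) G(1) lu eq])
  have Gl: "Linf_norm \<Omega> G \<le> ennreal c"
    unfolding Linf_norm_def
  proof (rule esssup_I)
    show "(\<lambda>x. ennreal (norm (G x))) \<in> borel_measurable (lebesgue_on \<Omega>)" using G(2) by simp
    show "AE x in lebesgue_on \<Omega>. ennreal (norm (G x)) \<le> ennreal c"
      using G(3) by eventually_elim (rule ennreal_leI)
  qed
  have ul: "Linf_norm \<Omega> u \<le> ennreal r"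
    unfolding Linf_norm_def
  proof (rule esssup_I)
    show "(\<lambda>x. ennreal (norm (u x))) \<in> borel_measurable (lebesgue_on \<Omega>)" using um by simp
    have "norm (u x) \<le> r" if "x \<in> \<Omega>" for x
      using u[OF that] c bdist_nonneg[of \<Omega> x] by (simp add: min_def)
    then show "AE x in lebesgue_on \<Omega>. ennreal (norm (u x)) \<le> ennreal r"
      by (intro AE_I2 ennreal_leI) simp
  qed
  have "u \<in> W1inf \<Omega>"
    unfolding W1inf_def Linf_def
    using um ul G(2) Gl uG by (auto intro!: bexI[of _ G] simp: order.strict_trans1)
  moreover have "U x = 0" if "x \<in> frontier \<Omega>" for x
    using that c by (simp add: U_def bdist_def)
  ultimately have W: "u \<in> W1inf_0 \<Omega>"
    unfolding W1inf_0_def using eq U_cont by (auto intro!: exI[of _ U])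
  note wg = has_weak_gradient_weak_gradient[OF uG]
  have "Linf_norm \<Omega> (weak_gradient \<Omega> u) \<le> ennreal c"
    unfolding Linf_norm_def
  proof (rule esssup_I)
    have "weak_gradient \<Omega> u \<in> borel_measurable (lebesgue_on \<Omega>)"
      using wg \<Omega> by (auto simp: has_weak_gradient_def intro: locally_integrable_imp_measurable)
    then show "(\<lambda>x. ennreal (norm (weak_gradient \<Omega> u x))) \<in> borel_measurable (lebesgue_on \<Omega>)" by simp
    show "AE x in lebesgue_on \<Omega>. ennreal (norm (weak_gradient \<Omega> u x)) \<le> ennreal c"
      using G(3) has_weak_gradient_unique[OF \<Omega>(1) wg uG] by eventually_elim (simp add: ennreal_leI)
  qed
  with W show "J_fun \<Omega> u \<le> ennreal c" by (simp add: J_fun_def)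
qed

end

section \<open>Pointwise bounds for functions vanishing on the boundary\<close>

lemma cube_subset_cball:
  fixes p :: "'a::euclidean_space"
  assumes "z \<in> cbox (p - t *\<^sub>R One) (p + t *\<^sub>R One)"
  shows "dist p z \<le> t * DIM('a)"
proof -
  have "dist p z \<le> (\<Sum>i\<in>Basis. \<bar>(p - z) \<bullet> i\<bar>)" unfolding dist_norm by (rule norm_le_l1)
  also have "\<dots> \<le> (\<Sum>i\<in>(Basis::'a set). t)"
    using assms by (intro sum_mono) (force simp: mem_box algebra_simps abs_le_iff)
  finally show ?thesis by (simp add: mult.commute)
qed

text \<open>Lipschitz bounds along segments inside \<open>\<Omega>\<close> come from averages over a small cube that moves
  along the segment, differentiated in the parameter.\<close>

context
  fixes \<Omega> :: "'a::euclidean_space set" and V :: "'a \<Rightarrow> real" and G M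
  assumes \<Omega>: "open \<Omega>" "bounded \<Omega>" "\<Omega> \<noteq> {}"
    and V: "continuous_on UNIV V" "\<And>x. x \<notin> \<Omega> \<Longrightarrow> V x = 0"
    and G: "has_weak_gradient \<Omega> V G" "AE x in lebesgue_on \<Omega>. norm (G x) \<le> M"
begin

text \<open>Differentiating the average along the segment puts the derivative on the bump; the
  definition of the weak gradient turns it into an average of the component of \<open>G\<close>
  along b - a, at most \<open>M * norm (b - a)\<close> times the mass of the bump. The averages are
  not normalised, hence this mass on the right. The cubes stay in \<Omega> so that every bump is a
  test function there.\<close>

lemma mollified_increment:
  fixes a b :: 'a and t :: real
  defines "\<eta> \<equiv> \<lambda>p. box_bump (p - t *\<^sub>R One) (p + t *\<^sub>R One) 1"
  assumes t: "t > 0"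
    and sub: "\<And>p. p \<in> closed_segment a b \<Longrightarrow> cbox (p - t *\<^sub>R One) (p + t *\<^sub>R One) \<subseteq> \<Omega>"
  shows "\<bar>(\<integral>z. V z * \<eta> b z \<partial>lebesgue_on \<Omega>) - (\<integral>z. V z * \<eta> a z \<partial>lebesgue_on \<Omega>)\<bar>
    \<le> M * norm (b - a) * (\<integral>z. \<eta> 0 z \<partial>lborel)"
proof -
  define w where "w = b - a"
  define p where "p s = a + s *\<^sub>R w" for s :: real
  define c where "c = (\<integral>z. \<eta> 0 z \<partial>lborel)"
  have \<eta>_shift: "\<eta> p z = \<eta> 0 (z - p)" for p z
    by (simp add: \<eta>_def box_bump_def inner_diff_left inner_add_left algebra_simps)
  have \<eta>0: "\<eta> 0 \<in> test_functions UNIV"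
    unfolding \<eta>_def by (rule box_bump_test_function) auto
  have \<eta>c: "continuous_on UNIV (\<eta> q)" for q
    unfolding \<eta>_def by (rule Ck_continuous[OF Ck_box_bump])
  have \<eta>n: "0 \<le> \<eta> q z" for q z unfolding \<eta>_def by (rule box_bump_nonneg)
  have ps: "p s \<in> closed_segment a b" if "s \<in> {0..1}" for s
    using that unfolding closed_segment_def p_def w_def by (auto intro!: exI[of _ s] simp: algebra_simps)
  have \<eta>t: "\<eta> (p s) \<in> test_functions \<Omega>" if "s \<in> {0..1}" for s
    unfolding \<eta>_def using sub[OF ps[OF that]] by (intro box_bump_test_function) auto
  have \<eta>_out: "\<eta> (p s) z = 0" if "s \<in> {0..1}" "z \<notin> \<Omega>" for s z
    using test_function_supp(2)[OF \<eta>t[OF that(1)]] that(2) test_function_eq_0[of z "\<eta> (p s)"] by blast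
  have \<eta>int: "(\<integral>z. \<eta> (p s) z \<partial>lebesgue_on \<Omega>) = c" if "s \<in> {0..1}" for s
  proof -
    have "(\<integral>z. \<eta> (p s) z \<partial>lebesgue_on \<Omega>) = (\<integral>z. \<eta> (p s) z \<partial>lborel)"
      using \<Omega> \<eta>_out[OF that] borel_measurable_continuous_onI[OF \<eta>c]
      by (intro integral_lebesgue_on_eq_lborel) auto
    also have "\<dots> = (\<integral>z. \<eta> 0 (z + - p s) \<partial>lborel)" using \<eta>_shift by simp
    also have "\<dots> = c" unfolding c_def
      by (rule lborel_integral_translate[OF borel_measurable_continuous_onI[OF \<eta>c]])
    finally show ?thesis .
  qed
  \<comment> \<open>A fixed closed box on which to differentiate under the integral; enlarging
    \<Omega> to it changes nothing, because \<open>V\<close> vanishes outside \<Omega>.\<close>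
  obtain A B where AB: "\<Omega> \<subseteq> cbox A B"
    using \<Omega>(2) bounded_subset_cbox_symmetric by metis
  define \<eta>' where "\<eta>' y = frechet_derivative (\<eta> 0) (at y) w" for y
  have \<eta>'c: "continuous_on UNIV \<eta>'"
    unfolding \<eta>'_def using continuous_on_frechet_derivative_test_function[OF \<eta>0] by simp
  have \<eta>': "frechet_derivative (\<eta> q) (at z) w = \<eta>' (z - q)" for q z
  proof -
    have "((\<lambda>z. \<eta> 0 (z - q)) has_derivative frechet_derivative (\<eta> 0) (at (z - q))) (at z)"
      by (rule has_derivative_compose[of "\<lambda>z. z - q" "\<lambda>h. h"])
         (auto intro!: derivative_eq_intros test_function_has_derivative[OF \<eta>0])
    then have "(\<eta> q has_derivative frechet_derivative (\<eta> 0) (at (z - q))) (at z)"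
      by (simp flip: \<eta>_shift)
    then show ?thesis unfolding \<eta>'_def by (simp add: frechet_derivative_at[symmetric])
  qed
  define f where "f s z = V z * \<eta> (p s) z" for s z
  define f' where "f' s z = - (V z * \<eta>' (z - p s))" for s z
  define F where "F s = integral (cbox A B) (f s)" for s
  have cf': "continuous_on (S \<times> T) (\<lambda>(s, z). f' s z)" for S T
    unfolding f'_def p_def split_beta
    by (intro continuous_intros continuous_on_compose2[OF V(1)] continuous_on_compose2[OF \<eta>'c]) auto
  have cfs: "continuous_on UNIV (f s)" for s
    unfolding f_def by (intro continuous_intros V \<eta>c)
  have cf's: "continuous_on UNIV (f' s)" for s
    unfolding f'_def by (intro continuous_intros V continuous_on_compose2[OF \<eta>'c]) auto
  have HK: "integral (cbox A B) g = (\<integral>z. g z \<partial>lebesgue_on \<Omega>)"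
    if "continuous_on UNIV g" "\<And>z. z \<notin> \<Omega> \<Longrightarrow> g z = 0" for g :: "'a \<Rightarrow> real"
  proof -
    have "integrable (lebesgue_on (cbox A B)) g"
      using that by (intro integrable_lebesgue_on_compact) (auto intro: continuous_on_subset)
    then have "integral (cbox A B) g = (\<integral>z. g z \<partial>lebesgue_on (cbox A B))"
      by (intro lebesgue_integral_eq_integral[symmetric]) auto
    also have "\<dots> = (\<integral>z. g z \<partial>lebesgue_on \<Omega>)"
      using \<Omega> AB that(2) by (intro integral_lebesgue_on_subset) auto
    finally show ?thesis .
  qed
  have FD: "(F has_real_derivative integral (cbox A B) (f' s)) (at s within {0..1})" if "s \<in> {0..1}" for s
    unfolding F_def
  proof (rule leibniz_rule_field_derivative[OF _ _ cf' that])
    fix s z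
    have "((\<lambda>s. \<eta> 0 (z - p s)) has_derivative (\<lambda>h. frechet_derivative (\<eta> 0) (at (z - p s)) (- (h *\<^sub>R w)))) (at s within {0..1})"
      by (rule has_derivative_compose[of "\<lambda>s. z - p s" "\<lambda>h. - (h *\<^sub>R w)"])
         (auto intro!: derivative_eq_intros test_function_has_derivative[OF \<eta>0] simp: p_def)
    moreover have "frechet_derivative (\<eta> 0) (at (z - p s)) (- (h *\<^sub>R w)) = - (\<eta>' (z - p s) * h)" for h
    proof -
      interpret linear "frechet_derivative (\<eta> 0) (at (z - p s))"
        using test_function_has_derivative[OF \<eta>0] by (rule has_derivative_linear)
      show ?thesis by (simp add: \<eta>'_def neg scale)
    qed
    moreover have "(*) (- \<eta>' (z - p s)) = (\<lambda>h. - (\<eta>' (z - p s) * h))" by (simp add: fun_eq_iff)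
    ultimately have "((\<lambda>s. \<eta> (p s) z) has_real_derivative - \<eta>' (z - p s)) (at s within {0..1})"
      by (simp add: has_field_derivative_def \<eta>_shift[of "p _"])
    from DERIV_cmult[OF this, of "V z"]
    show "((\<lambda>s. f s z) has_real_derivative f' s z) (at s within {0..1})"
      by (simp add: f_def f'_def)
  next
    show "f s integrable_on cbox A B" for s
      using cfs by (intro integrable_continuous) (auto intro: continuous_on_subset)
  qed simp
  have bound: "norm (integral (cbox A B) (f' s)) \<le> M * norm w * c" if s: "s \<in> {0..1}" for s
  proof -
    have lG: "locally_integrable \<Omega> (\<lambda>x. G x \<bullet> w)"
      using G by (auto simp: has_weak_gradient_def intro: locally_integrable_inner)
    note int = integrable_mult_test_function[OF \<Omega>(1) _ \<eta>t[OF s]]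
    have intV: "integrable (lebesgue_on \<Omega>) (\<lambda>z. V z * frechet_derivative (\<eta> (p s)) (at z) i)" for i
    proof -
      have "integrable (lebesgue_on (cbox A B)) (\<lambda>z. V z * frechet_derivative (\<eta> (p s)) (at z) i)"
        using continuous_on_frechet_derivative_test_function[OF \<eta>t[OF s], of i] V(1)
        by (intro integrable_lebesgue_on_compact) (auto intro!: continuous_on_mult intro: continuous_on_subset)
      then show ?thesis
        using \<Omega> AB V(2) by (subst (asm) integrable_lebesgue_on_subset_iff[of \<Omega>]) auto
    qed
    have "integral (cbox A B) (f' s) = (\<integral>z. f' s z \<partial>lebesgue_on \<Omega>)"
      by (rule HK[OF cf's]) (simp add: f'_def V)
    also have "\<dots> = - (\<integral>z. V z * frechet_derivative (\<eta> (p s)) (at z) w \<partial>lebesgue_on \<Omega>)"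
      by (simp add: f'_def \<eta>')
    also have "\<dots> = - (\<integral>z. (\<Sum>i\<in>Basis. (w \<bullet> i) * (V z * frechet_derivative (\<eta> (p s)) (at z) i)) \<partial>lebesgue_on \<Omega>)"
      by (subst frechet_derivative_test_function[OF \<eta>t[OF s]]) (simp add: sum_distrib_left ac_simps)
    also have "\<dots> = - (\<Sum>i\<in>Basis. (w \<bullet> i) * (\<integral>z. V z * frechet_derivative (\<eta> (p s)) (at z) i \<partial>lebesgue_on \<Omega>))"
      using intV by (subst Bochner_Integration.integral_sum) auto
    also have "\<dots> = (\<Sum>i\<in>Basis. (w \<bullet> i) * (\<integral>z. (G z \<bullet> i) * \<eta> (p s) z \<partial>lebesgue_on \<Omega>))"
      using G(1) \<eta>t[OF s] by (simp add: has_weak_gradient_def sum_negf)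
    also have "\<dots> = (\<integral>z. (\<Sum>i\<in>Basis. (w \<bullet> i) * ((G z \<bullet> i) * \<eta> (p s) z)) \<partial>lebesgue_on \<Omega>)"
      using G(1) by (subst Bochner_Integration.integral_sum)
        (auto intro!: int locally_integrable_inner simp: has_weak_gradient_def)
    also have "\<dots> = (\<integral>z. (G z \<bullet> w) * \<eta> (p s) z \<partial>lebesgue_on \<Omega>)"
      by (intro Bochner_Integration.integral_cong)
         (simp_all add: euclidean_inner[of _ w] sum_distrib_right sum_distrib_left ac_simps)
    finally have eq: "integral (cbox A B) (f' s) = (\<integral>z. (G z \<bullet> w) * \<eta> (p s) z \<partial>lebesgue_on \<Omega>)" .
    have "norm (\<integral>z. (G z \<bullet> w) * \<eta> (p s) z \<partial>lebesgue_on \<Omega>) \<le> (\<integral>z. norm ((G z \<bullet> w) * \<eta> (p s) z) \<partial>lebesgue_on \<Omega>)"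
      by (rule integral_norm_bound)
    also have "\<dots> \<le> (\<integral>z. M * norm w * \<eta> (p s) z \<partial>lebesgue_on \<Omega>)"
    proof (rule integral_mono_AE)
      show "integrable (lebesgue_on \<Omega>) (\<lambda>z. norm ((G z \<bullet> w) * \<eta> (p s) z))"
        using int[OF lG] by simp
      have "locally_integrable \<Omega> (\<lambda>z. M * norm w)"
        unfolding locally_integrable_iff by (auto intro!: integrable_lebesgue_on_compact continuous_intros)
      then show "integrable (lebesgue_on \<Omega>) (\<lambda>z. M * norm w * \<eta> (p s) z)" by (rule int)
      show "AE z in lebesgue_on \<Omega>. norm ((G z \<bullet> w) * \<eta> (p s) z) \<le> M * norm w * \<eta> (p s) z"
        using G(2)
      proof eventually_elim
        case (elim z)
        have "\<bar>G z \<bullet> w\<bar> \<le> norm (G z) * norm w" by (rule Cauchy_Schwarz_ineq2)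
        also have "\<dots> \<le> M * norm w" using elim by (rule mult_right_mono) simp
        finally show ?case using \<eta>n[of "p s" z] by (simp add: abs_mult mult_right_mono)
      qed
    qed
    also have "\<dots> = M * norm w * c" using \<eta>int[OF s] by simp
    finally show ?thesis unfolding eq .
  qed
  have "norm (F 1 - F 0) \<le> M * norm w * c * norm (1 - 0 :: real)"
    by (rule field_differentiable_bound[OF _ FD bound]) auto
  moreover have "F s = (\<integral>z. V z * \<eta> (p s) z \<partial>lebesgue_on \<Omega>)" for s
    unfolding F_def using HK[OF cfs, of s] V(2) by (simp add: f_def)
  moreover have "p 1 = b" "p 0 = a" by (simp_all add: p_def w_def)
  ultimately show ?thesis by (simp add: w_def c_def)
qed

lemma mollified_close:
  fixes q :: 'a and t e :: real
  defines "\<eta> \<equiv> \<lambda>p. box_bump (p - t *\<^sub>R One) (p + t *\<^sub>R One) 1"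
  assumes t: "t > 0" and sub: "cbox (q - t *\<^sub>R One) (q + t *\<^sub>R One) \<subseteq> \<Omega>"
    and e: "\<And>z. z \<in> cbox (q - t *\<^sub>R One) (q + t *\<^sub>R One) \<Longrightarrow> \<bar>V z - V q\<bar> \<le> e"
  shows "\<bar>(\<integral>z. V z * \<eta> q z \<partial>lebesgue_on \<Omega>) - V q * (\<integral>z. \<eta> 0 z \<partial>lborel)\<bar> \<le> e * (\<integral>z. \<eta> 0 z \<partial>lborel)"
proof -
  have \<eta>t: "\<eta> q \<in> test_functions \<Omega>"
    unfolding \<eta>_def using sub by (intro box_bump_test_function) auto
  have \<eta>c: "continuous_on UNIV (\<eta> q)" for q
    unfolding \<eta>_def by (rule Ck_continuous[OF Ck_box_bump])
  have \<eta>n: "0 \<le> \<eta> q z" for q z unfolding \<eta>_def by (rule box_bump_nonneg)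
  have \<eta>0: "\<eta> q z = 0" if "z \<notin> cbox (q - t *\<^sub>R One) (q + t *\<^sub>R One)" for z
    using that supp_box_bump[of 1 "q - t *\<^sub>R One" "q + t *\<^sub>R One"] test_function_eq_0[of z "\<eta> q"]
    by (auto simp: \<eta>_def)
  have \<eta>int: "(\<integral>z. \<eta> q z \<partial>lebesgue_on \<Omega>) = (\<integral>z. \<eta> 0 z \<partial>lborel)"
  proof -
    have "(\<integral>z. \<eta> q z \<partial>lebesgue_on \<Omega>) = (\<integral>z. \<eta> q z \<partial>lborel)"
      using \<Omega> \<eta>0 sub borel_measurable_continuous_onI[OF \<eta>c]
      by (intro integral_lebesgue_on_eq_lborel) auto
    also have "\<dots> = (\<integral>z. \<eta> 0 (z + - q) \<partial>lborel)"
      by (simp add: \<eta>_def box_bump_def inner_diff_left inner_add_left algebra_simps)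
    also have "\<dots> = (\<integral>z. \<eta> 0 z \<partial>lborel)"
      by (rule lborel_integral_translate[OF borel_measurable_continuous_onI[OF \<eta>c]])
    finally show ?thesis .
  qed
  have int: "integrable (lebesgue_on \<Omega>) (\<lambda>z. g z * \<eta> q z)" if "continuous_on UNIV g" for g
    using that by (intro integrable_mult_test_function[OF \<Omega>(1) _ \<eta>t])
      (auto simp: locally_integrable_iff intro!: integrable_lebesgue_on_compact intro: continuous_on_subset)
  have i1: "integrable (lebesgue_on \<Omega>) (\<lambda>z. V z * \<eta> q z)" by (rule int[OF V(1)])
  have i2: "integrable (lebesgue_on \<Omega>) (\<lambda>z. k * \<eta> q z)" for k by (rule int) simp
  have "(\<integral>z. V z * \<eta> q z \<partial>lebesgue_on \<Omega>) - V q * (\<integral>z. \<eta> 0 z \<partial>lborel) =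
      (\<integral>z. V z * \<eta> q z - V q * \<eta> q z \<partial>lebesgue_on \<Omega>)"
    by (subst Bochner_Integration.integral_diff[OF i1 i2]) (simp add: \<eta>int)
  also have "norm \<dots> \<le> (\<integral>z. norm (V z * \<eta> q z - V q * \<eta> q z) \<partial>lebesgue_on \<Omega>)"
    by (rule integral_norm_bound)
  also have "\<dots> \<le> (\<integral>z. e * \<eta> q z \<partial>lebesgue_on \<Omega>)"
  proof (rule integral_mono)
    show "integrable (lebesgue_on \<Omega>) (\<lambda>z. norm (V z * \<eta> q z - V q * \<eta> q z))"
      by (intro integrable_norm Bochner_Integration.integrable_diff i1 i2)
    show "integrable (lebesgue_on \<Omega>) (\<lambda>z. e * \<eta> q z)" by (rule i2)
    show "norm (V z * \<eta> q z - V q * \<eta> q z) \<le> e * \<eta> q z" for z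
    proof (cases "z \<in> cbox (q - t *\<^sub>R One) (q + t *\<^sub>R One)")
      case True
      then show ?thesis
        using mult_right_mono[OF e[OF True] \<eta>n[of q z]] \<eta>n[of q z]
        by (simp add: abs_mult flip: left_diff_distrib)
    qed (simp add: \<eta>0)
  qed
  finally show ?thesis by (simp add: \<eta>int)
qed

text \<open>\<open>V\<close> at the endpoints is compared with its averages over small cubes around
  them, where \<open>V\<close> varies by at most e / 2. Dividing by the positive mass of the bump
  leaves the error e, which is arbitrary.\<close>

lemma Lipschitz_on_segment:
  assumes seg: "closed_segment a b \<subseteq> \<Omega>"
  shows "\<bar>V b - V a\<bar> \<le> M * norm (b - a)"
proof (rule field_le_epsilon)
  fix e :: real assume e: "e > 0"
  obtain \<rho> where \<rho>: "\<rho> > 0" "(\<Union>x\<in>closed_segment a b. ball x \<rho>) \<subseteq> \<Omega>"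
    using compact_subset_open_imp_ball_epsilon_subset[OF compact_segment \<Omega>(1) seg] by blast
  have Vc: "\<exists>d>0. \<forall>z. dist z q < d \<longrightarrow> dist (V z) (V q) < e / 2" for q
    using V(1) e unfolding continuous_on_iff by (metis UNIV_I half_gt_zero)
  obtain da where da: "da > 0" "\<And>z. dist z a < da \<Longrightarrow> dist (V z) (V a) < e / 2" using Vc by blast
  obtain db where db: "db > 0" "\<And>z. dist z b < db \<Longrightarrow> dist (V z) (V b) < e / 2" using Vc by blast
  \<comment> \<open>A cube of half side t lies in the closed ball of radius t times the dimension;
    the factor 2 puts this radius strictly below \<rho>, \<open>da\<close> and \<open>db\<close> at
    once.\<close>
  define t where "t = min \<rho> (min da db) / (2 * DIM('a))"
  have t: "t > 0" using \<rho>(1) da(1) db(1) by (simp add: t_def)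
  have "t * DIM('a) = min \<rho> (min da db) / 2" by (simp add: t_def)
  then have tD: "t * DIM('a) < min \<rho> (min da db)" using \<rho>(1) da(1) db(1) by linarith
  have cube: "dist q z < min \<rho> (min da db)" if "z \<in> cbox (q - t *\<^sub>R One) (q + t *\<^sub>R One)" for z q :: 'a
    using cube_subset_cball[OF that] tD by linarith
  have sub: "cbox (q - t *\<^sub>R One) (q + t *\<^sub>R One) \<subseteq> \<Omega>" if "q \<in> closed_segment a b" for q
    using cube that \<rho>(2) by fastforce
  let ?\<eta> = "\<lambda>q :: 'a. box_bump (q - t *\<^sub>R One) (q + t *\<^sub>R One) 1"
  define c where "c = (\<integral>z. ?\<eta> 0 z \<partial>lborel)"
  have c: "c > 0"
  proof -
    have \<eta>t: "?\<eta> 0 \<in> test_functions UNIV" by (rule box_bump_test_function) auto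
    have int: "integrable lborel (?\<eta> 0)"
      by (rule integrable_compact_supp[OF continuous_on_test_function[OF \<eta>t] test_function_supp(1)[OF \<eta>t]
            test_function_eq_0[of _ "?\<eta> 0"]])
    have "c \<noteq> 0"
    proof
      assume "c = 0"
      then have "AE z in lborel. ?\<eta> 0 z = 0"
        unfolding c_def using integral_nonneg_eq_0_iff_AE[OF int AE_I2[OF box_bump_nonneg]] by blast
      then have "AE z in lborel. z \<notin> box (0 - t *\<^sub>R One) (0 + t *\<^sub>R (One::'a))"
        by (rule AE_mp) (auto intro!: AE_I2 simp: box_bump_pos_iff[of 1, symmetric])
      then have "emeasure lborel (box (0 - t *\<^sub>R One) (0 + t *\<^sub>R (One::'a))) = 0"
        by (subst (asm) AE_iff_measurable[OF _ refl]) auto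
      then have "t + t = 0" using t
        by (subst (asm) emeasure_lborel_box) (auto simp: inner_diff_left inner_add_left)
      then show False using t by simp
    qed
    moreover have "c \<ge> 0" unfolding c_def by (intro integral_nonneg_AE AE_I2 box_bump_nonneg)
    ultimately show ?thesis by simp
  qed
  let ?I = "\<lambda>q. \<integral>z. V z * ?\<eta> q z \<partial>lebesgue_on \<Omega>"
  have "\<bar>?I b - ?I a\<bar> \<le> M * norm (b - a) * c"
    unfolding c_def by (rule mollified_increment[OF t sub])
  moreover have "\<bar>?I a - V a * c\<bar> \<le> e / 2 * c"
    unfolding c_def using da(2) cube
    by (intro mollified_close[OF t sub]) (auto simp: dist_real_def dist_commute intro!: less_imp_le)
  moreover have "\<bar>?I b - V b * c\<bar> \<le> e / 2 * c"
    unfolding c_def using db(2) cube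
    by (intro mollified_close[OF t sub]) (auto simp: dist_real_def dist_commute intro!: less_imp_le)
  moreover have "e / 2 * c + e / 2 * c = e * c" by (simp add: field_simps)
  ultimately have le: "\<bar>V b * c - V a * c\<bar> \<le> M * norm (b - a) * c + e * c"
    by linarith
  have "\<bar>V b - V a\<bar> * c \<le> (M * norm (b - a) + e) * c"
  proof -
    have "V b * c - V a * c = (V b - V a) * c" by (simp add: left_diff_distrib)
    then have "\<bar>V b * c - V a * c\<bar> = \<bar>V b - V a\<bar> * c" using c by (simp add: abs_mult)
    moreover have "M * norm (b - a) * c + e * c = (M * norm (b - a) + e) * c"
      by (simp add: distrib_right)
    ultimately show ?thesis using le by simp
  qed
  then show "\<bar>V b - V a\<bar> \<le> M * norm (b - a) + e" using c by simp
qed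

text \<open>The segment bound is applied from \<open>x\<close> towards a nearest frontier point
  \<open>y\<close>. The segment stays in the ball of radius d(x), inside \<Omega>, except for
  \<open>y\<close> itself; hence the points \<open>z n\<close> short of \<open>y\<close>, and
  continuity of \<open>V\<close> together with V y = 0 for the limit.\<close>

lemma abs_le_bdist:
  assumes x: "x \<in> \<Omega>"
  shows "\<bar>V x\<bar> \<le> M * bdist \<Omega> x"
proof -
  obtain y where y: "y \<in> frontier \<Omega>" "bdist \<Omega> x = dist x y" using bdist_nearest[OF \<Omega>] by metis
  have "y \<notin> \<Omega>" using y(1) frontier_domain(4)[OF \<Omega>] by auto
  define s where "s n = 1 - inverse (real (Suc n))" for n
  have s: "0 \<le> s n" "s n < 1" for n by (auto simp: s_def field_simps)
  define z where "z n = x + s n *\<^sub>R (y - x)" for n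
  have s1: "s \<longlonglongrightarrow> 1 - 0"
    unfolding s_def[abs_def] by (intro tendsto_diff tendsto_const LIMSEQ_inverse_real_of_nat)
  have "z \<longlonglongrightarrow> x + (1 - 0) *\<^sub>R (y - x)"
    unfolding z_def[abs_def] by (intro tendsto_add tendsto_scaleR tendsto_const s1)
  then have "z \<longlonglongrightarrow> y" by simp
  then have "(\<lambda>n. V (z n)) \<longlonglongrightarrow> V y"
    using V(1) by (intro isCont_tendsto_compose[of y V]) (auto simp: continuous_on_eq_continuous_at)
  then have lim: "(\<lambda>n. \<bar>V (z n) - V x\<bar>) \<longlonglongrightarrow> \<bar>0 - V x\<bar>"
    using V(2)[OF \<open>y \<notin> \<Omega>\<close>] by (intro tendsto_intros) simp
  have b: "\<bar>V (z n) - V x\<bar> \<le> M * dist x y * s n" for n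
  proof -
    have "closed_segment x (z n) \<subseteq> ball x (bdist \<Omega> x)"
    proof (rule closed_segment_subset)
      show "x \<in> ball x (bdist \<Omega> x)" using bdist_pos[OF \<Omega> x] by simp
      have "dist x (z n) = s n * dist x y"
        using s[of n] by (simp add: z_def dist_norm norm_minus_commute)
      also have "\<dots> < dist x y"
        using s[of n] bdist_pos[OF \<Omega> x] y(2) by simp
      finally show "z n \<in> ball x (bdist \<Omega> x)" by (simp add: y(2))
    qed simp
    then have "\<bar>V (z n) - V x\<bar> \<le> M * norm (z n - x)"
      using ball_bdist_subset[OF \<Omega> x] by (intro Lipschitz_on_segment) auto
    also have "norm (z n - x) = s n * dist x y"
      using s[of n] by (simp add: z_def dist_norm norm_minus_commute)
    finally show ?thesis by (simp add: mult_ac)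
  qed
  have "(\<lambda>n. M * dist x y * s n) \<longlonglongrightarrow> M * dist x y * (1 - 0)"
    by (intro tendsto_mult tendsto_const s1)
  from LIMSEQ_le[OF lim this] b show ?thesis by (auto simp: y(2))
qed

end

text \<open>The continuous representative supplied by \<open>W1inf_0\<close> vanishes on the
  frontier, so its extension by zero is continuous on the whole space and fits the pointwise bound;
  passing to another representative does not change the weak gradient.\<close>

lemma W1inf_0_abs_le_bdist:
  fixes \<Omega> :: "'a::euclidean_space set"
  assumes \<Omega>: "open \<Omega>" "bounded \<Omega>" "\<Omega> \<noteq> {}" and u: "u \<in> W1inf_0 \<Omega>"
    and M: "AE x in lebesgue_on \<Omega>. norm (weak_gradient \<Omega> u x) \<le> M"
  shows "AE x in lebesgue_on \<Omega>. \<bar>u x\<bar> \<le> M * bdist \<Omega> x"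
proof -
  from u obtain v where v: "AE x in lebesgue_on \<Omega>. v x = u x" "continuous_on (closure \<Omega>) v"
    "\<And>x. x \<in> frontier \<Omega> \<Longrightarrow> v x = 0" by (auto simp: W1inf_0_def)
  from u obtain G where G: "has_weak_gradient \<Omega> u G" by (auto simp: W1inf_0_def W1inf_def)
  define V where "V x = (if x \<in> \<Omega> then v x else 0)" for x
  have "continuous_on (closure \<Omega> \<union> - \<Omega>) V"
    unfolding V_def[abs_def]
  proof (rule continuous_on_cases)
    show "\<forall>x. x \<in> closure \<Omega> \<and> x \<notin> \<Omega> \<or> x \<in> - \<Omega> \<and> x \<in> \<Omega> \<longrightarrow> v x = 0"
      using v(3) \<Omega>(1) by (auto simp: frontier_def interior_open)
  qed (use v(2) \<Omega>(1) in \<open>auto simp: open_closed\<close>)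
  moreover have "closure \<Omega> \<union> - \<Omega> = UNIV" using closure_subset by auto
  ultimately have Vc: "continuous_on UNIV V" by simp
  have eq: "AE x in lebesgue_on \<Omega>. V x = u x"
    using v(1) by (rule AE_mp) (auto intro!: AE_I2 simp: V_def)
  have "locally_integrable \<Omega> V"
    unfolding locally_integrable_iff
    by (auto intro!: integrable_lebesgue_on_compact intro: continuous_on_subset[OF Vc])
  from has_weak_gradient_cong_AE[OF \<Omega>(1) has_weak_gradient_weak_gradient[OF G] this eq]
  have "has_weak_gradient \<Omega> V (weak_gradient \<Omega> u)" .
  from abs_le_bdist[OF \<Omega> Vc _ this M]
  have "\<bar>V x\<bar> \<le> M * bdist \<Omega> x" if "x \<in> \<Omega>" for x using that by (simp add: V_def)
  then have "AE x in lebesgue_on \<Omega>. \<bar>V x\<bar> \<le> M * bdist \<Omega> x" by (intro AE_I2) simp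
  with eq show ?thesis by eventually_elim simp
qed

section \<open>Truncated multiples of the distance function\<close>

lemma abs_min_diff_le: "\<bar>min a r - min b r\<bar> \<le> \<bar>a - b\<bar>" for a b r :: real
  by (auto simp: min_def)

text \<open>The derivative of the truncated multiple min (c d) r with respect to c. On the level set
  c d = r, where this derivative need not exist, the value 0 is a convention on a null set.\<close>

definition trunc_bdist :: "'a::euclidean_space set \<Rightarrow> real \<Rightarrow> 'a \<Rightarrow> real" where
  "trunc_bdist \<Omega> c x = (if c * bdist \<Omega> x < inradius \<Omega> then bdist \<Omega> x else 0)"

text \<open>For c > 0 this is I2 at 1 / c; in this form it also makes sense for c = 0, where it is
  the squared norm of d.\<close>

definition trunc_energy :: "'a::euclidean_space set \<Rightarrow> real \<Rightarrow> real" where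
  "trunc_energy \<Omega> c = (\<integral>x. (trunc_bdist \<Omega> c x)\<^sup>2 \<partial>lebesgue_on \<Omega>)"

definition profile :: "'a::euclidean_space set \<Rightarrow> real \<Rightarrow> 'a \<Rightarrow> real" where
  "profile \<Omega> c x = min (c * bdist \<Omega> x) (inradius \<Omega>)"

context
  fixes \<Omega> :: "'a::euclidean_space set"
  assumes \<Omega>: "open \<Omega>" "bounded \<Omega>" "\<Omega> \<noteq> {}"
begin

interpretation finite_measure "lebesgue_on \<Omega>"
  by (rule domain_finite_measure[OF \<Omega>])

lemma integrable_AE_bounded:
  assumes "f \<in> borel_measurable (lebesgue_on \<Omega>)" "AE x in lebesgue_on \<Omega>. \<bar>f x\<bar> \<le> B"
  shows "integrable (lebesgue_on \<Omega>) (f :: 'a \<Rightarrow> real)"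
  using assms by (intro integrable_const_bound[of _ B]) auto

lemma bounded_in_L2:
  assumes "f \<in> borel_measurable (lebesgue_on \<Omega>)" "\<And>x. x \<in> \<Omega> \<Longrightarrow> \<bar>f x\<bar> \<le> B"
  shows "f \<in> L2 \<Omega>"
proof -
  have "(f x)\<^sup>2 \<le> B\<^sup>2" if "x \<in> \<Omega>" for x
    using power_mono[OF assms(2)[OF that], of 2] by simp
  then have "integrable (lebesgue_on \<Omega>) (\<lambda>x. (f x)\<^sup>2)"
    using assms(1) by (intro integrable_AE_bounded[of _ "B\<^sup>2"] AE_I2) auto
  with assms(1) show ?thesis by (simp add: L2_def)
qed

lemma L2_norm_tendsto_0:
  assumes m: "\<And>n. f n \<in> borel_measurable (lebesgue_on \<Omega>)"
    and B: "\<And>n x. x \<in> \<Omega> \<Longrightarrow> \<bar>f n x\<bar> \<le> B"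
    and lim: "AE x in lebesgue_on \<Omega>. (\<lambda>n. f n x) \<longlonglongrightarrow> 0"
  shows "(\<lambda>n. L2_norm \<Omega> (f n)) \<longlonglongrightarrow> 0"
proof -
  have "(\<lambda>n. \<integral>x. f n x * f n x \<partial>lebesgue_on \<Omega>) \<longlonglongrightarrow> (\<integral>x. 0 \<partial>lebesgue_on \<Omega>)"
  proof (rule integral_dominated_convergence[where w = "\<lambda>_. B * B"])
    show "AE x in lebesgue_on \<Omega>. norm (f n x * f n x) \<le> B * B" for n
    proof (rule AE_I2)
      fix x assume "x \<in> space (lebesgue_on \<Omega>)"
      then have "\<bar>f n x\<bar> \<le> B" using B by simp
      then have "\<bar>f n x\<bar> * \<bar>f n x\<bar> \<le> B * B" by (intro mult_mono) auto
      then show "norm (f n x * f n x) \<le> B * B" by (simp only: real_norm_def abs_mult)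
    qed
    show "AE x in lebesgue_on \<Omega>. (\<lambda>n. f n x * f n x) \<longlonglongrightarrow> 0"
      using lim by eventually_elim (auto intro!: tendsto_mult_zero)
  qed (use m in auto)
  from tendsto_real_sqrt[OF this] show ?thesis by (simp add: L2_norm_def L2_inner_def)
qed

lemma L2_norm_le_scaled_bdist:
  assumes m: "f \<in> borel_measurable (lebesgue_on \<Omega>)" and k: "k \<ge> 0"
    and b: "\<And>x. x \<in> \<Omega> \<Longrightarrow> \<bar>f x\<bar> \<le> k * bdist \<Omega> x"
  shows "L2_norm \<Omega> f \<le> k * L2_norm \<Omega> (bdist \<Omega>)"
proof -
  have dr: "\<bar>bdist \<Omega> x\<bar> \<le> inradius \<Omega>" if "x \<in> \<Omega>" for x
    using bdist_le_inradius[OF \<Omega> that] bdist_nonneg[of \<Omega> x] by simp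
  have dm: "bdist \<Omega> \<in> borel_measurable (lebesgue_on \<Omega>)" by (rule bdist_measurable)
  have fL: "f \<in> L2 \<Omega>"
  proof (rule bounded_in_L2[OF m])
    fix x assume x: "x \<in> \<Omega>"
    have "\<bar>f x\<bar> \<le> k * bdist \<Omega> x" by (rule b[OF x])
    also have "\<dots> \<le> k * inradius \<Omega>" using bdist_le_inradius[OF \<Omega> x] k by (rule mult_left_mono)
    finally show "\<bar>f x\<bar> \<le> k * inradius \<Omega>" .
  qed
  have dL: "bdist \<Omega> \<in> L2 \<Omega>" by (rule bounded_in_L2[OF dm dr])
  have "L2_inner \<Omega> f f \<le> (\<integral>x. k\<^sup>2 * (bdist \<Omega> x)\<^sup>2 \<partial>lebesgue_on \<Omega>)"
    unfolding L2_inner_def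
  proof (rule integral_mono)
    show "integrable (lebesgue_on \<Omega>) (\<lambda>x. f x * f x)" using fL by (simp add: L2_def power2_eq_square)
    show "integrable (lebesgue_on \<Omega>) (\<lambda>x. k\<^sup>2 * (bdist \<Omega> x)\<^sup>2)" using dL by (simp add: L2_def)
    show "f x * f x \<le> k\<^sup>2 * (bdist \<Omega> x)\<^sup>2" if "x \<in> space (lebesgue_on \<Omega>)" for x
      using power_mono[OF b[of x], of 2] that by (simp add: power2_eq_square mult_ac)
  qed
  also have "\<dots> = k\<^sup>2 * L2_inner \<Omega> (bdist \<Omega>) (bdist \<Omega>)"
    by (simp add: L2_inner_def power2_eq_square)
  finally show ?thesis
    using k unfolding L2_norm_def by (metis real_sqrt_le_mono real_sqrt_mult real_sqrt_abs abs_of_nonneg)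
qed

lemma trunc_bdist_measurable: "trunc_bdist \<Omega> c \<in> borel_measurable (lebesgue_on \<Omega>)"
proof -
  have [measurable]: "bdist \<Omega> \<in> borel_measurable (lebesgue_on \<Omega>)" by (rule bdist_measurable)
  show ?thesis unfolding trunc_bdist_def[abs_def] by measurable
qed

lemma profile_measurable: "profile \<Omega> c \<in> borel_measurable (lebesgue_on \<Omega>)"
proof -
  have [measurable]: "bdist \<Omega> \<in> borel_measurable (lebesgue_on \<Omega>)" by (rule bdist_measurable)
  show ?thesis unfolding profile_def[abs_def] by measurable
qed

lemma trunc_bdist_bounds:
  assumes "x \<in> \<Omega>"
  shows "0 \<le> trunc_bdist \<Omega> c x" "trunc_bdist \<Omega> c x \<le> bdist \<Omega> x" "\<bar>trunc_bdist \<Omega> c x\<bar> \<le> inradius \<Omega>"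
  using bdist_le_inradius[OF \<Omega> assms] bdist_nonneg[of \<Omega> x]
  by (auto simp: trunc_bdist_def)

lemma profile_bounds:
  assumes "x \<in> \<Omega>" "c \<ge> 0"
  shows "0 \<le> profile \<Omega> c x" "\<bar>profile \<Omega> c x\<bar> \<le> inradius \<Omega>"
proof -
  have "0 \<le> c * bdist \<Omega> x" using assms(2) bdist_nonneg[of \<Omega> x] by simp
  then show "0 \<le> profile \<Omega> c x" "\<bar>profile \<Omega> c x\<bar> \<le> inradius \<Omega>"
    using inradius_pos[OF \<Omega>] by (auto simp: profile_def)
qed

lemma negligible_bdist_level:
  assumes "s > 0" shows "negligible {x\<in>S. bdist \<Omega> x = s}"
  using negligible_infdist_level[OF frontier_domain(1,3)[OF \<Omega>] assms]
  by (rule negligible_subset) (auto simp: bdist_def)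

lemma J_fun_profile_le:
  "c \<ge> 0 \<Longrightarrow> (\<And>x. x \<in> \<Omega> \<Longrightarrow> u x = profile \<Omega> c x) \<Longrightarrow> J_fun \<Omega> u \<le> ennreal c"
  using inradius_pos[OF \<Omega>] by (intro J_fun_min_bdist_le[OF \<Omega>]) (auto simp: profile_def)

text \<open>On \<open>W1inf_0\<close> the bound \<open>\<bar>v\<bar> \<le> J v * d\<close> gives \<open>\<langle>p, v\<rangle> \<le> J v\<close> for the normalised \<open>p\<close>
  below, with equality at the profile itself.\<close>

lemma subgradient_profile:
  assumes c: "c \<ge> 0" and k: "k \<ge> 0" "k * trunc_energy \<Omega> c = 1"
    and u: "u \<in> L2 \<Omega>" "\<And>x. x \<in> \<Omega> \<Longrightarrow> u x = profile \<Omega> c x"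
  shows "(\<lambda>x. k * trunc_bdist \<Omega> c x) \<in> subdifferential \<Omega> (J_fun \<Omega>) u"
proof -
  let ?p = "\<lambda>x. k * trunc_bdist \<Omega> c x"
  have pm: "?p \<in> borel_measurable (lebesgue_on \<Omega>)"
    using trunc_bdist_measurable by (intro borel_measurable_times) auto
  have pb: "\<bar>?p x\<bar> \<le> k * inradius \<Omega>" "0 \<le> ?p x" if "x \<in> \<Omega>" for x
    using trunc_bdist_bounds[OF that, of c] k by (auto simp: abs_mult mult_left_mono)
  have "?p \<in> L2 \<Omega>" using pm pb by (intro bounded_in_L2) auto
  moreover have J: "J_fun \<Omega> u \<le> ennreal c" by (rule J_fun_profile_le[OF c u(2)])
  moreover have "enn2ereal (J_fun \<Omega> u) + ereal (L2_inner \<Omega> ?p (\<lambda>x. v x - u x))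
      \<le> enn2ereal (J_fun \<Omega> v)" if v: "v \<in> L2 \<Omega>" for v
  proof (cases "v \<in> W1inf_0 \<Omega> \<and> J_fun \<Omega> v < \<infinity>")
    case False
    then have "J_fun \<Omega> v = \<infinity>" by (auto simp: J_fun_def less_top[symmetric])
    then show ?thesis by simp
  next
    case True
    then obtain M where M: "J_fun \<Omega> v = ennreal M" "M \<ge> 0"
      by (cases "J_fun \<Omega> v") auto
    have "AE x in lebesgue_on \<Omega>. ennreal (norm (weak_gradient \<Omega> v x)) \<le> ennreal M"
      using esssup_AE[of "\<lambda>x. ennreal (norm (weak_gradient \<Omega> v x))" "lebesgue_on \<Omega>"] M(1) True
      by (simp add: J_fun_def Linf_norm_def)
    then have "AE x in lebesgue_on \<Omega>. norm (weak_gradient \<Omega> v x) \<le> M"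
      by eventually_elim (simp add: M)
    then have vM: "AE x in lebesgue_on \<Omega>. \<bar>v x\<bar> \<le> M * bdist \<Omega> x"
      using True by (intro W1inf_0_abs_le_bdist[OF \<Omega>]) auto
    have vm: "v \<in> borel_measurable (lebesgue_on \<Omega>)" using v by (simp add: L2_def)
    have \<Omega>AE: "AE x in lebesgue_on \<Omega>. x \<in> \<Omega>" by (intro AE_I2) simp
    have int_v: "integrable (lebesgue_on \<Omega>) (\<lambda>x. ?p x * v x)"
    proof (rule integrable_AE_bounded)
      show "(\<lambda>x. ?p x * v x) \<in> borel_measurable (lebesgue_on \<Omega>)"
        using pm vm by (rule borel_measurable_times)
      show "AE x in lebesgue_on \<Omega>. \<bar>?p x * v x\<bar> \<le> (k * inradius \<Omega>) * (M * inradius \<Omega>)"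
        using vM \<Omega>AE
      proof eventually_elim
        case (elim x)
        have "M * bdist \<Omega> x \<le> M * inradius \<Omega>"
          using bdist_le_inradius[OF \<Omega> elim(2)] M(2) by (rule mult_left_mono)
        then have "\<bar>v x\<bar> \<le> M * inradius \<Omega>" using elim(1) by linarith
        then have "\<bar>?p x\<bar> * \<bar>v x\<bar> \<le> (k * inradius \<Omega>) * (M * inradius \<Omega>)"
          using pb[OF elim(2)] by (intro mult_mono) auto
        then show ?case by (simp only: abs_mult)
      qed
    qed
    have int_u: "integrable (lebesgue_on \<Omega>) (\<lambda>x. ?p x * profile \<Omega> c x)"
    proof (rule integrable_AE_bounded)
      show "(\<lambda>x. ?p x * profile \<Omega> c x) \<in> borel_measurable (lebesgue_on \<Omega>)"
        using pm profile_measurable by (rule borel_measurable_times)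
      show "AE x in lebesgue_on \<Omega>. \<bar>?p x * profile \<Omega> c x\<bar> \<le> (k * inradius \<Omega>) * inradius \<Omega>"
        using \<Omega>AE
      proof eventually_elim
        case (elim x)
        have "\<bar>?p x\<bar> * \<bar>profile \<Omega> c x\<bar> \<le> (k * inradius \<Omega>) * inradius \<Omega>"
          using pb[OF elim] profile_bounds[OF elim c] by (intro mult_mono) auto
        then show ?case by (simp only: abs_mult)
      qed
    qed
    have int_t: "integrable (lebesgue_on \<Omega>) (\<lambda>x. (trunc_bdist \<Omega> c x)\<^sup>2)"
      using bounded_in_L2[OF trunc_bdist_measurable trunc_bdist_bounds(3)] by (simp add: L2_def)
    \<comment> \<open>Where \<open>?p\<close> does not vanish the truncation is void, so the profile
      is c d there; this gives equality in the pairing with \<open>u\<close>.\<close>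
    have "(\<integral>x. ?p x * profile \<Omega> c x \<partial>lebesgue_on \<Omega>) = (\<integral>x. (k * c) * (trunc_bdist \<Omega> c x)\<^sup>2 \<partial>lebesgue_on \<Omega>)"
      by (intro Bochner_Integration.integral_cong) (auto simp: trunc_bdist_def profile_def power2_eq_square)
    also have "\<dots> = c * (k * trunc_energy \<Omega> c)" by (simp add: trunc_energy_def)
    finally have pu: "(\<integral>x. ?p x * profile \<Omega> c x \<partial>lebesgue_on \<Omega>) = c" using k by simp
    have "(\<integral>x. ?p x * v x \<partial>lebesgue_on \<Omega>) \<le> (\<integral>x. (k * M) * (trunc_bdist \<Omega> c x)\<^sup>2 \<partial>lebesgue_on \<Omega>)"
    proof (rule integral_mono_AE[OF int_v])
      show "integrable (lebesgue_on \<Omega>) (\<lambda>x. (k * M) * (trunc_bdist \<Omega> c x)\<^sup>2)" using int_t by simp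
      show "AE x in lebesgue_on \<Omega>. ?p x * v x \<le> (k * M) * (trunc_bdist \<Omega> c x)\<^sup>2"
        using vM \<Omega>AE
      proof eventually_elim
        case (elim x)
        have "?p x * v x \<le> ?p x * (M * bdist \<Omega> x)"
          using elim pb(2)[OF elim(2)] by (intro mult_left_mono) auto
        also have "\<dots> = (k * M) * (trunc_bdist \<Omega> c x)\<^sup>2"
          by (simp add: trunc_bdist_def power2_eq_square)
        finally show ?case .
      qed
    qed
    also have "\<dots> = M * (k * trunc_energy \<Omega> c)" by (simp add: trunc_energy_def)
    finally have pv: "(\<integral>x. ?p x * v x \<partial>lebesgue_on \<Omega>) \<le> M" using k by simp
    have "L2_inner \<Omega> ?p (\<lambda>x. v x - u x) = (\<integral>x. ?p x * v x - ?p x * profile \<Omega> c x \<partial>lebesgue_on \<Omega>)"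
      unfolding L2_inner_def
      by (intro Bochner_Integration.integral_cong) (simp_all add: u(2) right_diff_distrib)
    also have "\<dots> \<le> M - c"
      by (subst Bochner_Integration.integral_diff[OF int_v int_u]) (use pu pv in simp)
    finally have i: "L2_inner \<Omega> ?p (\<lambda>x. v x - u x) \<le> M - c" .
    have "enn2ereal (J_fun \<Omega> u) \<le> ereal c"
      using J c by (metis enn2ereal_ennreal less_eq_ennreal.rep_eq)
    \<comment> \<open>The upper bound c for J(u) cancels against the pairing of \<open>?p\<close>
      with \<open>u\<close>, which equals c.\<close>
    then have "enn2ereal (J_fun \<Omega> u) + ereal (L2_inner \<Omega> ?p (\<lambda>x. v x - u x))
        \<le> ereal c + ereal (M - c)"
      using i by (intro add_mono) auto
    also have "\<dots> = enn2ereal (J_fun \<Omega> v)" using M by (simp add: enn2ereal_ennreal)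
    finally show ?thesis .
  qed
  ultimately show ?thesis
    using u(1) by (auto simp: subdifferential_def intro: order.strict_trans1)
qed

text \<open>After extinction u = 0 and the speed is 0, so no normalisation is possible; 0 is a
  subgradient because J takes its minimum 0 at u.\<close>

lemma subgradient_zero:
  assumes u: "u \<in> L2 \<Omega>" "\<And>x. x \<in> \<Omega> \<Longrightarrow> u x = profile \<Omega> 0 x"
  shows "(\<lambda>x. 0) \<in> subdifferential \<Omega> (J_fun \<Omega>) u"
proof -
  have "J_fun \<Omega> u = 0" using J_fun_profile_le[OF _ u(2)] by simp
  moreover have "(\<lambda>x. 0) \<in> L2 \<Omega>" by (rule bounded_in_L2[of _ 0]) auto
  ultimately show ?thesis
    using u(1) by (auto simp: subdifferential_def L2_inner_def zero_ennreal.rep_eq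
        enn2ereal_nonneg[unfolded zero_ereal_def])
qed

lemma L2_norm_profile_diff:
  "L2_norm \<Omega> (\<lambda>x. profile \<Omega> a x - profile \<Omega> b x) \<le> \<bar>a - b\<bar> * L2_norm \<Omega> (bdist \<Omega>)"
proof (rule L2_norm_le_scaled_bdist)
  show "(\<lambda>x. profile \<Omega> a x - profile \<Omega> b x) \<in> borel_measurable (lebesgue_on \<Omega>)"
    by (intro borel_measurable_diff profile_measurable)
  fix x assume "x \<in> \<Omega>"
  have "\<bar>profile \<Omega> a x - profile \<Omega> b x\<bar> \<le> \<bar>a * bdist \<Omega> x - b * bdist \<Omega> x\<bar>"
    unfolding profile_def by (rule abs_min_diff_le)
  also have "\<dots> = \<bar>a - b\<bar> * bdist \<Omega> x"
    using bdist_nonneg[of \<Omega> x] by (simp add: abs_mult flip: left_diff_distrib)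
  finally show "\<bar>profile \<Omega> a x - profile \<Omega> b x\<bar> \<le> \<bar>a - b\<bar> * bdist \<Omega> x" .
qed simp

text \<open>Off the null set c t * d = r the quotients converge pointwise, since the truncation is
  void or constant for times close to t. As truncating does not increase differences, they are
  dominated by r times a bound for the difference quotients of \<open>c\<close>.\<close>

lemma has_L2_derivative_profile:
  assumes c: "(c has_real_derivative c') (at t)" "c t \<ge> 0"
  shows "has_L2_derivative \<Omega> (\<lambda>s. profile \<Omega> (c s)) (\<lambda>x. c' * trunc_bdist \<Omega> (c t) x) t"
  unfolding has_L2_derivative_def
proof
  let ?w = "\<lambda>x. c' * trunc_bdist \<Omega> (c t) x"
  have wm: "?w \<in> borel_measurable (lebesgue_on \<Omega>)"
    using trunc_bdist_measurable by (intro borel_measurable_times) auto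
  have wb: "\<bar>?w x\<bar> \<le> \<bar>c'\<bar> * inradius \<Omega>" if "x \<in> \<Omega>" for x
    unfolding abs_mult using trunc_bdist_bounds(3)[OF that] by (rule mult_left_mono) simp
  show "?w \<in> L2 \<Omega>" using wm wb by (rule bounded_in_L2)
  show "((\<lambda>s. L2_norm \<Omega> (\<lambda>x. (profile \<Omega> (c s) x - profile \<Omega> (c t) x) / (s - t) - ?w x)) \<longlongrightarrow> 0) (at t)"
    unfolding tendsto_at_iff_sequentially comp_def
  proof (intro allI impI)
    fix X assume X: "\<forall>i. X i \<in> UNIV - {t}" "X \<longlonglongrightarrow> t"
    have Xt: "filterlim X (at t) sequentially"
      using X by (auto simp: filterlim_at)
    define q where "q n = (c (X n) - c t) / (X n - t)" for n
    have q: "q \<longlonglongrightarrow> c'"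
      using filterlim_compose[OF _ Xt] c(1) unfolding has_field_derivative_iff q_def[abs_def] by blast
    then obtain B where B: "\<And>n. \<bar>q n\<bar> \<le> B"
      using convergent_imp_Bseq[of q] unfolding Bseq_def convergent_def by (metis real_norm_def)
    have cX: "(\<lambda>n. c (X n)) \<longlonglongrightarrow> c t"
      using DERIV_isCont[OF c(1)] X(2) by (rule isCont_tendsto_compose)
    have quot: "\<bar>(profile \<Omega> (c (X n)) x - profile \<Omega> (c t) x) / (X n - t)\<bar> \<le> B * inradius \<Omega>" if "x \<in> \<Omega>" for n x
    proof -
      have "\<bar>profile \<Omega> (c (X n)) x - profile \<Omega> (c t) x\<bar> \<le> \<bar>c (X n) * bdist \<Omega> x - c t * bdist \<Omega> x\<bar>"
        unfolding profile_def by (rule abs_min_diff_le)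
      also have "\<dots> = \<bar>c (X n) - c t\<bar> * bdist \<Omega> x"
        using bdist_nonneg[of \<Omega> x] by (simp add: abs_mult flip: left_diff_distrib)
      finally have "\<bar>(profile \<Omega> (c (X n)) x - profile \<Omega> (c t) x) / (X n - t)\<bar> \<le> \<bar>c (X n) - c t\<bar> * bdist \<Omega> x / \<bar>X n - t\<bar>"
        unfolding abs_divide by (rule divide_right_mono) simp
      also have "\<dots> = \<bar>q n\<bar> * bdist \<Omega> x" by (simp add: q_def abs_divide)
      also have "\<dots> \<le> B * inradius \<Omega>"
        using B[of n] bdist_le_inradius[OF \<Omega> that] bdist_nonneg[of \<Omega> x] by (intro mult_mono) auto
      finally show ?thesis .
    qed
    show "(\<lambda>n. L2_norm \<Omega> (\<lambda>x. (profile \<Omega> (c (X n)) x - profile \<Omega> (c t) x) / (X n - t) - ?w x)) \<longlonglongrightarrow> 0"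
    proof (rule L2_norm_tendsto_0)
      show "(\<lambda>x. (profile \<Omega> (c (X n)) x - profile \<Omega> (c t) x) / (X n - t) - ?w x) \<in> borel_measurable (lebesgue_on \<Omega>)" for n
        by (intro borel_measurable_diff borel_measurable_divide profile_measurable wm) auto
      show "\<bar>(profile \<Omega> (c (X n)) x - profile \<Omega> (c t) x) / (X n - t) - ?w x\<bar> \<le> B * inradius \<Omega> + \<bar>c'\<bar> * inradius \<Omega>"
        if "x \<in> \<Omega>" for n x
        using quot[OF that, of n] wb[OF that] by linarith
      have "negligible {x\<in>\<Omega>. c t * bdist \<Omega> x = inradius \<Omega>}"
      proof (cases "c t = 0")
        case True
        then show ?thesis using inradius_pos[OF \<Omega>] by simp
      next
        case False
        then have "{x\<in>\<Omega>. c t * bdist \<Omega> x = inradius \<Omega>} = {x\<in>\<Omega>. bdist \<Omega> x = inradius \<Omega> / c t}"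
          by (auto simp: field_simps)
        then show ?thesis
          using negligible_bdist_level[of "inradius \<Omega> / c t" \<Omega>] inradius_pos[OF \<Omega>] c(2) False by simp
      qed
      then have "AE x in lebesgue_on \<Omega>. c t * bdist \<Omega> x \<noteq> inradius \<Omega>"
        using domain_sets[OF \<Omega>] by (subst AE_lebesgue_on_iff_negligible) auto
      then show "AE x in lebesgue_on \<Omega>. (\<lambda>n. (profile \<Omega> (c (X n)) x - profile \<Omega> (c t) x) / (X n - t) - ?w x) \<longlonglongrightarrow> 0"
      proof eventually_elim
        case (elim x)
        have lim: "(\<lambda>n. c (X n) * bdist \<Omega> x) \<longlonglongrightarrow> c t * bdist \<Omega> x"
          by (intro tendsto_mult tendsto_const cX)
        show ?case
        proof (cases "c t * bdist \<Omega> x < inradius \<Omega>")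
          case True
          have "\<forall>\<^sub>F n in sequentially. c (X n) * bdist \<Omega> x < inradius \<Omega>"
            by (rule order_tendstoD(2)[OF lim True])
          then have "\<forall>\<^sub>F n in sequentially. (q n - c') * bdist \<Omega> x =
              (profile \<Omega> (c (X n)) x - profile \<Omega> (c t) x) / (X n - t) - ?w x"
            by eventually_elim (use True in \<open>simp add: profile_def trunc_bdist_def q_def
              left_diff_distrib diff_divide_distrib\<close>)
          moreover have "(\<lambda>n. (q n - c') * bdist \<Omega> x) \<longlonglongrightarrow> 0"
            using tendsto_mult[OF tendsto_diff[OF q tendsto_const[of c']] tendsto_const[of "bdist \<Omega> x"]]
            by simp
          ultimately show ?thesis by (rule Lim_transform_eventually[rotated])
        next
          case False
          then have "inradius \<Omega> < c t * bdist \<Omega> x" using elim by simp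
          from order_tendstoD(1)[OF lim this]
          have "\<forall>\<^sub>F n in sequentially. 0 = (profile \<Omega> (c (X n)) x - profile \<Omega> (c t) x) / (X n - t) - ?w x"
            by eventually_elim (use False in \<open>simp add: profile_def trunc_bdist_def\<close>)
          then show ?thesis by (rule Lim_transform_eventually[OF tendsto_const])
        qed
      qed
    qed
  qed
qed

text \<open>Reduces the flow to the scalar function \<open>c\<close>. Lipschitz continuity is asked
  only away from time 0, because \<open>c\<close> blows up there; the blow-up gives continuity of u
  at time 0, as every x in \<Omega> has d(x) > 0 and is truncated to r for small times. The second
  alternative for \<open>k\<close> is the state after extinction.\<close>

lemma profile_solves_gradient_flow:
  assumes nonneg: "\<And>t. t > 0 \<Longrightarrow> c t \<ge> 0"
    and blowup: "filterlim c at_top (at_right 0)"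
    and Lip: "\<And>a. a > 0 \<Longrightarrow> \<exists>L. \<forall>s\<ge>a. \<forall>t\<ge>a. \<bar>c s - c t\<bar> \<le> L * \<bar>s - t\<bar>"
    and speed: "AE t in lebesgue. 0 < t \<longrightarrow> (\<exists>k. (c has_real_derivative - k) (at t) \<and> k \<ge> 0 \<and>
      (k * trunc_energy \<Omega> (c t) = 1 \<or> k = 0 \<and> c t = 0))"
    and u: "\<And>t x. x \<in> \<Omega> \<Longrightarrow> u t x = (if t = 0 then inradius \<Omega> else profile \<Omega> (c t) x)"
  shows "solves_gradient_flow \<Omega> (J_fun \<Omega>) (\<lambda>x. inradius \<Omega>) u"
proof -
  let ?N = "L2_norm \<Omega> (bdist \<Omega>)"
  have L2_norm_cong: "L2_norm \<Omega> f = L2_norm \<Omega> g" if "\<And>x. x \<in> \<Omega> \<Longrightarrow> f x = g x" for f g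
  proof -
    have "(\<integral>x. f x * f x \<partial>lebesgue_on \<Omega>) = (\<integral>x. g x * g x \<partial>lebesgue_on \<Omega>)"
      by (intro Bochner_Integration.integral_cong) (simp_all add: that)
    then show ?thesis by (simp add: L2_norm_def L2_inner_def)
  qed
  have N0: "?N \<ge> 0" unfolding L2_norm_def L2_inner_def by (intro real_sqrt_ge_zero integral_nonneg_AE) auto
  have diff: "L2_norm \<Omega> (\<lambda>x. u s x - u t x) \<le> \<bar>c s - c t\<bar> * ?N" if "s > 0" "t > 0" for s t
    using L2_norm_profile_diff[of "c s" "c t"] that
    by (subst L2_norm_cong[of _ "\<lambda>x. profile \<Omega> (c s) x - profile \<Omega> (c t) x"]) (auto simp: u)
  have ut: "u t \<in> L2 \<Omega>" if "t \<ge> 0" for t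
  proof (rule bounded_in_L2)
    have "(\<lambda>x. if t = 0 then inradius \<Omega> else profile \<Omega> (c t) x) \<in> borel_measurable (lebesgue_on \<Omega>)"
      using profile_measurable[of "c t"] by (cases "t = 0") auto
    then show "u t \<in> borel_measurable (lebesgue_on \<Omega>)"
      by (rule measurable_cong[THEN iffD1, rotated]) (simp add: u)
    show "\<bar>u t x\<bar> \<le> inradius \<Omega>" if "x \<in> \<Omega>" for x
      using u[OF that, of t] profile_bounds(2)[OF that nonneg[of t]] \<open>t \<ge> 0\<close> inradius_pos[OF \<Omega>] by auto
  qed
  have L2n: "0 \<le> L2_norm \<Omega> f" for f
    unfolding L2_norm_def L2_inner_def by (intro real_sqrt_ge_zero integral_nonneg_AE) auto
  have cont_c: "isCont c t" if "t > 0" for t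
  proof -
    obtain L where L: "\<forall>s\<ge>t/2. \<forall>s'\<ge>t/2. \<bar>c s - c s'\<bar> \<le> L * \<bar>s - s'\<bar>" using Lip[of "t/2"] \<open>t > 0\<close> by auto
    have "((\<lambda>s. c s - c t) \<longlongrightarrow> 0) (at t)"
    proof (rule tendsto_rabs_zero_cancel, rule tendsto_sandwich[OF _ _ tendsto_const])
      show "((\<lambda>s. L * \<bar>s - t\<bar>) \<longlongrightarrow> 0) (at t)"
        by (auto intro!: tendsto_eq_intros)
      have "\<forall>\<^sub>F s in at t. s \<in> {t/2<..}"
        using \<open>t > 0\<close> by (intro eventually_at_in_open') auto
      then show "\<forall>\<^sub>F s in at t. \<bar>c s - c t\<bar> \<le> L * \<bar>s - t\<bar>"
        by eventually_elim (use L \<open>t > 0\<close> in auto)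
    qed simp
    then show ?thesis by (simp add: isCont_def LIM_zero_cancel)
  qed
  have cont: "L2_continuous_on \<Omega> {0..} u"
    unfolding L2_continuous_on_def
  proof
    fix t :: real assume "t \<in> {0..}"
    then consider "t = 0" | "t > 0" by fastforce
    then show "((\<lambda>s. L2_norm \<Omega> (\<lambda>x. u s x - u t x)) \<longlongrightarrow> 0) (at t within {0..})"
    proof cases
      case 1
      show ?thesis
        unfolding tendsto_at_iff_sequentially comp_def
      proof (intro allI impI)
        fix X assume X: "\<forall>i. X i \<in> {0..} - {t}" "X \<longlonglongrightarrow> t"
        have X0: "X n > 0" for n using X(1) 1 by (metis DiffE atLeast_iff insertI1 order_le_less)
        have "filterlim X (at_right 0) sequentially"
          using X X0 1 by (auto simp: filterlim_at intro!: always_eventually less_imp_neq[THEN not_sym])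
        then have cX: "filterlim (\<lambda>n. c (X n)) at_top sequentially"
          by (rule filterlim_compose[OF blowup])
        show "(\<lambda>n. L2_norm \<Omega> (\<lambda>x. u (X n) x - u t x)) \<longlonglongrightarrow> 0"
        proof (rule L2_norm_tendsto_0)
          show "(\<lambda>x. u (X n) x - u t x) \<in> borel_measurable (lebesgue_on \<Omega>)" for n
            using ut[of "X n"] ut[of t] X0[of n] 1 by (auto simp: L2_def intro: borel_measurable_diff)
          show "\<bar>u (X n) x - u t x\<bar> \<le> inradius \<Omega>" if "x \<in> \<Omega>" for n x
            using u[OF that] X0[of n] 1 profile_bounds[OF that nonneg[OF X0[of n]]] by simp
          \<comment> \<open>The threshold r / d(x) that \<open>c\<close> has to exceed is not
            uniform near the frontier, so the convergence is pointwise and the norm is handled by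
            domination.\<close>
          have "(\<lambda>n. u (X n) x - u t x) \<longlonglongrightarrow> 0" if x: "x \<in> \<Omega>" for x
          proof -
            have "\<forall>\<^sub>F n in sequentially. inradius \<Omega> / bdist \<Omega> x \<le> c (X n)"
              using cX by (simp add: filterlim_at_top)
            then have "\<forall>\<^sub>F n in sequentially. 0 = u (X n) x - u t x"
              by eventually_elim (use X0 1 bdist_pos[OF \<Omega> x] in \<open>simp add: u[OF x] profile_def min_def field_simps
                  less_imp_neq[THEN not_sym]\<close>)
            then show ?thesis by (rule Lim_transform_eventually[OF tendsto_const])
          qed
          then show "AE x in lebesgue_on \<Omega>. (\<lambda>n. u (X n) x - u t x) \<longlonglongrightarrow> 0"
            by (intro AE_I2) simp
        qed
      qed
    next
      case 2
      have "((\<lambda>s. L2_norm \<Omega> (\<lambda>x. u s x - u t x)) \<longlongrightarrow> 0) (at t)"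
      proof (rule tendsto_sandwich[OF _ _ tendsto_const])
        have "((\<lambda>s. \<bar>c s - c t\<bar> * ?N) \<longlongrightarrow> \<bar>c t - c t\<bar> * ?N) (at t)"
          using cont_c[OF 2] by (intro tendsto_intros) (simp add: isCont_def)
        then show "((\<lambda>s. \<bar>c s - c t\<bar> * ?N) \<longlongrightarrow> 0) (at t)" by simp
        have "\<forall>\<^sub>F s in at t. s \<in> {0<..}" using 2 by (intro eventually_at_in_open') auto
        then show "\<forall>\<^sub>F s in at t. L2_norm \<Omega> (\<lambda>x. u s x - u t x) \<le> \<bar>c s - c t\<bar> * ?N"
          by eventually_elim (use 2 in \<open>auto intro: diff\<close>)
      qed (simp add: L2n)
      then show ?thesis by (rule tendsto_within_subset) simp
    qed
  qed
  have ac: "L2_abs_continuous_on \<Omega> {a..b} u" if ab: "0 < a" "a < b" for a b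
    unfolding L2_abs_continuous_on_def
  proof (intro allI impI)
    fix e :: real assume e: "e > 0"
    obtain L where L: "\<forall>s\<ge>a. \<forall>t\<ge>a. \<bar>c s - c t\<bar> \<le> L * \<bar>s - t\<bar>" using Lip[OF ab(1)] by blast
    \<comment> \<open>The summand 1 keeps \<open>C\<close> positive, so that e / C is a valid
      \<delta>.\<close>
    define C where "C = \<bar>L\<bar> * ?N + 1"
    have C: "C > 0" using N0 by (simp add: C_def add_nonneg_pos)
    have step: "L2_norm \<Omega> (\<lambda>x. u t x - u s x) \<le> C * (t - s)" if "s \<ge> a" "t \<ge> s" for s t
    proof -
      have "\<bar>c t - c s\<bar> \<le> L * \<bar>t - s\<bar>" using L that by (meson order_trans)
      also have "\<dots> \<le> \<bar>L\<bar> * (t - s)" using that by (simp add: mult_right_mono)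
      finally have "\<bar>c t - c s\<bar> * ?N \<le> \<bar>L\<bar> * (t - s) * ?N" using N0 by (rule mult_right_mono)
      also have "\<dots> \<le> C * (t - s)" using that by (simp add: C_def algebra_simps)
      finally show ?thesis using diff[of t s] that ab by linarith
    qed
    show "\<exists>\<delta>>0. \<forall>(n::nat) p q. (\<forall>k<n. p k \<in> {a..b} \<and> q k \<in> {a..b} \<and> p k \<le> q k) \<and>
        disjoint_family_on (\<lambda>k. {p k<..<q k}) {..<n} \<and> (\<Sum>k<n. q k - p k) < \<delta> \<longrightarrow>
        (\<Sum>k<n. L2_norm \<Omega> (\<lambda>x. u (q k) x - u (p k) x)) < e"
    proof (intro exI[of _ "e / C"] conjI allI impI)
      show "e / C > 0" using e C by simp
      fix n :: nat and p q :: "nat \<Rightarrow> real"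
      assume pq: "(\<forall>k<n. p k \<in> {a..b} \<and> q k \<in> {a..b} \<and> p k \<le> q k) \<and>
        disjoint_family_on (\<lambda>k. {p k<..<q k}) {..<n} \<and> (\<Sum>k<n. q k - p k) < e / C"
      have "(\<Sum>k<n. L2_norm \<Omega> (\<lambda>x. u (q k) x - u (p k) x)) \<le> (\<Sum>k<n. C * (q k - p k))"
        using pq by (intro sum_mono step) auto
      also have "\<dots> = C * (\<Sum>k<n. q k - p k)" by (simp add: sum_distrib_left)
      also have "\<dots> < e" using pq C by (simp add: pos_less_divide_eq mult.commute)
      finally show "(\<Sum>k<n. L2_norm \<Omega> (\<lambda>x. u (q k) x - u (p k) x)) < e" .
    qed
  qed
  have flow: "\<exists>w. has_L2_derivative \<Omega> u w t \<and> (\<lambda>x. - w x) \<in> subdifferential \<Omega> (J_fun \<Omega>) (u t)"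
    if t: "t > 0" and k: "(c has_real_derivative - k) (at t)" "k \<ge> 0"
      "k * trunc_energy \<Omega> (c t) = 1 \<or> k = 0 \<and> c t = 0" for t k
  proof (intro exI conjI)
    let ?w = "\<lambda>x. - k * trunc_bdist \<Omega> (c t) x"
    have d: "has_L2_derivative \<Omega> (\<lambda>s. profile \<Omega> (c s)) ?w t"
      by (rule has_L2_derivative_profile[OF k(1) nonneg[OF t]])
    have "\<forall>\<^sub>F s in at t. s \<in> {0<..}" using t by (intro eventually_at_in_open') auto
    then have "\<forall>\<^sub>F s in at t. L2_norm \<Omega> (\<lambda>x. (profile \<Omega> (c s) x - profile \<Omega> (c t) x) / (s - t) - ?w x) =
        L2_norm \<Omega> (\<lambda>x. (u s x - u t x) / (s - t) - ?w x)"
      by eventually_elim (use t in \<open>auto intro!: L2_norm_cong simp: u\<close>)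
    with d show "has_L2_derivative \<Omega> u ?w t"
      unfolding has_L2_derivative_def by (auto elim: Lim_transform_eventually)
    have up: "u t x = profile \<Omega> (c t) x" if "x \<in> \<Omega>" for x using u[OF that] t by simp
    note uL = ut[OF less_imp_le[OF t]]
    show "(\<lambda>x. - ?w x) \<in> subdifferential \<Omega> (J_fun \<Omega>) (u t)"
      using k(3)
    proof
      assume "k * trunc_energy \<Omega> (c t) = 1"
      then show ?thesis using subgradient_profile[OF nonneg[OF t] k(2) _ uL up] by simp
    next
      assume "k = 0 \<and> c t = 0"
      then show ?thesis using subgradient_zero[OF uL] up by simp
    qed
  qed
  have "AE t in lebesgue. 0 < t \<longrightarrow>
      (\<exists>w. has_L2_derivative \<Omega> u w t \<and> (\<lambda>x. - w x) \<in> subdifferential \<Omega> (J_fun \<Omega>) (u t))"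
    using speed by eventually_elim (use flow in blast)
  then show ?thesis
    unfolding solves_gradient_flow_def using ut cont ac u by (auto intro!: AE_I2)
qed

end

section \<open>The height of the truncation\<close>

text \<open>Separation of variables: \<open>G\<close> is the time needed to reach a height and
  \<open>g\<close> its inverse. \<open>h\<close> is given up to 2 although \<open>g\<close> stops at
  1, so that T = G 1 lies inside the range of \<open>G\<close> and the derivative at T is two-sided.
  Positivity is asked only for s > 0, since in the application \<open>h\<close> vanishes at 0;
  \<open>G\<close> is still strictly increasing.\<close>

lemma autonomous_ivp:
  fixes h :: "real \<Rightarrow> real"
  assumes h: "continuous_on {0..2} h" "\<And>s. 0 < s \<Longrightarrow> s \<le> 2 \<Longrightarrow> 0 < h s"
  obtains T g where "T > 0" "continuous_on {0..T} g" "g 0 = 0" "g T = 1"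
    "\<And>t. t \<in> {0<..T} \<Longrightarrow> 0 < g t \<and> g t \<le> 1 \<and> (g has_real_derivative 1 / h (g t)) (at t)"
proof -
  define G where "G s = integral {0..s} h" for s
  have GD: "(G has_real_derivative h s) (at s within {0..2})" if "s \<in> {0..2}" for s
    unfolding G_def by (rule integral_has_real_derivative[OF h(1) that])
  have Gc: "continuous_on {0..2} G"
    using GD DERIV_continuous_on by blast
  have GD': "(G has_real_derivative h s) (at s)" if "0 < s" "s < 2" for s
    using GD[of s] that at_within_interior[of s "{0..2}"] by simp
  have mono: "G a < G b" if "0 \<le> a" "a < b" "b \<le> 2" for a b
  proof (rule DERIV_pos_imp_increasing_open[OF that(2)])
    show "continuous_on {a..b} G" using Gc that by (auto intro: continuous_on_subset)
    show "\<exists>y. DERIV G x :> y \<and> 0 < y" if "a < x" "x < b" for x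
      using GD'[of x] h(2)[of x] that \<open>0 \<le> a\<close> \<open>b \<le> 2\<close> by (intro exI[of _ "h x"]) auto
  qed
  have inj: "inj_on G {0..2}"
    by (rule linorder_inj_onI) (use mono in \<open>force+\<close>)
  have G0: "G 0 = 0" by (simp add: G_def)
  define g where "g = the_inv_into {0..2} G"
  have gG: "g (G s) = s" if "s \<in> {0..2}" for s
    unfolding g_def by (rule the_inv_into_f_f[OF inj that])
  have range: "\<exists>s\<in>{0..2}. G s = t" if "t \<in> {0..G 2}" for t
    using IVT'[of G 0 t 2] that Gc G0 by auto
  have img: "G ` {0..2} = {0..G 2}"
  proof (intro equalityI subsetI)
    fix t assume "t \<in> G ` {0..2}"
    then obtain s where s: "s \<in> {0..2}" "t = G s" by blast
    then have "G 0 \<le> G s" "G s \<le> G 2"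
      using mono[of 0 s] mono[of s 2] by (cases "s = 0"; cases "s = 2"; force)+
    with s G0 show "t \<in> {0..G 2}" by simp
  qed (use range in force)
  have gc: "continuous_on {0..G 2} g"
    using continuous_on_inv[OF Gc compact_Icc, of g] gG img by simp
  have Gg: "G (g t) = t" "g t \<in> {0..2}" if "t \<in> {0..G 2}" for t
    using range[OF that] gG by auto
  define T where "T = G 1"
  have T: "0 < T" "T < G 2" using mono[of 0 1] mono[of 1 2] G0 by (auto simp: T_def)
  have props: "0 < g t \<and> g t \<le> 1 \<and> (g has_real_derivative 1 / h (g t)) (at t)" if t: "t \<in> {0<..T}" for t
  proof -
    have tI: "t \<in> {0..G 2}" using t T by simp
    have g0: "0 < g t"
      using Gg[OF tI] G0 t by (metis atLeastAtMost_iff greaterThanAtMost_iff order_le_less)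
    have g1: "g t \<le> 1"
    proof (rule ccontr)
      assume "\<not> g t \<le> 1"
      then have "G 1 < G (g t)" using mono[of 1 "g t"] Gg(2)[OF tI] by simp
      then show False using Gg(1)[OF tI] t by (simp add: T_def)
    qed
    have "isCont g t"
      using gc t T by (intro continuous_on_interior[of "{0..G 2}"]) auto
    then have "(g has_real_derivative inverse (h (g t))) (at t)"
      using GD'[of "g t"] g0 g1 h(2)[of "g t"] t T Gg(1)
      by (intro DERIV_inverse_function[of G _ _ _ 0 "G 2"]) auto
    with g0 g1 show ?thesis by (simp add: inverse_eq_divide)
  qed
  show thesis
  proof
    show "T > 0" by (rule T)
    show "continuous_on {0..T} g" using gc T by (auto intro: continuous_on_subset)
    show "g 0 = 0" "g T = 1" using gG[of 0] gG[of 1] G0 by (simp_all add: T_def)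
  qed (rule props)
qed

section \<open>Positivity and continuity of the energies, and construction of the solution\<close>

context
  fixes \<Omega> :: "'a::euclidean_space set"
  assumes \<Omega>: "open \<Omega>" "bounded \<Omega>" "\<Omega> \<noteq> {}"
begin

interpretation finite_measure "lebesgue_on \<Omega>"
  by (rule domain_finite_measure[OF \<Omega>])

text \<open>Points close to the frontier satisfy c d < r, so the region of this inequality is a
  nonempty open set, and d is positive on it.\<close>

lemma trunc_energy_pos:
  assumes "c \<ge> 0"
  shows "trunc_energy \<Omega> c > 0"
proof -
  define A where "A = {x\<in>\<Omega>. c * bdist \<Omega> x < inradius \<Omega>}"
  have "open A"
    unfolding A_def using \<Omega>(1) bdist_continuous[of \<Omega> \<Omega>]
    by (auto simp: Collect_conj_eq intro!: open_Int open_Collect_less continuous_intros bdist_continuous)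
  moreover have "A \<noteq> {}"
  proof -
    obtain y where y: "y \<in> frontier \<Omega>" using frontier_domain(3)[OF \<Omega>] by blast
    \<comment> \<open>Dividing by c + 1 instead of c includes the case c = 0.\<close>
    define e where "e = inradius \<Omega> / (c + 1)"
    have e: "e > 0" using inradius_pos[OF \<Omega>] assms by (simp add: e_def)
    have "y \<in> closure \<Omega>" using y by (simp add: frontier_def)
    then obtain x where x: "x \<in> \<Omega>" "dist x y < e" using e unfolding closure_approachable by blast
    have "bdist \<Omega> x < e" using infdist_le[OF y, of x] x by (simp add: bdist_def)
    then have "(c + 1) * bdist \<Omega> x < inradius \<Omega>" using assms by (simp add: e_def field_simps)
    then have "c * bdist \<Omega> x < inradius \<Omega>" using bdist_nonneg[of \<Omega> x] by (simp add: distrib_right)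
    with x show ?thesis by (auto simp: A_def)
  qed
  ultimately have nA: "\<not> negligible A" by (rule open_not_negligible)
  have int: "integrable (lebesgue_on \<Omega>) (\<lambda>x. (trunc_bdist \<Omega> c x)\<^sup>2)"
    using bounded_in_L2[OF \<Omega> trunc_bdist_measurable[OF \<Omega>] trunc_bdist_bounds(3)[OF \<Omega>]]
    by (simp add: L2_def)
  have "trunc_energy \<Omega> c \<noteq> 0"
  proof
    assume "trunc_energy \<Omega> c = 0"
    then have "AE x in lebesgue_on \<Omega>. (trunc_bdist \<Omega> c x)\<^sup>2 = 0"
      unfolding trunc_energy_def using integral_nonneg_eq_0_iff_AE[OF int] by simp
    then have "negligible {x\<in>\<Omega>. \<not> (trunc_bdist \<Omega> c x)\<^sup>2 = 0}"
      using domain_sets[OF \<Omega>] by (subst (asm) AE_lebesgue_on_iff_negligible) auto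
    moreover have "A \<subseteq> {x\<in>\<Omega>. \<not> (trunc_bdist \<Omega> c x)\<^sup>2 = 0}"
      using bdist_pos[OF \<Omega>] by (force simp: A_def trunc_bdist_def)
    ultimately show False using nA negligible_subset by blast
  qed
  moreover have "trunc_energy \<Omega> c \<ge> 0"
    unfolding trunc_energy_def by (intro integral_nonneg_AE) auto
  ultimately show ?thesis by simp
qed

text \<open>For s > 0 the region d < r s is exactly where d / s < r, so restricting the domain and
  cutting off the integrand agree.\<close>

lemma I2_eq_trunc_energy:
  assumes "s > 0"
  shows "I2 \<Omega> s = trunc_energy \<Omega> (1 / s)"
proof -
  have "I2 \<Omega> s = (\<integral>x. (trunc_bdist \<Omega> (1 / s) x)\<^sup>2 \<partial>lebesgue_on (\<Omega> - inner_parallel \<Omega> (inradius \<Omega> * s)))"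
    unfolding I2_def using assms
    by (intro Bochner_Integration.integral_cong)
       (auto simp: inner_parallel_def trunc_bdist_def field_simps)
  also have "\<dots> = trunc_energy \<Omega> (1 / s)"
    unfolding trunc_energy_def
  proof (rule integral_lebesgue_on_subset[symmetric])
    have "\<Omega> - inner_parallel \<Omega> (inradius \<Omega> * s) = \<Omega> \<inter> {x. bdist \<Omega> x < inradius \<Omega> * s}"
      by (auto simp: inner_parallel_def)
    moreover have "open {x. bdist \<Omega> x < inradius \<Omega> * s}"
      by (intro open_Collect_less bdist_continuous continuous_intros)
    ultimately show "\<Omega> - inner_parallel \<Omega> (inradius \<Omega> * s) \<in> sets lebesgue"
      using \<Omega>(1) by auto
    show "(trunc_bdist \<Omega> (1 / s) x)\<^sup>2 = 0" if "x \<in> \<Omega> - (\<Omega> - inner_parallel \<Omega> (inradius \<Omega> * s))" for x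
      using that assms by (auto simp: inner_parallel_def trunc_bdist_def field_simps)
  qed (use domain_sets[OF \<Omega>] in auto)
  finally show ?thesis .
qed

text \<open>The factor 1 / s^2 is moved under the integral because d / s < r on the region, which
  bounds the integrand by r^2 uniformly in s down to 0. At s = 0 the integrand is 0, and at each
  fixed point of \<Omega> it is 0 for all small s, because d > 0 there.\<close>

lemma continuous_on_I2_quotient:
  "continuous_on {0..} (\<lambda>s. \<integral>x. (if bdist \<Omega> x < inradius \<Omega> * s then (bdist \<Omega> x / s)\<^sup>2 else 0) \<partial>lebesgue_on \<Omega>)"
  unfolding continuous_on_sequentially comp_def
proof (intro allI ballI impI)
  fix X :: "nat \<Rightarrow> real" and s assume s: "s \<in> {0..}" and "(\<forall>n. X n \<in> {0..}) \<and> X \<longlonglongrightarrow> s"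
  then have X: "\<And>n. X n \<ge> 0" "X \<longlonglongrightarrow> s" by auto
  let ?k = "\<lambda>s x. if bdist \<Omega> x < inradius \<Omega> * s then (bdist \<Omega> x / s)\<^sup>2 else 0"
  note [measurable] = bdist_measurable[of \<Omega> \<Omega>]
  have km: "?k s \<in> borel_measurable (lebesgue_on \<Omega>)" for s by measurable
  have r: "inradius \<Omega> > 0" by (rule inradius_pos[OF \<Omega>])
  show "(\<lambda>n. \<integral>x. ?k (X n) x \<partial>lebesgue_on \<Omega>) \<longlonglongrightarrow> (\<integral>x. ?k s x \<partial>lebesgue_on \<Omega>)"
  proof (rule integral_dominated_convergence[where w = "\<lambda>_. (inradius \<Omega>)\<^sup>2"])
    show "AE x in lebesgue_on \<Omega>. norm (?k (X n) x) \<le> (inradius \<Omega>)\<^sup>2" for n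
    proof (rule AE_I2)
      fix x
      show "norm (?k (X n) x) \<le> (inradius \<Omega>)\<^sup>2"
      proof (cases "bdist \<Omega> x < inradius \<Omega> * X n")
        case True
        then have "X n > 0" using X(1)[of n] bdist_nonneg[of \<Omega> x] r
          by (metis mult_zero_right not_less order_le_less)
        then have "bdist \<Omega> x / X n \<le> inradius \<Omega>" using True by (simp add: field_simps)
        moreover have "0 \<le> bdist \<Omega> x / X n" using X(1)[of n] bdist_nonneg[of \<Omega> x] by simp
        ultimately show ?thesis using True by (simp add: power_mono del: power_divide)
      qed simp
    qed
    have "negligible {x\<in>\<Omega>. \<not> bdist \<Omega> x \<noteq> inradius \<Omega> * s}"
    proof (cases "s = 0")
      case True
      then have "{x\<in>\<Omega>. \<not> bdist \<Omega> x \<noteq> inradius \<Omega> * s} = {}" using bdist_pos[OF \<Omega>] by force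
      then show ?thesis by (simp only: negligible_empty)
    next
      case False
      then show ?thesis using negligible_bdist_level[OF \<Omega>, of "inradius \<Omega> * s" \<Omega>] r s by simp
    qed
    then have "AE x in lebesgue_on \<Omega>. bdist \<Omega> x \<noteq> inradius \<Omega> * s"
      using domain_sets[OF \<Omega>] by (subst AE_lebesgue_on_iff_negligible) auto
    then show "AE x in lebesgue_on \<Omega>. (\<lambda>n. ?k (X n) x) \<longlonglongrightarrow> ?k s x"
    proof eventually_elim
      case (elim x)
      have lim: "(\<lambda>n. inradius \<Omega> * X n) \<longlonglongrightarrow> inradius \<Omega> * s"
        by (intro tendsto_mult tendsto_const X)
      show ?case
      proof (cases "bdist \<Omega> x < inradius \<Omega> * s")
        case True
        then have "s \<noteq> 0" using bdist_nonneg[of \<Omega> x] by auto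
        have "\<forall>\<^sub>F n in sequentially. bdist \<Omega> x < inradius \<Omega> * X n"
          by (rule order_tendstoD(1)[OF lim True])
        then have "\<forall>\<^sub>F n in sequentially. (bdist \<Omega> x / X n)\<^sup>2 = ?k (X n) x"
          by eventually_elim simp
        moreover have "(\<lambda>n. (bdist \<Omega> x / X n)\<^sup>2) \<longlonglongrightarrow> (bdist \<Omega> x / s)\<^sup>2"
          using \<open>s \<noteq> 0\<close> by (intro tendsto_power tendsto_divide tendsto_const X)
        ultimately show ?thesis using True Lim_transform_eventually by fastforce
      next
        case False
        then have "inradius \<Omega> * s < bdist \<Omega> x" using elim by simp
        from order_tendstoD(2)[OF lim this]
        have "\<forall>\<^sub>F n in sequentially. 0 = ?k (X n) x" by eventually_elim simp
        from Lim_transform_eventually[OF tendsto_const this] False show ?thesis by simp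
      qed
    qed
  qed (use km in auto)
qed

lemma I2_quotient_eq:
  assumes "s > 0"
  shows "(\<integral>x. (if bdist \<Omega> x < inradius \<Omega> * s then (bdist \<Omega> x / s)\<^sup>2 else 0) \<partial>lebesgue_on \<Omega>) = I2 \<Omega> s / s\<^sup>2"
proof -
  have "(\<integral>x. (if bdist \<Omega> x < inradius \<Omega> * s then (bdist \<Omega> x / s)\<^sup>2 else 0) \<partial>lebesgue_on \<Omega>) =
      (\<integral>x. (trunc_bdist \<Omega> (1 / s) x)\<^sup>2 / s\<^sup>2 \<partial>lebesgue_on \<Omega>)"
    using assms by (intro Bochner_Integration.integral_cong)
      (auto simp: trunc_bdist_def field_simps)
  then show ?thesis by (simp add: I2_eq_trunc_energy[OF assms] trunc_energy_def)
qed

lemma I2_pos: "s > 0 \<Longrightarrow> I2 \<Omega> s > 0"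
  by (simp add: I2_eq_trunc_energy trunc_energy_pos)

text \<open>Below 1 the cut-off c d < r holds at every point of \<Omega>. The value c = 1 belongs to
  the switching time, which the almost-everywhere statement of the flow leaves out.\<close>

lemma trunc_energy_eq_L2_norm:
  assumes "0 \<le> c" "c < 1"
  shows "trunc_energy \<Omega> c = (L2_norm \<Omega> (bdist \<Omega>))\<^sup>2"
proof -
  have "trunc_bdist \<Omega> c x = bdist \<Omega> x" if "x \<in> \<Omega>" for x
  proof -
    have "c * bdist \<Omega> x < 1 * bdist \<Omega> x" using assms bdist_pos[OF \<Omega> that] by (intro mult_strict_right_mono)
    then show ?thesis using bdist_le_inradius[OF \<Omega> that] by (simp add: trunc_bdist_def)
  qed
  then have "trunc_energy \<Omega> c = L2_inner \<Omega> (bdist \<Omega>) (bdist \<Omega>)"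
    unfolding trunc_energy_def L2_inner_def
    by (intro Bochner_Integration.integral_cong) (auto simp: power2_eq_square)
  moreover have "0 \<le> L2_inner \<Omega> (bdist \<Omega>) (bdist \<Omega>)"
    unfolding L2_inner_def by (intro integral_nonneg_AE) auto
  ultimately show ?thesis by (simp add: L2_norm_def)
qed

lemma flow_exists:
  "\<exists>T>0. \<exists>g. solves_ivp \<Omega> T g \<and>
    solves_gradient_flow \<Omega> (J_fun \<Omega>) (\<lambda>x. inradius \<Omega>) (flow_solution \<Omega> T g)"
proof -
  let ?h = "\<lambda>s. \<integral>x. (if bdist \<Omega> x < inradius \<Omega> * s then (bdist \<Omega> x / s)\<^sup>2 else 0) \<partial>lebesgue_on \<Omega>"
  have hc: "continuous_on {0..2} ?h"
    by (rule continuous_on_subset[OF continuous_on_I2_quotient]) auto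
  have hpos: "0 < ?h s" if "s > 0" for s
    unfolding I2_quotient_eq[OF that] using that I2_pos[OF that] by simp
  obtain T g where g: "T > 0" "continuous_on {0..T} g" "g 0 = 0" "g T = 1"
    "\<And>t. t \<in> {0<..T} \<Longrightarrow> 0 < g t \<and> g t \<le> 1 \<and> (g has_real_derivative 1 / ?h (g t)) (at t)"
    by (rule autonomous_ivp[OF hc hpos], assumption) (rule that)
  have gp: "0 < g t" "g t \<le> 1" if "t \<in> {0<..T}" for t using g(5)[OF that] by auto
  have gD: "(g has_real_derivative (g t)\<^sup>2 / I2 \<Omega> (g t)) (at t)" if t: "t \<in> {0<..T}" for t
  proof -
    have "1 / ?h (g t) = (g t)\<^sup>2 / I2 \<Omega> (g t)" by (simp only: I2_quotient_eq[OF gp(1)[OF t]]) simp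
    then show ?thesis using g(5)[OF t] by simp
  qed
  have ivp: "solves_ivp \<Omega> T g"
    unfolding solves_ivp_def using g(2,3) gp gD by (auto intro: has_field_derivative_at_within)
  define N where "N = (L2_norm \<Omega> (bdist \<Omega>))\<^sup>2"
  have N: "N > 0" using trunc_energy_pos[of 0] trunc_energy_eq_L2_norm[of 0] by (simp add: N_def)
  \<comment> \<open>The slope -1 / N solves the normalisation k N = 1 for untruncated multiples of
    d, and e T = 1 matches 1 / g at \<open>T\<close>; extinction follows at
    \<open>T + N\<close>.\<close>
  define e where "e t = 1 / N * max (N + T - t) 0" for t
  define c where "c t = (if t < T then 1 / g t else e t)" for t
  have e01: "0 \<le> e t" "e t \<le> 1" if "t \<ge> T" for t
    using that N by (auto simp: e_def field_simps)
  have cT: "c T = 1" using N by (simp add: c_def e_def)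
  have c_eq: "c t = 1 / g t" if "t \<in> {0<..T}" for t
    using that cT g(4) by (auto simp: c_def)
  have sol: "flow_solution \<Omega> T g t x = (if t = 0 then inradius \<Omega> else profile \<Omega> (c t) x)" if x: "x \<in> \<Omega>" for t x
  proof (cases "t = 0 \<or> t < T")
    case True
    then show ?thesis by (auto simp: flow_solution_def profile_def c_def)
  next
    \<comment> \<open>From \<open>T\<close> on \<open>flow_solution\<close> has no truncation; since
      e t <= 1 and d <= r, the one in \<open>profile\<close> is void.\<close>
    case False
    then have "e t * bdist \<Omega> x \<le> 1 * bdist \<Omega> x"
      using e01 bdist_nonneg[of \<Omega> x] by (intro mult_right_mono) auto
    then have "e t * bdist \<Omega> x \<le> inradius \<Omega>" using bdist_le_inradius[OF \<Omega> x] by simp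
    then show ?thesis using False by (simp add: flow_solution_def profile_def c_def e_def N_def)
  qed
  have inv_D: "((\<lambda>t. 1 / g t) has_real_derivative - (1 / I2 \<Omega> (g t))) (at t)" if t: "t \<in> {0<..T}" for t
  proof -
    have "((\<lambda>t. inverse (g t)) has_real_derivative
        - (inverse (g t) * ((g t)\<^sup>2 / I2 \<Omega> (g t)) * inverse (g t))) (at t)"
      using gp(1)[OF t] by (intro DERIV_inverse' gD[OF t]) simp
    moreover have "inverse (g t) * ((g t)\<^sup>2 / I2 \<Omega> (g t)) * inverse (g t) = 1 / I2 \<Omega> (g t)"
      using gp(1)[OF t] by (simp add: power2_eq_square inverse_eq_divide)
    ultimately show ?thesis by (simp add: inverse_eq_divide)
  qed
  have Lip1: "\<exists>L\<ge>0. \<forall>s\<in>{a..T}. \<forall>t\<in>{a..T}. \<bar>c s - c t\<bar> \<le> L * \<bar>s - t\<bar>" if a: "a > 0" for a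
  proof -
    have gca: "continuous_on {a..T} g" using g(2) a by (auto intro: continuous_on_subset)
    have hca: "continuous_on {a..T} (\<lambda>t. ?h (g t))"
      using a gp by (intro continuous_on_compose2[OF continuous_on_I2_quotient gca]) (auto intro: less_imp_le)
    \<comment> \<open>This is 1 / I2 (g t), written through \<open>?h\<close> because continuity is
      known for \<open>?h\<close>. Its bound on the compact interval is the Lipschitz
      constant.\<close>
    have "continuous_on {a..T} (\<lambda>t. 1 / (?h (g t) * (g t)\<^sup>2))"
    proof (intro continuous_on_divide continuous_on_mult continuous_on_power continuous_on_const hca gca ballI)
      fix t assume "t \<in> {a..T}"
      then have "0 < g t" using a gp by auto
      then show "?h (g t) * (g t)\<^sup>2 \<noteq> 0" using hpos[of "g t"] by simp
    qed
    then have "compact ((\<lambda>t. 1 / (?h (g t) * (g t)\<^sup>2)) ` {a..T})"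
      by (intro compact_continuous_image) auto
    then obtain B where B: "\<forall>y\<in>(\<lambda>t. 1 / (?h (g t) * (g t)\<^sup>2)) ` {a..T}. norm y \<le> B"
      by (meson compact_imp_bounded bounded_iff)
    have "\<bar>c s - c t\<bar> \<le> max B 0 * \<bar>s - t\<bar>" if st: "s \<in> {a..T}" "t \<in> {a..T}" for s t
    proof -
      have "norm (1 / g s - 1 / g t) \<le> max B 0 * norm (s - t)"
      proof (rule field_differentiable_bound[of "{a..T}"])
        fix x assume x: "x \<in> {a..T}"
        then have x': "x \<in> {0<..T}" using a by auto
        show "((\<lambda>t. 1 / g t) has_field_derivative - (1 / I2 \<Omega> (g x))) (at x within {a..T})"
          using inv_D[OF x'] by (rule has_field_derivative_at_within)
        have eq: "?h (g x) * (g x)\<^sup>2 = I2 \<Omega> (g x)"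
          using gp(1)[OF x'] by (simp only: I2_quotient_eq[OF gp(1)[OF x']]) simp
        have "norm (1 / (?h (g x) * (g x)\<^sup>2)) \<le> B" using B x by blast
        then show "norm (- (1 / I2 \<Omega> (g x))) \<le> max B 0"
          unfolding eq norm_minus_cancel by (rule max.coboundedI1)
      qed (use st in auto)
      then show ?thesis using st a by (simp add: c_eq)
    qed
    then show ?thesis by (intro exI[of _ "max B 0"]) auto
  qed
  have Lip2: "\<bar>c s - c t\<bar> \<le> 1 / N * \<bar>s - t\<bar>" if "s \<ge> T" "t \<ge> T" for s t
  proof -
    have "c s - c t = 1 / N * (max (N + T - s) 0 - max (N + T - t) 0)"
      using that by (simp add: c_def e_def right_diff_distrib)
    then have "\<bar>c s - c t\<bar> = 1 / N * \<bar>max (N + T - s) 0 - max (N + T - t) 0\<bar>"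
      using N by (simp add: abs_mult)
    also have "\<dots> \<le> 1 / N * \<bar>s - t\<bar>" using N by (intro mult_left_mono) auto
    finally show ?thesis .
  qed
  have Lip: "\<exists>L. \<forall>s\<ge>a. \<forall>t\<ge>a. \<bar>c s - c t\<bar> \<le> L * \<bar>s - t\<bar>" if a: "a > 0" for a
  proof -
    obtain L where L: "L \<ge> 0" "\<And>s t. s \<in> {a..T} \<Longrightarrow> t \<in> {a..T} \<Longrightarrow> \<bar>c s - c t\<bar> \<le> L * \<bar>s - t\<bar>"
      using Lip1[OF a] by blast
    \<comment> \<open>\<open>K\<close> majorises the constants of both branches, so that the
      estimate for two times on opposite sides of \<open>T\<close> can be split at
      \<open>T\<close>.\<close>
    define K where "K = L + 1 / N"
    have K: "L \<le> K" "1 / N \<le> K" using L(1) N by (auto simp: K_def)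
    have K1: "\<bar>c s - c t\<bar> \<le> K * \<bar>s - t\<bar>" if "s \<in> {a..T}" "t \<in> {a..T}" for s t
      using L(2)[OF that] mult_right_mono[OF K(1), of "\<bar>s - t\<bar>"] by linarith
    have K2: "\<bar>c s - c t\<bar> \<le> K * \<bar>s - t\<bar>" if "s \<ge> T" "t \<ge> T" for s t
      using Lip2[OF that] mult_right_mono[OF K(2), of "\<bar>s - t\<bar>"] by linarith
    have K3: "\<bar>c s - c t\<bar> \<le> K * \<bar>s - t\<bar>" if st: "a \<le> s" "s \<le> t" for s t
    proof -
      consider "t \<le> T" | "T \<le> s" | "s \<le> T" "T \<le> t" by linarith
      then show ?thesis
      proof cases
        case 1
        then show ?thesis using st by (intro K1) auto
      next
        case 2
        then show ?thesis using st by (intro K2) auto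
      next
        case 3
        have "\<bar>c s - c T\<bar> \<le> K * \<bar>s - T\<bar>" using 3 st by (intro K1) auto
        moreover have "\<bar>c T - c t\<bar> \<le> K * \<bar>T - t\<bar>" using 3 by (intro K2) auto
        moreover have "K * \<bar>s - T\<bar> + K * \<bar>T - t\<bar> = K * \<bar>s - t\<bar>"
          using 3 by (simp flip: distrib_left)
        ultimately show ?thesis by linarith
      qed
    qed
    have "\<bar>c s - c t\<bar> \<le> K * \<bar>s - t\<bar>" if "s \<ge> a" "t \<ge> a" for s t
      using K3[of s t] K3[of t s] that by (cases "s \<le> t") (auto simp: abs_minus_commute)
    then show ?thesis by blast
  qed
  have nonneg: "c t \<ge> 0" if "t > 0" for t
    using that gp[of t] e01[of t] by (auto simp: c_def less_imp_le)
  have blowup: "filterlim c at_top (at_right 0)"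
  proof -
    have "(g \<longlongrightarrow> g 0) (at 0 within {0..T})"
      using g(1,2) unfolding continuous_on_def by auto
    then have "(g \<longlongrightarrow> 0) (at_right 0)"
      using g(1,3) at_within_Icc_at_right[of 0 T] by simp
    moreover have ev: "\<forall>\<^sub>F t in at_right 0. t \<in> {0<..<T}"
      using g(1) by (simp add: eventually_at_right_field) (metis greaterThanLessThan_iff)
    have "\<forall>\<^sub>F t in at_right 0. 0 < g t"
      using ev by eventually_elim (use gp in auto)
    ultimately have "filterlim (\<lambda>t. inverse (g t)) at_top (at_right 0)"
      by (intro filterlim_inverse_at_top)
    moreover have eq: "\<forall>\<^sub>F t in at_right 0. inverse (g t) = c t"
      using ev by eventually_elim (simp add: c_def inverse_eq_divide)
    ultimately show ?thesis by (simp only: filterlim_cong[OF refl refl eq])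
  qed
  \<comment> \<open>The three branches meet at \<open>T\<close> and \<open>T + N\<close>, and these
    two times are left out; at \<open>T + N\<close> the slope jumps from -1 / N to 0.\<close>
  have speed: "\<exists>k. (c has_real_derivative - k) (at t) \<and> k \<ge> 0 \<and>
      (k * trunc_energy \<Omega> (c t) = 1 \<or> k = 0 \<and> c t = 0)"
    if t: "t > 0" "t \<noteq> T" "t \<noteq> T + N" for t
  proof -
    consider "t < T" | "T < t" "t < T + N" | "T + N < t" using t by linarith
    then show ?thesis
    proof cases
      case 1
      then have t': "t \<in> {0<..T}" using t by simp
      have "(c has_real_derivative - (1 / I2 \<Omega> (g t))) (at t)"
        using inv_D[OF t'] by (rule has_field_derivative_transform_within_open[where S = "{..<T}"])
          (use 1 in \<open>auto simp: c_def\<close>)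
      moreover have "1 / I2 \<Omega> (g t) * trunc_energy \<Omega> (c t) = 1"
        using I2_eq_trunc_energy[OF gp(1)[OF t']] I2_pos[OF gp(1)[OF t']] 1 by (simp add: c_def)
      ultimately show ?thesis using I2_pos[OF gp(1)[OF t']] by (intro exI[of _ "1 / I2 \<Omega> (g t)"]) auto
    next
      case 2
      have "((\<lambda>t. 1 / N * (N + T - t)) has_real_derivative - (1 / N)) (at t)"
        using N by (auto intro!: derivative_eq_intros)
      then have "(c has_real_derivative - (1 / N)) (at t)"
        by (rule has_field_derivative_transform_within_open[where S = "{T<..<T + N}"])
          (use 2 in \<open>auto simp: c_def e_def\<close>)
      moreover have "0 \<le> c t" "c t < 1"
        using 2 N by (auto simp: c_def e_def field_simps)
      then have "1 / N * trunc_energy \<Omega> (c t) = 1"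
        using N by (simp add: trunc_energy_eq_L2_norm N_def)
      ultimately show ?thesis using N by (intro exI[of _ "1 / N"]) auto
    next
      case 3
      have "((\<lambda>t. 0) has_real_derivative 0) (at t)" by simp
      then have "(c has_real_derivative 0) (at t)"
        by (rule has_field_derivative_transform_within_open[where S = "{T + N<..}"])
          (use 3 N in \<open>auto simp: c_def e_def\<close>)
      moreover have "c t = 0" using 3 N by (simp add: c_def e_def)
      ultimately show ?thesis by (intro exI[of _ 0]) auto
    qed
  qed
  have "AE t in lebesgue. t \<noteq> T \<and> t \<noteq> T + N"
    using AE_completion[OF AE_conjI[OF AE_lborel_singleton[of T] AE_lborel_singleton[of "T + N"]]] .
  then have "AE t in lebesgue. 0 < t \<longrightarrow> (\<exists>k. (c has_real_derivative - k) (at t) \<and> k \<ge> 0 \<and>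
      (k * trunc_energy \<Omega> (c t) = 1 \<or> k = 0 \<and> c t = 0))"
    by eventually_elim (use speed in blast)
  from profile_solves_gradient_flow[OF \<Omega> nonneg blowup Lip this sol] ivp g(1)
  show ?thesis by blast
qed

end

theorem theorem3p6:
  fixes \<Omega> :: "(real ^ 'n) set"
  assumes "open \<Omega>" and "connected \<Omega>" and "\<Omega> \<noteq> {}" and "bounded \<Omega>"
    and "admits_perimeter_bound \<Omega>"
  shows "\<exists>t\<^sub>s>0. \<exists>g. solves_ivp \<Omega> t\<^sub>s g \<and>
    solves_gradient_flow \<Omega> (J_fun \<Omega>) (\<lambda>x. inradius \<Omega>) (flow_solution \<Omega> t\<^sub>s g)"
  using flow_exists[OF assms(1,4,3)] .

end
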